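(* Suppose that for each $1\le n\le N$ the function $\overline\ell_n(\vartheta_{0:n})$ is twice differentiable and that, for any compact subset $K$ of $\{\mathbb{R}^p\}^{n+1}$ and each $0\le i\le n$, $$\sup_{\vartheta_{0:n}\in K}|\nabla_i\overline\ell_n(\vartheta_{0:n})|<\infty\quad\text{and}\quad\sup_{\vartheta_{0:n}\in K}|\nabla_i^2\overline\ell_n(\vartheta_{0:n})|<\infty.$$ Let $\sigma=\sigma(\tau)$ be a (positive) function of $\tau>0$ with $\lim_{\tau\to0}\sigma(\tau)/\tau=0$. Then for any compact set $K_4\subset\mathbb{R}^p$ there exists a finite constant $C_9$ such that, for all $\tau$ small enough, $$\sup_{\theta\in K_4}\left|\tau^{-2}\Sigma^{-1}\big(\breve\theta^F_N-\theta\big)-\nabla\ell_N(\theta)\right|\le C_9(\tau+\sigma^2/\tau^2)$$ and $$\sup_{\theta\in K_4}\left|\sum_{n=1}^N\big(\breve V^P_n\big)^{-1}\big(\breve\theta^F_n-\breve\theta^F_{n-1}\big)-\nabla\ell_N(\theta)\right|\le C_9(\tau+\sigma^2/\tau^2),$$ where $\breve\theta^F_n=\breve\theta^F_n(\theta,\sigma,\tau)$ and $\breve V^P_n=\breve V^P_n(\theta,\sigma,\tau)$.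
   Context: POMP (partially observed Markov process) model: $X_{0:N}=(X_0,\ldots,X_N)$ is a Markov process with values in a measurable space $\mathfrak{X}$ and $Y_{1:N}=(Y_1,\ldots,Y_N)$ are observations with values in a measurable space $\mathfrak{Y}$, with a joint density (with respect to a product of $\sigma$-finite measures) depending on $\theta\in\mathbb{R}^p$ and specified by an initial density $f_{X_0}(x_0;\theta)$, transition densities $f_{X_n|X_{n-1}}(x_n\mid x_{n-1};\theta)$ and observation densities $f_{Y_n|X_n}(y_n\mid x_n;\theta)$, $1\le n\le N$ (given $X_{0:n}$ and $Y_{1:n-1}$, $Y_n$ depends only on $X_n$). The data $y^*_{1:N}=(y^*_1,\ldots,y^*_N)\in\mathfrak{Y}^N$ are fixed. Time-varying-parameter model: for $\vartheta_{0:N}=(\vartheta_0,\ldots,\vartheta_N)\in\{\mathbb{R}^p\}^{N+1}$, let $$\overline f_{\overline X_{0:N},\overline Y_{1:N}}(x_{0:N},y_{1:N};\vartheta_{0:N})=f_{X_0}(x_0;\vartheta_0)\prod_{k=1}^Nf_{X_k|X_{k-1}}(x_k\mid x_{k-1};\vartheta_k)f_{Y_k|X_k}(y_k\mid x_k;\vartheta_k).$$ Its log likelihood is, for $1\le n\le N$, $$\overline\ell_n(\vartheta_{0:n})=\log\int f_{X_0}(x_0;\vartheta_0)\prod_{k=1}^nf_{X_k|X_{k-1}}(x_k\mid x_{k-1};\vartheta_k)f_{Y_k|X_k}(y^*_k\mid x_k;\vartheta_k)\,dx_{0:n}.$$ For $\theta\in\mathbb{R}^p$, $\theta^{[k]}$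 denotes $k$ concatenated copies of $\theta$, and $\ell_n(\theta)=\overline\ell_n(\theta^{[n+1]})$ is the log likelihood of the original model. $\nabla_i\overline\ell_n$ is the gradient with respect to $\vartheta_i$ and $\nabla_i^2\overline\ell_n$ the matrix of second derivatives with respect to $\vartheta_i$. Stochastically perturbed model: let $\kappa$ be a probability density on $\mathbb{R}^p$ with compact support, zero mean and covariance matrix $\Sigma$; let $Z_0,\ldots,Z_N$ be independent draws from $\kappa$. For perturbation parameters $\sigma,\tau>0$ set $\breve\Theta_0=\vartheta_0+\tau Z_0$ and $\breve\Theta_k=\vartheta_k+\tau Z_0+\sigma\sum_{j=1}^kZ_j$ for $1\le k\le N$, and write $g_{\breve\Theta_{0:N}}(\breve\vartheta_{0:N};\vartheta_{0:N},\sigma,\tau)$ for the joint density of $\breve\Theta_{0:N}$. The model $g$ for $(\breve X_{0:N},\breve\Theta_{0:N},\breve Y_{1:N})$ has joint density $$g_{\breve\Theta_{0:N}}(\breve\vartheta_{0:N};\vartheta_{0:N},\sigma,\tau)\,\overline f_{\overline X_{0:N},\overline Y_{1:N}}(x_{0:N},y_{1:N};\breve\vartheta_{0:N}).$$ $\breve{\mathbb{E}}_{\vartheta_{0:n},\sigma,\tau}$ and $\breve{\operatorname{Var}}_{\vartheta_{0:n},\sigma,\tau}$ denote expectation and variance (covariance matrix) under $g$. Define the filtering means and prediction variances $$\breve\theta^F_n(\theta,\sigma,\tau)=\breve{\mathbb{E}}_{\theta^{[n+1]},\sigma,\tau}[\breve\Theta_n\mid\breve Y_{1:n}=y^*_{1:n}],\qquad\breve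 V^P_n(\theta,\sigma,\tau)=\breve{\operatorname{Var}}_{\theta^{[n+1]},\sigma,\tau}(\breve\Theta_n\mid\breve Y_{1:n-1}=y^*_{1:n-1})$$ for $n=1,\ldots,N$ (no conditioning in $\breve V^P_1$), and $\breve\theta^F_0=\theta$. $|\cdot|$ is the absolute value (norm) of a vector or the largest absolute eigenvalue of a square matrix.
   Formalization: The mixed second derivatives of the log likelihoods (in ϑ_i and ϑ_j, i≠j) are also assumed bounded on compact sets; this is automatic if they are twice continuously differentiable, and without it the claim can fail when κ has a nonzero third moment. *)

theory Defs
  imports "HOL-Probability.Probability"
begin

definition gradient :: "('a::real_inner \<Rightarrow> real) \<Rightarrow> 'a \<Rightarrow> 'a" where
  "gradient f x = (THE D. GDERIV f x :> D)"

definition hessian :: "(real ^ 'p::finite \<Rightarrow> real) \<Rightarrow> real ^ 'p \<Rightarrow> real ^ 'p ^ 'p" where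
  "hessian f x = matrix (frechet_derivative (gradient f) (at x))"

text \<open>Nonreal eigenvalues count as well, hence the passage to complex matrices.\<close>

definition eig_norm :: "real ^ 'p::finite ^ 'p \<Rightarrow> real" where
  "eig_norm A = Sup {cmod c | c. \<exists>v :: complex ^ 'p. v \<noteq> 0 \<and> map_matrix complex_of_real A *v v = c *s v}"

definition cov_matrix :: "'w measure \<Rightarrow> ('w \<Rightarrow> real ^ 'p::finite) \<Rightarrow> real ^ 'p ^ 'p" where
  "cov_matrix M X = (\<chi> i j. \<integral>w. (X w $ i - (\<integral>w. X w \<partial>M) $ i) * (X w $ j - (\<integral>w. X w \<partial>M) $ j) \<partial>M)"

text \<open>
  A tuple with entries indexed by \<open>0, \<dots>, n\<close> is a function on \<open>nat\<close> whose values beyond \<open>n\<close> are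
  ignored; the functions \<open>F\<close> below only look at the entries up to \<open>n\<close>. The length varies within
  one statement, so these spaces are not types and Frechet differentiability is spelled out.
\<close>

definition tuple_norm :: "nat \<Rightarrow> (nat \<Rightarrow> 'a::real_normed_vector) \<Rightarrow> real" where
  "tuple_norm n h = L2_set (\<lambda>i. norm (h i)) {..n}"

text \<open>The derivative is the linear map taking \<open>h\<close> to the sum of the \<open>D i (h i)\<close>.\<close>

definition tuple_has_derivative ::
  "nat \<Rightarrow> ((nat \<Rightarrow> 'a::real_normed_vector) \<Rightarrow> 'b::real_normed_vector)
    \<Rightarrow> (nat \<Rightarrow> 'a \<Rightarrow> 'b) \<Rightarrow> (nat \<Rightarrow> 'a) \<Rightarrow> bool" where
  "tuple_has_derivative n F D \<theta> \<longleftrightarrow>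
     (\<forall>i\<le>n. bounded_linear (D i)) \<and>
     (\<forall>e>0. \<exists>d>0. \<forall>h. tuple_norm n h < d \<longrightarrow>
        norm (F (\<lambda>i. \<theta> i + h i) - F \<theta> - (\<Sum>i\<le>n. D i (h i))) \<le> e * tuple_norm n h)"

definition tuple_differentiable ::
  "nat \<Rightarrow> ((nat \<Rightarrow> 'a::real_normed_vector) \<Rightarrow> 'b::real_normed_vector) \<Rightarrow> (nat \<Rightarrow> 'a) \<Rightarrow> bool" where
  "tuple_differentiable n F \<theta> \<longleftrightarrow> (\<exists>D. tuple_has_derivative n F D \<theta>)"

definition pgrad :: "nat \<Rightarrow> ((nat \<Rightarrow> 'a::real_inner) \<Rightarrow> real) \<Rightarrow> (nat \<Rightarrow> 'a) \<Rightarrow> 'a" where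
  "pgrad i F \<theta> = gradient (\<lambda>v. F (\<theta>(i := v))) (\<theta> i)"

definition phess ::
  "nat \<Rightarrow> ((nat \<Rightarrow> real ^ 'p::finite) \<Rightarrow> real) \<Rightarrow> (nat \<Rightarrow> real ^ 'p) \<Rightarrow> real ^ 'p ^ 'p" where
  "phess i F \<theta> = hessian (\<lambda>v. F (\<theta>(i := v))) (\<theta> i)"

text \<open>
  The derivative with respect to \<open>\<theta> j\<close> of the gradient with respect to \<open>\<theta> i\<close>. Pointwise twice
  differentiability and local bounds on the blocks \<open>phess i F\<close> do not imply local bounds on the
  blocks with \<open>i \<noteq> j\<close>: consider suitable sums of smooth truncations of
  \<open>x * y * ln (x\<^sup>2 + y\<^sup>2 + e)\<close> for \<open>e\<close> tending to \<open>0\<close>.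
\<close>

definition pmixed :: "nat \<Rightarrow> nat \<Rightarrow> ((nat \<Rightarrow> 'a::real_inner) \<Rightarrow> real) \<Rightarrow> (nat \<Rightarrow> 'a) \<Rightarrow> 'a \<Rightarrow> 'a" where
  "pmixed j i F \<theta> = frechet_derivative (\<lambda>v. pgrad i F (\<theta>(j := v))) (at (\<theta> j))"

definition tuple_twice_differentiable ::
  "nat \<Rightarrow> ((nat \<Rightarrow> 'a::real_inner) \<Rightarrow> real) \<Rightarrow> bool" where
  "tuple_twice_differentiable n F \<longleftrightarrow>
     (\<forall>\<theta>. tuple_differentiable n F \<theta> \<and> (\<forall>i\<le>n. tuple_differentiable n (pgrad i F) \<theta>))"

text \<open>
  The argument order of the densities follows the usual notation: \<open>trans P k x' x \<theta>\<close> is the density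
  of \<open>X\<^sub>k\<close> at \<open>x'\<close> given that \<open>X\<close> is at \<open>x\<close> at time \<open>k - 1\<close>, and \<open>obs P k y x \<theta>\<close> is the density of
  \<open>Y\<^sub>k\<close> at \<open>y\<close> given \<open>X\<^sub>k = x\<close>, with respect to \<open>state_meas P k\<close> and \<open>obs_meas P k\<close>.
\<close>

record ('p, 'x, 'y) pomp =
  state_meas :: "nat \<Rightarrow> 'x measure"
  obs_meas :: "nat \<Rightarrow> 'y measure"
  init :: "'x \<Rightarrow> 'p \<Rightarrow> real"
  trans :: "nat \<Rightarrow> 'x \<Rightarrow> 'x \<Rightarrow> 'p \<Rightarrow> real"
  obs :: "nat \<Rightarrow> 'y \<Rightarrow> 'x \<Rightarrow> 'p \<Rightarrow> real"

text \<open>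
  Measurability is joint in the parameter as well, since the parameter becomes a random variable
  in the perturbed model.
\<close>

definition pomp_model ::
  "nat \<Rightarrow> 'x measure \<Rightarrow> 'y measure \<Rightarrow> ('p::topological_space, 'x, 'y) pomp \<Rightarrow> bool" where
  "pomp_model N MX MY P \<longleftrightarrow>
     (\<forall>k\<le>N. sigma_finite_measure (state_meas P k) \<and> sets (state_meas P k) = sets MX) \<and>
     (\<forall>k\<in>{1..N}. sigma_finite_measure (obs_meas P k) \<and> sets (obs_meas P k) = sets MY) \<and>
     (\<lambda>(x, \<theta>). init P x \<theta>) \<in> borel_measurable (MX \<Otimes>\<^sub>M borel) \<and>
     (\<forall>k\<in>{1..N}. (\<lambda>(x', x, \<theta>). trans P k x' x \<theta>) \<in> borel_measurable (MX \<Otimes>\<^sub>M MX \<Otimes>\<^sub>M borel)) \<and>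
     (\<forall>k\<in>{1..N}. (\<lambda>(y, x, \<theta>). obs P k y x \<theta>) \<in> borel_measurable (MY \<Otimes>\<^sub>M MX \<Otimes>\<^sub>M borel)) \<and>
     (\<forall>\<theta>. \<forall>x\<in>space MX. 0 \<le> init P x \<theta>) \<and>
     (\<forall>k\<in>{1..N}. \<forall>\<theta>. \<forall>x\<in>space MX. \<forall>x'\<in>space MX. 0 \<le> trans P k x' x \<theta>) \<and>
     (\<forall>k\<in>{1..N}. \<forall>\<theta>. \<forall>x\<in>space MX. \<forall>y\<in>space MY. 0 \<le> obs P k y x \<theta>) \<and>
     (\<forall>\<theta>. (\<integral>\<^sup>+x. ennreal (init P x \<theta>) \<partial>state_meas P 0) = 1) \<and>
     (\<forall>k\<in>{1..N}. \<forall>\<theta>. \<forall>x\<in>space MX. (\<integral>\<^sup>+x'. ennreal (trans P k x' x \<theta>) \<partial>state_meas P k) = 1) \<and>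
     (\<forall>k\<in>{1..N}. \<forall>\<theta>. \<forall>x\<in>space MX. (\<integral>\<^sup>+y. ennreal (obs P k y x \<theta>) \<partial>obs_meas P k) = 1)"

definition joint_density ::
  "('p, 'x, 'y) pomp \<Rightarrow> nat \<Rightarrow> (nat \<Rightarrow> 'x) \<Rightarrow> (nat \<Rightarrow> 'y) \<Rightarrow> (nat \<Rightarrow> 'p) \<Rightarrow> real" where
  "joint_density P n x y \<theta> =
     init P (x 0) (\<theta> 0) *
     (\<Prod>k\<in>{1..n}. trans P k (x k) (x (k - 1)) (\<theta> k) * obs P k (y k) (x k) (\<theta> k))"

definition likelihood ::
  "('p, 'x, 'y) pomp \<Rightarrow> (nat \<Rightarrow> 'y) \<Rightarrow> nat \<Rightarrow> (nat \<Rightarrow> 'p) \<Rightarrow> ennreal" where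
  "likelihood P ys n \<theta> = (\<integral>\<^sup>+x. ennreal (joint_density P n x ys \<theta>) \<partial>PiM {..n} (state_meas P))"

text \<open>
  This is the logarithm of the likelihood only where the likelihood is positive and finite; it has
  the dummy value \<open>0\<close> elsewhere.
\<close>

definition loglik_tv :: "('p, 'x, 'y) pomp \<Rightarrow> (nat \<Rightarrow> 'y) \<Rightarrow> nat \<Rightarrow> (nat \<Rightarrow> 'p) \<Rightarrow> real" where
  "loglik_tv P ys n \<theta> = ln (enn2real (likelihood P ys n \<theta>))"

definition loglik :: "('p, 'x, 'y) pomp \<Rightarrow> (nat \<Rightarrow> 'y) \<Rightarrow> nat \<Rightarrow> 'p \<Rightarrow> real" where
  "loglik P ys n \<theta> = loglik_tv P ys n (\<lambda>_. \<theta>)"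

definition perturbation_density :: "('p::euclidean_space \<Rightarrow> real) \<Rightarrow> bool" where
  "perturbation_density \<kappa> \<longleftrightarrow>
     \<kappa> \<in> borel_measurable borel \<and> (\<forall>z. 0 \<le> \<kappa> z) \<and>
     prob_space (density lborel \<kappa>) \<and>
     compact (closure {z. \<kappa> z \<noteq> 0}) \<and>
     (\<integral>z. z \<partial>density lborel \<kappa>) = 0"

text \<open>
  For \<open>\<sigma>, \<tau> > 0\<close> this law has a density with respect to Lebesgue measure. That density is only ever
  integrated, so the law itself is used in its place.
\<close>

definition perturbed_law ::
  "('p::euclidean_space \<Rightarrow> real) \<Rightarrow> nat \<Rightarrow> (nat \<Rightarrow> 'p) \<Rightarrow> real \<Rightarrow> real \<Rightarrow> (nat \<Rightarrow> 'p) measure" where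
  "perturbed_law \<kappa> n \<theta> \<sigma> \<tau> =
     distr (PiM {..n} (\<lambda>_. density lborel \<kappa>)) (PiM {..n} (\<lambda>_. borel))
       (\<lambda>z. \<lambda>k\<in>{..n}. \<theta> k + \<tau> *\<^sub>R z 0 + \<sigma> *\<^sub>R (\<Sum>j\<in>{1..k}. z j))"

text \<open>
  The density at the data \<open>ys 1, \<dots>, ys m\<close> of the first \<open>m\<close> observations, given the parameters at
  times \<open>0, \<dots>, n\<close>: all states and the later observations are integrated out.
\<close>

definition obs_density ::
  "('p, 'x, 'y) pomp \<Rightarrow> (nat \<Rightarrow> 'y) \<Rightarrow> nat \<Rightarrow> nat \<Rightarrow> (nat \<Rightarrow> 'p) \<Rightarrow> ennreal" where
  "obs_density P ys m n \<theta> =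
     (\<integral>\<^sup>+y. (\<integral>\<^sup>+x. ennreal (joint_density P n x (\<lambda>k. if k \<le> m then ys k else y k) \<theta>)
        \<partial>PiM {..n} (state_meas P)) \<partial>PiM {m<..n} (obs_meas P))"

text \<open>
  The conditional law of the perturbed parameters at times \<open>0, \<dots>, n\<close> given that the first \<open>m\<close>
  observations are \<open>ys 1, \<dots>, ys m\<close>. Conditioning on a single value of the observations refers to
  the conditional density, i.e. the joint density divided by the marginal density at the data.
\<close>

definition cond_law ::
  "('p::euclidean_space \<Rightarrow> real) \<Rightarrow> ('p, 'x, 'y) pomp \<Rightarrow> (nat \<Rightarrow> 'y) \<Rightarrow> nat \<Rightarrow> nat
    \<Rightarrow> (nat \<Rightarrow> 'p) \<Rightarrow> real \<Rightarrow> real \<Rightarrow> (nat \<Rightarrow> 'p) measure" where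
  "cond_law \<kappa> P ys m n \<theta> \<sigma> \<tau> =
     density (perturbed_law \<kappa> n \<theta> \<sigma> \<tau>)
       (\<lambda>t. obs_density P ys m n t / (\<integral>\<^sup>+t. obs_density P ys m n t \<partial>perturbed_law \<kappa> n \<theta> \<sigma> \<tau>))"

definition filter_mean ::
  "('p::euclidean_space \<Rightarrow> real) \<Rightarrow> ('p, 'x, 'y) pomp \<Rightarrow> (nat \<Rightarrow> 'y) \<Rightarrow> nat
    \<Rightarrow> 'p \<Rightarrow> real \<Rightarrow> real \<Rightarrow> 'p" where
  "filter_mean \<kappa> P ys n \<theta> \<sigma> \<tau> =
     (if n = 0 then \<theta> else \<integral>t. t n \<partial>cond_law \<kappa> P ys n n (\<lambda>_. \<theta>) \<sigma> \<tau>)"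

definition pred_var ::
  "(real ^ 'p::finite \<Rightarrow> real) \<Rightarrow> (real ^ 'p, 'x, 'y) pomp \<Rightarrow> (nat \<Rightarrow> 'y) \<Rightarrow> nat
    \<Rightarrow> real ^ 'p \<Rightarrow> real \<Rightarrow> real \<Rightarrow> real ^ 'p ^ 'p" where
  "pred_var \<kappa> P ys n \<theta> \<sigma> \<tau> =
     cov_matrix (cond_law \<kappa> P ys (n - 1) n (\<lambda>_. \<theta>) \<sigma> \<tau>) (\<lambda>t. t n)"

end

theory Submission
  imports Defs
begin

text \<open>
  Conditioning the perturbed model on the observations reweights the law of the perturbed parameters
  by the likelihood. In the coordinates \<open>z\<close> of the independent draws, the parameter at time \<open>k\<close> is
  \<open>\<theta>\<close> plus the displacement \<open>disp \<sigma> \<tau> k z = \<tau> z\<^sub>0 + \<sigma> (z\<^sub>1 + \<dots> + z\<^sub>k)\<close>, which is \<open>O(\<tau>)\<close> because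
  the kernel has compact support and \<open>\<sigma> \<le> \<tau>\<close> for small \<open>\<tau>\<close>. A Taylor expansion, uniform for \<open>\<theta>\<close>
  in a compact set, gives the relative weight \<open>1 + (\<Sum>i\<le>n. disp \<sigma> \<tau> i z \<bullet> g i) + O(\<tau>\<^sup>2)\<close>,
  where \<open>g i\<close> is the gradient of the log likelihood with respect to the parameter at time \<open>i\<close>
  (\<open>exp_expansion_uniform\<close>, \<open>wt_expansion\<close>).

  Since the draws are independent with mean zero and covariance \<open>\<Sigma>\<close>, the displacements at times \<open>n\<close>
  and \<open>i \<le> n\<close> have mean zero and cross covariance \<open>(\<tau>\<^sup>2 + i \<sigma>\<^sup>2) \<Sigma>\<close> (\<open>integral_disp_bilinear\<close>); there
  is no term \<open>\<tau> \<sigma>\<close>. Hence the filtering mean is \<open>\<theta> + \<tau>\<^sup>2 \<Sigma> (\<Sum>i\<le>n. g i) + O(\<tau>\<^sup>3 + \<sigma>\<^sup>2)\<close>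
  (\<open>filter_mean_estimate\<close>), and the sum of the \<open>g i\<close> is the gradient of the log likelihood of the
  model with a constant parameter (\<open>gradient_diagonal\<close>). Dividing by \<open>\<tau>\<^sup>2\<close> gives the first estimate.

  For the second one, the prediction variance is \<open>\<tau>\<^sup>2 \<Sigma> + O(\<tau>\<^sup>3 + \<sigma>\<^sup>2)\<close> (\<open>pred_var_estimate\<close>), so its
  inverse may be replaced by that of \<open>\<tau>\<^sup>2 \<Sigma>\<close> at the cost of a relative error \<open>O(\<tau> + \<sigma>\<^sup>2 / \<tau>\<^sup>2)\<close>
  (\<open>inverse_perturbation\<close>). The summands then approximate the increments in \<open>n\<close> of the gradients
  of the log likelihoods, and these telescope. The matrix \<open>\<Sigma>\<close> is invertible because the kernel is
  a density.
\<close>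

section \<open>Gradients and derivatives on tuples\<close>

lemma gradient_eqI:
  assumes "GDERIV f x :> D"
  shows "gradient f x = D"
  unfolding gradient_def
proof (rule the_equality)
  fix D' assume "GDERIV f x :> D'"
  then have "(\<lambda>h. h \<bullet> D') = (\<lambda>h. h \<bullet> D)"
    using assms unfolding gderiv_def by (rule has_derivative_unique)
  then have "(D' - D) \<bullet> D' = (D' - D) \<bullet> D" by meson
  then have "(D' - D) \<bullet> (D' - D) = 0" by (simp add: inner_diff_right)
  then show "D' = D" by simp
qed (fact assms)

text \<open>
  Tuples with entries \<open>0, \<dots>, n\<close> are functions on \<open>nat\<close>, so a function of such a tuple is a
  function that does not look beyond entry \<open>n\<close>. Compactness is only available for sets of tuples
  that are \<open>undefined\<close> beyond \<open>n\<close>; this property transfers bounds from there to all tuples.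
\<close>

definition depends_upto :: "nat \<Rightarrow> ((nat \<Rightarrow> 'a) \<Rightarrow> 'b) \<Rightarrow> bool" where
  "depends_upto n F \<longleftrightarrow> (\<forall>t t'. (\<forall>i\<le>n. t i = t' i) \<longrightarrow> F t = F t')"

lemma depends_uptoD: "depends_upto n F \<Longrightarrow> (\<And>i. i \<le> n \<Longrightarrow> t i = t' i) \<Longrightarrow> F t = F t'"
  by (auto simp: depends_upto_def)

lemma depends_upto_update:
  assumes "depends_upto n F" "\<And>i. i \<le> n \<Longrightarrow> t i = t' i"
  shows "(\<lambda>v. F (t(i := v))) = (\<lambda>v. F (t'(i := v)))"
  using assms by (auto intro!: ext depends_uptoD[of n F])

lemma depends_upto_pgrad:
  assumes "depends_upto n F" "i \<le> n"
  shows "depends_upto n (pgrad i F)"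
  unfolding depends_upto_def
proof (intro allI impI)
  fix t t' :: "nat \<Rightarrow> 'a" assume *: "\<forall>i\<le>n. t i = t' i"
  then have "(\<lambda>v. F (t(i := v))) = (\<lambda>v. F (t'(i := v)))"
    by (intro depends_upto_update[OF assms(1)]) auto
  with * assms(2) show "pgrad i F t = pgrad i F t'" by (simp add: pgrad_def)
qed

lemma depends_upto_phess:
  fixes F :: "(nat \<Rightarrow> real ^ 'p::finite) \<Rightarrow> real"
  assumes "depends_upto n F" "i \<le> n"
  shows "depends_upto n (phess i F)"
  unfolding depends_upto_def
proof (intro allI impI)
  fix t t' :: "nat \<Rightarrow> real ^ 'p" assume *: "\<forall>i\<le>n. t i = t' i"
  then have "(\<lambda>v. F (t(i := v))) = (\<lambda>v. F (t'(i := v)))"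
    by (intro depends_upto_update[OF assms(1)]) auto
  with * assms(2) show "phess i F t = phess i F t'" by (simp add: phess_def)
qed

lemma depends_upto_pmixed:
  assumes "depends_upto n F" "i \<le> n" "j \<le> n"
  shows "depends_upto n (pmixed j i F)"
  unfolding depends_upto_def
proof (intro allI impI)
  fix t t' :: "nat \<Rightarrow> 'a" assume *: "\<forall>i\<le>n. t i = t' i"
  then have "(\<lambda>v. pgrad i F (t(j := v))) = (\<lambda>v. pgrad i F (t'(j := v)))"
    by (intro depends_upto_update[OF depends_upto_pgrad[OF assms(1,2)]]) auto
  with * assms(3) show "pmixed j i F t = pmixed j i F t'" by (simp add: pmixed_def)
qed

lemma tuple_norm_nonneg: "0 \<le> tuple_norm n h"
  by (simp add: tuple_norm_def)

lemma tuple_norm_scaleR: "tuple_norm n (\<lambda>i. c *\<^sub>R h i) = \<bar>c\<bar> * tuple_norm n h"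
  by (simp add: tuple_norm_def L2_set_right_distrib)

lemma tuple_has_derivative_linear:
  "tuple_has_derivative n F D \<theta> \<Longrightarrow> i \<le> n \<Longrightarrow> bounded_linear (D i)"
  by (simp add: tuple_has_derivative_def)

lemma tuple_has_derivative_line:
  fixes \<theta> h :: "nat \<Rightarrow> 'a::real_normed_vector"
  assumes D: "tuple_has_derivative n F D (\<lambda>i. \<theta> i + s *\<^sub>R h i)"
  shows "((\<lambda>s. F (\<lambda>i. \<theta> i + s *\<^sub>R h i)) has_vector_derivative (\<Sum>i\<le>n. D i (h i))) (at s)"
  unfolding has_vector_derivative_def has_derivative_at_alt
proof (intro conjI allI impI)
  show "bounded_linear (\<lambda>x. x *\<^sub>R (\<Sum>i\<le>n. D i (h i)))"
    by (rule bounded_linear_scaleR_left)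
next
  fix e :: real assume "0 < e"
  define C where "C = tuple_norm n h"
  have C: "0 \<le> C" by (simp add: C_def tuple_norm_nonneg)
  have "0 < e / (C + 1)" using \<open>0 < e\<close> C by simp
  then obtain d where d: "0 < d" and b: "\<And>h'. tuple_norm n h' < d \<Longrightarrow>
      norm (F (\<lambda>i. (\<theta> i + s *\<^sub>R h i) + h' i) - F (\<lambda>i. \<theta> i + s *\<^sub>R h i) - (\<Sum>i\<le>n. D i (h' i)))
        \<le> e / (C + 1) * tuple_norm n h'"
    using D unfolding tuple_has_derivative_def by meson
  show "\<exists>d>0. \<forall>y. norm (y - s) < d \<longrightarrow>
      norm (F (\<lambda>i. \<theta> i + y *\<^sub>R h i) - F (\<lambda>i. \<theta> i + s *\<^sub>R h i) - (y - s) *\<^sub>R (\<Sum>i\<le>n. D i (h i)))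
        \<le> e * norm (y - s)"
  proof (intro exI conjI allI impI)
    show "0 < d / (C + 1)" using d C by simp
    fix y assume y: "norm (y - s) < d / (C + 1)"
    let ?h = "\<lambda>i. (y - s) *\<^sub>R h i"
    have n: "tuple_norm n ?h = \<bar>y - s\<bar> * C" by (simp add: tuple_norm_scaleR C_def)
    have "\<bar>y - s\<bar> * C \<le> \<bar>y - s\<bar> * (C + 1)" by (intro mult_left_mono) auto
    also have "\<dots> < d" using y C by (simp add: field_simps)
    finally have "tuple_norm n ?h < d" by (simp add: n)
    note b[OF this]
    moreover have "(\<lambda>i. (\<theta> i + s *\<^sub>R h i) + ?h i) = (\<lambda>i. \<theta> i + y *\<^sub>R h i)"
      by (simp add: algebra_simps)
    moreover have "(\<Sum>i\<le>n. D i (?h i)) = (y - s) *\<^sub>R (\<Sum>i\<le>n. D i (h i))"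
      unfolding scaleR_sum_right
      by (intro sum.cong refl) (simp add: linear_simps tuple_has_derivative_linear[OF D])
    moreover have "e / (C + 1) * tuple_norm n ?h \<le> e * norm (y - s)"
    proof -
      have "e / (C + 1) * tuple_norm n ?h = e * \<bar>y - s\<bar> * (C / (C + 1))" by (simp add: n)
      also have "\<dots> \<le> e * \<bar>y - s\<bar> * 1" using C \<open>0 < e\<close> by (intro mult_left_mono) auto
      finally show ?thesis by simp
    qed
    ultimately show "norm (F (\<lambda>i. \<theta> i + y *\<^sub>R h i) - F (\<lambda>i. \<theta> i + s *\<^sub>R h i) - (y - s) *\<^sub>R (\<Sum>i\<le>n. D i (h i)))
        \<le> e * norm (y - s)" by simp
  qed
qed

lemma tuple_norm_single:
  assumes "i \<le> n"
  shows "tuple_norm n (\<lambda>j. if j = i then v else 0) = norm v"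
proof -
  have "(\<Sum>j\<le>n. (norm (if j = i then v else 0))\<^sup>2) = (\<Sum>j\<le>n. if j = i then (norm v)\<^sup>2 else 0)"
    by (intro sum.cong) auto
  with assms show ?thesis by (simp add: tuple_norm_def L2_set_def)
qed

lemma tuple_has_derivative_coord:
  fixes \<theta> :: "nat \<Rightarrow> 'a::real_normed_vector"
  assumes D: "tuple_has_derivative n F D \<theta>" and i: "i \<le> n"
  shows "((\<lambda>v. F (\<theta>(i := v))) has_derivative D i) (at (\<theta> i))"
  unfolding has_derivative_at_alt
proof (intro conjI allI impI)
  show "bounded_linear (D i)" using D i by (rule tuple_has_derivative_linear)
next
  fix e :: real assume "0 < e"
  then obtain d where d: "0 < d" and b: "\<And>h'. tuple_norm n h' < d \<Longrightarrow>
      norm (F (\<lambda>i. \<theta> i + h' i) - F \<theta> - (\<Sum>i\<le>n. D i (h' i))) \<le> e * tuple_norm n h'"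
    using D unfolding tuple_has_derivative_def by meson
  show "\<exists>d>0. \<forall>y. norm (y - \<theta> i) < d \<longrightarrow>
      norm (F (\<theta>(i := y)) - F (\<theta>(i := \<theta> i)) - D i (y - \<theta> i)) \<le> e * norm (y - \<theta> i)"
  proof (intro exI conjI allI impI)
    show "0 < d" by fact
    fix y assume y: "norm (y - \<theta> i) < d"
    let ?h = "\<lambda>j. if j = i then y - \<theta> i else 0"
    have "(\<Sum>j\<le>n. D j (?h j)) = (\<Sum>j\<le>n. if j = i then D i (y - \<theta> i) else 0)"
      by (intro sum.cong) (auto simp: linear_simps tuple_has_derivative_linear[OF D])
    then have 1: "(\<Sum>j\<le>n. D j (?h j)) = D i (y - \<theta> i)" using i by simp
    have 2: "(\<lambda>j. \<theta> j + ?h j) = \<theta>(i := y)" by auto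
    from b[of ?h] y i show "norm (F (\<theta>(i := y)) - F (\<theta>(i := \<theta> i)) - D i (y - \<theta> i)) \<le> e * norm (y - \<theta> i)"
      unfolding 1 2 by (simp add: tuple_norm_single)
  qed
qed

lemma bounded_linear_GDERIV:
  fixes x :: "'a::euclidean_space"
  assumes "(f has_derivative D) (at x)"
  shows "GDERIV f x :> (\<Sum>b\<in>Basis. D b *\<^sub>R b)"
proof -
  interpret bounded_linear D using assms by (rule has_derivative_bounded_linear)
  have "D h = h \<bullet> (\<Sum>b\<in>Basis. D b *\<^sub>R b)" for h
  proof -
    have "D h = D (\<Sum>b\<in>Basis. (h \<bullet> b) *\<^sub>R b)" by (simp add: euclidean_representation)
    also have "\<dots> = (\<Sum>b\<in>Basis. (h \<bullet> b) * D b)" by (simp add: sum scaleR)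
    finally show ?thesis by (simp add: inner_sum_right mult.commute)
  qed
  then have "D = (\<lambda>h. h \<bullet> (\<Sum>b\<in>Basis. D b *\<^sub>R b))" by (rule ext)
  with assms show ?thesis by (simp add: gderiv_def)
qed

lemma tuple_has_derivative_pgrad:
  fixes \<theta> :: "nat \<Rightarrow> 'a::euclidean_space"
  assumes D: "tuple_has_derivative n F D \<theta>" and i: "i \<le> n"
  shows "GDERIV (\<lambda>v. F (\<theta>(i := v))) (\<theta> i) :> pgrad i F \<theta>" "D i h = h \<bullet> pgrad i F \<theta>"
proof -
  note c = tuple_has_derivative_coord[OF D i]
  note g = bounded_linear_GDERIV[OF c]
  then have eq: "pgrad i F \<theta> = (\<Sum>b\<in>Basis. D i b *\<^sub>R b)"
    unfolding pgrad_def by (rule gradient_eqI)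
  show 1: "GDERIV (\<lambda>v. F (\<theta>(i := v))) (\<theta> i) :> pgrad i F \<theta>" using g by (simp add: eq)
  have "D i = (\<lambda>h. h \<bullet> pgrad i F \<theta>)"
    using c 1 unfolding gderiv_def by (rule has_derivative_unique)
  then show "D i h = h \<bullet> pgrad i F \<theta>" by metis
qed

section \<open>Symmetric Hessians and their spectral radius\<close>

text \<open>
  This leads to the symmetry of the second derivative when the gradient is differentiable at the
  single point \<open>x\<close> only, without continuity of second derivatives: the second difference of \<open>f\<close> along \<open>u\<close> and \<open>v\<close>
  is symmetric in \<open>u\<close> and \<open>v\<close>, and the mean value theorem along \<open>u\<close> shows that it equals
  \<open>u \<bullet> A v\<close> up to an error that is small compared with \<open>(norm u + norm v)\<^sup>2\<close>.
\<close>

lemma second_difference: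
  fixes f :: "'a::real_inner \<Rightarrow> real"
  assumes g: "\<And>w. GDERIV f w :> g w" and A: "linear A"
    and d: "\<And>h. norm h < d \<Longrightarrow> norm (g (x + h) - g x - A h) \<le> e * norm h"
    and small: "norm u + norm v < d" and e: "0 \<le> e"
  shows "\<bar>f (x + u + v) - f (x + u) - f (x + v) + f x - u \<bullet> A v\<bar> \<le> 2 * e * (norm u + norm v)\<^sup>2"
proof -
  let ?k = "\<lambda>s. f (x + v + s *\<^sub>R u) - f (x + s *\<^sub>R u)"
  have line: "((\<lambda>s. f (a + s *\<^sub>R u)) has_real_derivative u \<bullet> g (a + s *\<^sub>R u)) (at s)" for a s
  proof -
    have "((\<lambda>s. f (a + s *\<^sub>R u)) has_derivative (\<lambda>t. (t *\<^sub>R u) \<bullet> g (a + s *\<^sub>R u))) (at s)"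
      by (rule has_derivative_compose[of "\<lambda>s. a + s *\<^sub>R u" "\<lambda>t. t *\<^sub>R u" s UNIV f])
        (auto intro!: derivative_eq_intros g[unfolded gderiv_def])
    then show ?thesis by (simp add: has_field_derivative_def mult.commute[of _ "u \<bullet> _"])
  qed
  have "\<exists>z. 0 < z \<and> z < (1::real) \<and> ?k 1 - ?k 0
      = (1 - 0) * (u \<bullet> g (x + v + z *\<^sub>R u) - u \<bullet> g (x + z *\<^sub>R u))"
    by (rule MVT2) (auto intro!: derivative_intros line)
  then obtain z where z: "0 < z" "z < 1"
    and k: "?k 1 - ?k 0 = u \<bullet> (g (x + v + z *\<^sub>R u) - g (x + z *\<^sub>R u))"
    by (auto simp: inner_diff_right)
  have zu: "norm (z *\<^sub>R u) \<le> norm u" using z by (simp add: mult_left_le_one_le)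
  have n1: "norm (v + z *\<^sub>R u) \<le> norm u + norm v"
    using norm_triangle_ineq[of v "z *\<^sub>R u"] zu by linarith
  have "norm (g (x + (v + z *\<^sub>R u)) - g x - A (v + z *\<^sub>R u)) \<le> e * norm (v + z *\<^sub>R u)"
    by (rule d) (use n1 small in linarith)
  also have "\<dots> \<le> e * (norm u + norm v)" using n1 e by (rule mult_left_mono)
  finally have b1: "norm (g (x + v + z *\<^sub>R u) - g x - (A v + A (z *\<^sub>R u))) \<le> e * (norm u + norm v)"
    by (simp add: linear_add[OF A] add.assoc)
  have "norm (g (x + z *\<^sub>R u) - g x - A (z *\<^sub>R u)) \<le> e * norm (z *\<^sub>R u)"
    by (rule d) (use zu small norm_ge_zero[of v] in linarith)
  also have "\<dots> \<le> e * (norm u + norm v)"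
    using zu e norm_ge_zero[of v] by (intro mult_left_mono) linarith+
  finally have b2: "norm (g (x + z *\<^sub>R u) - g x - A (z *\<^sub>R u)) \<le> e * (norm u + norm v)" .
  let ?r = "g (x + v + z *\<^sub>R u) - g (x + z *\<^sub>R u) - A v"
  let ?a = "g (x + v + z *\<^sub>R u) - g x - (A v + A (z *\<^sub>R u))"
  let ?b = "g (x + z *\<^sub>R u) - g x - A (z *\<^sub>R u)"
  have "?r = ?a - ?b" by simp
  then have "norm ?r \<le> norm ?a + norm ?b" by (simp only: norm_triangle_ineq4)
  also have "\<dots> \<le> e * (norm u + norm v) + e * (norm u + norm v)" using b1 b2 by (rule add_mono)
  finally have r: "norm ?r \<le> 2 * (e * (norm u + norm v))" by simp
  have "f (x + u + v) - f (x + u) - f (x + v) + f x - u \<bullet> A v = u \<bullet> ?r"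
    using k by (simp add: inner_diff_right algebra_simps)
  also have "\<bar>\<dots>\<bar> \<le> norm u * norm ?r" by (rule Cauchy_Schwarz_ineq2)
  also have "\<dots> \<le> (norm u + norm v) * (2 * (e * (norm u + norm v)))"
    using r e by (intro mult_mono) auto
  finally show ?thesis by (simp add: power2_eq_square algebra_simps)
qed

lemma second_derivative_symmetric:
  fixes f :: "'a::real_inner \<Rightarrow> real"
  assumes g: "\<And>w. GDERIV f w :> g w" and A: "(g has_derivative A) (at x)"
  shows "u \<bullet> A v = v \<bullet> A u"
proof -
  interpret A: bounded_linear A using A by (rule has_derivative_bounded_linear)
  let ?c = "(norm u + norm v)\<^sup>2"
  have "\<bar>u \<bullet> A v - v \<bullet> A u\<bar> \<le> 0"
  proof (rule field_le_epsilon)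
    fix e0 :: real assume e0: "0 < e0"
    define e where "e = e0 / (4 * ?c + 1)"
    have pos: "0 < 4 * ?c + 1" by (simp add: add_nonneg_pos)
    then have e: "0 < e" using e0 by (simp add: e_def)
    obtain d where d: "0 < d" and b: "\<And>y. norm (y - x) < d \<Longrightarrow> norm (g y - g x - A (y - x)) \<le> e * norm (y - x)"
      using A e unfolding has_derivative_at_alt by meson
    have b': "norm (g (x + h) - g x - A h) \<le> e * norm h" if "norm h < d" for h
      using b[of "x + h"] that by simp
    define t where "t = d / (norm u + norm v + 1)"
    have t: "0 < t" using d by (simp add: t_def add_nonneg_pos)
    have "t * (norm u + norm v) < t * (norm u + norm v + 1)" using t by simp
    also have "\<dots> = d" by (simp add: t_def add_nonneg_pos add_nonneg_eq_0_iff)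
    finally have small: "norm (t *\<^sub>R u) + norm (t *\<^sub>R v) < d" "norm (t *\<^sub>R v) + norm (t *\<^sub>R u) < d"
      using t by (simp_all add: algebra_simps)
    have c: "(norm (t *\<^sub>R u) + norm (t *\<^sub>R v))\<^sup>2 = t\<^sup>2 * ?c"
      using t by (simp add: power_mult_distrib flip: distrib_left)
    note s1 = second_difference[OF g A.linear_axioms b' small(1) less_imp_le[OF e]]
    note s2 = second_difference[OF g A.linear_axioms b' small(2) less_imp_le[OF e]]
    have "\<bar>(t *\<^sub>R u) \<bullet> A (t *\<^sub>R v) - (t *\<^sub>R v) \<bullet> A (t *\<^sub>R u)\<bar> \<le> 4 * e * (t\<^sup>2 * ?c)"
      using s1 s2 c by (simp add: algebra_simps add.commute[of "norm (t *\<^sub>R v)"])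
    also have "(t *\<^sub>R u) \<bullet> A (t *\<^sub>R v) - (t *\<^sub>R v) \<bullet> A (t *\<^sub>R u) = t\<^sup>2 * (u \<bullet> A v - v \<bullet> A u)"
      by (simp add: A.scaleR power2_eq_square algebra_simps)
    finally have "t\<^sup>2 * \<bar>u \<bullet> A v - v \<bullet> A u\<bar> \<le> t\<^sup>2 * (4 * e * ?c)"
      by (simp add: abs_mult mult.left_commute)
    then have "\<bar>u \<bullet> A v - v \<bullet> A u\<bar> \<le> 4 * e * ?c" using t by simp
    also have "\<dots> \<le> e * (4 * ?c + 1)" using e by (simp add: algebra_simps)
    also have "\<dots> = e0" using pos by (simp add: e_def)
    finally show "\<bar>u \<bullet> A v - v \<bullet> A u\<bar> \<le> 0 + e0" by simp
  qed
  then show ?thesis by simp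
qed

lemma symmetric_matrix_top_eigenvector:
  fixes A :: "real ^ 'p::finite ^ 'p"
  assumes sym: "\<And>u v. u \<bullet> (A *v v) = v \<bullet> (A *v u)"
  obtains l v where "norm v = 1" "A *v v = l *\<^sub>R v" "\<And>w. w \<bullet> (A *v w) \<le> l * (norm w)\<^sup>2"
proof -
  let ?S = "sphere (0 :: real ^ 'p) 1"
  have "continuous_on ?S (\<lambda>v. v \<bullet> (A *v v))"
    by (intro continuous_on_inner continuous_on_id linear_continuous_on matrix_vector_mul_bounded_linear)
  moreover have "axis undefined 1 \<in> ?S" by (simp add: norm_axis_1)
  ultimately obtain v where v: "v \<in> ?S" and m: "\<And>w. w \<in> ?S \<Longrightarrow> w \<bullet> (A *v w) \<le> v \<bullet> (A *v v)"
    using continuous_attains_sup[of ?S "\<lambda>v. v \<bullet> (A *v v)"] by auto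
  define l where "l = v \<bullet> (A *v v)"
  have nv: "norm v = 1" using v by simp
  have bound: "w \<bullet> (A *v w) \<le> l * (norm w)\<^sup>2" for w
  proof (cases "w = 0")
    case False
    let ?u = "(1 / norm w) *\<^sub>R w"
    have "?u \<bullet> (A *v ?u) \<le> l" unfolding l_def by (rule m) (use False in auto)
    moreover have "w \<bullet> (A *v w) = (norm w)\<^sup>2 * (?u \<bullet> (A *v ?u))"
      using False by (simp add: matrix_vector_mult_scaleR power2_eq_square)
    ultimately show ?thesis
      by (metis mult.commute mult_left_mono zero_le_power2)
  qed auto
  \<comment> \<open>The form \<open>l * (norm w)\<^sup>2 - w \<bullet> A w\<close> in \<open>w\<close> is nonnegative and vanishes at \<open>v\<close>, so its
    derivative vanishes there too.\<close>
  define r where "r = l *\<^sub>R v - A *v v"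
  define q where "q = l * (norm r)\<^sup>2 - r \<bullet> (A *v r)"
  have "norm r = 0"
  proof (rule ccontr)
    assume "norm r \<noteq> 0"
    then have r: "0 < (norm r)\<^sup>2" by simp
    \<comment> \<open>At \<open>v - t *\<^sub>R r\<close> the term of first order in \<open>t\<close> dominates for this small \<open>t\<close>, which would
      make the form negative.\<close>
    define t where "t = (norm r)\<^sup>2 / (\<bar>q\<bar> + 1)"
    have t: "0 < t" using r by (simp add: t_def add_nonneg_pos)
    have "(v - t *\<^sub>R r) \<bullet> (A *v (v - t *\<^sub>R r)) \<le> l * (norm (v - t *\<^sub>R r))\<^sup>2" by (rule bound)
    moreover have "(v - t *\<^sub>R r) \<bullet> (A *v (v - t *\<^sub>R r))
        = l - 2 * t * (r \<bullet> (A *v v)) + t\<^sup>2 * (r \<bullet> (A *v r))"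
      using sym[of v r] by (simp add: l_def algebra_simps matrix_vector_mult_diff_distrib
          matrix_vector_mult_scaleR power2_eq_square inner_diff_left inner_diff_right)
    moreover have "(norm (v - t *\<^sub>R r))\<^sup>2 = 1 - 2 * t * (r \<bullet> v) + t\<^sup>2 * (norm r)\<^sup>2"
      using nv unfolding power2_norm_eq_inner
      by (simp add: norm_eq_1 inner_diff_left inner_diff_right inner_commute power2_eq_square algebra_simps)
    ultimately have "2 * t * (l * (r \<bullet> v) - r \<bullet> (A *v v)) \<le> t\<^sup>2 * q"
      by (simp add: q_def algebra_simps)
    moreover have "l * (r \<bullet> v) - r \<bullet> (A *v v) = (norm r)\<^sup>2"
      unfolding power2_norm_eq_inner by (subst (3) r_def) (simp add: inner_diff_right)
    ultimately have "2 * t * (norm r)\<^sup>2 \<le> t\<^sup>2 * q" by simp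
    then have "2 * (norm r)\<^sup>2 \<le> t * q" using t by (simp add: power2_eq_square)
    also have "\<dots> \<le> t * (\<bar>q\<bar> + 1)" using t by (intro mult_left_mono) auto
    also have "\<dots> = (norm r)\<^sup>2" by (simp add: t_def add_nonneg_eq_0_iff)
    finally show False using r by simp
  qed
  then have "A *v v = l *\<^sub>R v" by (simp add: r_def)
  with nv bound that show ?thesis by blast
qed

lemma eigenvalue_le_eig_norm:
  fixes A :: "real ^ 'p::finite ^ 'p"
  assumes v: "v \<noteq> 0" "A *v v = l *\<^sub>R v"
  shows "\<bar>l\<bar> \<le> eig_norm A"
proof -
  let ?A = "map_matrix complex_of_real A"
  let ?E = "{cmod c | c. \<exists>v :: complex ^ 'p. v \<noteq> 0 \<and> ?A *v v = c *s v}"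
  have "bounded_linear ((*v) ?A)" by simp
  then obtain K where K: "\<And>v. norm (?A *v v) \<le> norm v * K"
    using bounded_linear.bounded by blast
  have "bdd_above ?E"
  proof (rule bdd_aboveI)
    fix x assume "x \<in> ?E"
    then obtain c and v :: "complex ^ 'p" where c: "x = cmod c" "v \<noteq> 0" "?A *v v = c *s v" by auto
    have "norm (c *s v) = cmod c * norm v"
      by (simp add: norm_vec_def L2_set_right_distrib norm_mult)
    with K[of v] c have "norm v * x \<le> norm v * K" by (simp add: mult.commute)
    with c show "x \<le> K" by simp
  qed
  moreover have "cmod (complex_of_real l) \<in> ?E"
  proof -
    let ?v = "\<chi> i. complex_of_real (v $ i)"
    have "?v \<noteq> 0" using v(1) by (auto simp: vec_eq_iff)
    moreover have "?A *v ?v = complex_of_real l *s ?v"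
    proof -
      have "complex_of_real ((A *v v) $ i) = complex_of_real (l * v $ i)" for i
        by (simp add: v(2))
      then show ?thesis
        by (simp add: vec_eq_iff matrix_vector_mult_def map_matrix_def)
    qed
    ultimately show ?thesis by blast
  qed
  ultimately have "cmod (complex_of_real l) \<le> eig_norm A"
    unfolding eig_norm_def by (intro cSup_upper)
  then show ?thesis by simp
qed

text \<open>
  For a symmetric matrix the extrema of the quadratic form on the unit sphere are real eigenvalues,
  so the spectral radius bounds the form.
\<close>

lemma symmetric_form_le_eig_norm:
  fixes A :: "real ^ 'p::finite ^ 'p"
  assumes sym: "\<And>u v. u \<bullet> (A *v v) = v \<bullet> (A *v u)"
  shows "\<bar>w \<bullet> (A *v w)\<bar> \<le> eig_norm A * (norm w)\<^sup>2"
proof -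
  have neg: "(- A) *v x = - (A *v x)" for x
    by (simp add: vec_eq_iff matrix_vector_mult_def sum_negf)
  obtain l v where 1: "norm v = 1" "A *v v = l *\<^sub>R v" "w \<bullet> (A *v w) \<le> l * (norm w)\<^sup>2"
    using symmetric_matrix_top_eigenvector[OF sym] by metis
  have "u \<bullet> ((- A) *v v) = v \<bullet> ((- A) *v u)" for u v using sym by (simp add: neg)
  from symmetric_matrix_top_eigenvector[OF this]
  obtain l' v' where 2: "norm v' = 1" "(- A) *v v' = l' *\<^sub>R v'" "w \<bullet> ((- A) *v w) \<le> l' * (norm w)\<^sup>2"
    by metis
  have "\<bar>l\<bar> \<le> eig_norm A" using 1 by (intro eigenvalue_le_eig_norm[of v]) auto
  then have "l * (norm w)\<^sup>2 \<le> eig_norm A * (norm w)\<^sup>2" by (intro mult_right_mono) auto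
  moreover have "A *v v' = (- l') *\<^sub>R v'" using 2(2) by (metis neg minus_minus scaleR_minus_left)
  then have "\<bar>- l'\<bar> \<le> eig_norm A" using 2(1) by (intro eigenvalue_le_eig_norm[of v']) auto
  then have "l' * (norm w)\<^sup>2 \<le> eig_norm A * (norm w)\<^sup>2" by (intro mult_right_mono) auto
  ultimately show ?thesis using 1(3) 2(3) by (simp add: neg abs_le_iff)
qed


section \<open>A uniform second order expansion\<close>

lemma abs_taylor2_unit_interval:
  fixes f :: "real \<Rightarrow> real"
  assumes f: "\<And>s. 0 \<le> s \<Longrightarrow> s \<le> 1 \<Longrightarrow> (f has_real_derivative f' s) (at s)"
    and f': "\<And>s. 0 \<le> s \<Longrightarrow> s \<le> 1 \<Longrightarrow> (f' has_real_derivative f'' s) (at s)"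
    and M: "\<And>s. 0 \<le> s \<Longrightarrow> s \<le> 1 \<Longrightarrow> \<bar>f'' s\<bar> \<le> M"
  shows "\<bar>f 1 - f 0 - f' 0\<bar> \<le> M"
proof -
  have "\<exists>z. 0 < z \<and> z < (1::real) \<and> f 1 - f 0 = (1 - 0) * f' z" by (rule MVT2) (auto intro: f)
  then obtain z where z: "0 < z" "z < 1" "f 1 - f 0 = f' z" by auto
  have "\<exists>y. 0 < y \<and> y < z \<and> f' z - f' 0 = (z - 0) * f'' y"
    by (rule MVT2) (use z in \<open>auto intro: f'\<close>)
  then obtain y where y: "0 < y" "y < z" "f' z - f' 0 = z * f'' y" by auto
  have "\<bar>z * f'' y\<bar> \<le> 1 * M"
    unfolding abs_mult using z y M[of y] by (intro mult_mono) auto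
  with y z show ?thesis by simp
qed

text \<open>
  Uniform bounds on the diagonal blocks of the Hessian control only its quadratic form there; this is
  where symmetry enters, since the spectral radius of a matrix does not bound the quadratic form of
  a nonsymmetric matrix.
\<close>

lemma second_order_form_bound:
  fixes F :: "(nat \<Rightarrow> real ^ 'p::finite) \<Rightarrow> real"
  assumes twice: "tuple_twice_differentiable n F"
    and E: "\<And>i. i \<le> n \<Longrightarrow> tuple_has_derivative n (pgrad i F) (E i) t"
    and b1: "\<And>i. i \<le> n \<Longrightarrow> eig_norm (phess i F t) \<le> b"
    and b2: "\<And>i j. i \<le> n \<Longrightarrow> j \<le> n \<Longrightarrow> i \<noteq> j \<Longrightarrow> onorm (pmixed j i F t) \<le> b"
    and h: "\<And>i. i \<le> n \<Longrightarrow> norm (h i) \<le> r" and r: "0 \<le> r" and b: "0 \<le> b"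
    and i: "i \<le> n" and j: "j \<le> n"
  shows "\<bar>h i \<bullet> E i j (h j)\<bar> \<le> b * r\<^sup>2"
proof -
  note d = tuple_has_derivative_coord[OF E[OF i] j]
  show ?thesis
  proof (cases "i = j")
    case False
    have "pmixed j i F t = E i j"
      unfolding pmixed_def using frechet_derivative_at[OF d] by simp
    with b2[OF i j False] have o: "onorm (E i j) \<le> b" by simp
    have "norm (E i j (h j)) \<le> onorm (E i j) * norm (h j)"
      using d by (intro onorm has_derivative_bounded_linear)
    also have "\<dots> \<le> b * r" using o h[OF j] b by (intro mult_mono) auto
    finally have "norm (E i j (h j)) \<le> b * r" .
    then have "norm (h i) * norm (E i j (h j)) \<le> r * (b * r)"
      using h[OF i] r by (intro mult_mono) auto
    with Cauchy_Schwarz_ineq2[of "h i" "E i j (h j)"] show ?thesis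
      by (simp add: power2_eq_square mult.commute mult.left_commute)
  next
    case True
    let ?f = "\<lambda>v. F (t(i := v))" and ?g = "\<lambda>w. pgrad i F (t(i := w))"
    have g: "GDERIV ?f w :> ?g w" for w
    proof -
      obtain D where "tuple_has_derivative n F D (t(i := w))"
        using twice unfolding tuple_twice_differentiable_def tuple_differentiable_def by meson
      from tuple_has_derivative_pgrad(1)[OF this i] show ?thesis by simp
    qed
    have d': "(?g has_derivative E i i) (at (t i))" using d True by simp
    have "gradient ?f = ?g" using g by (intro ext gradient_eqI)
    then have "phess i F t = matrix (E i i)"
      unfolding phess_def hessian_def using frechet_derivative_at[OF d'] by simp
    then have m: "phess i F t *v v = E i i v" for v
      using d' by (simp add: matrix_works has_derivative_linear)
    have "\<bar>h i \<bullet> (phess i F t *v h i)\<bar> \<le> eig_norm (phess i F t) * (norm (h i))\<^sup>2"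
      by (rule symmetric_form_le_eig_norm)
        (simp only: m, rule second_derivative_symmetric[OF g d'])
    also have "\<dots> \<le> b * r\<^sup>2"
      using b1[OF i] h[OF i] b by (intro mult_mono power_mono) auto
    finally show ?thesis using m[of "h i"] True by simp
  qed
qed

text \<open>
  A second order expansion of \<open>exp \<circ> F\<close>, relative to the value at the diagonal point, that is
  uniform over compact sets of diagonal points.
\<close>

lemma exp_expansion_uniform:
  fixes F :: "(nat \<Rightarrow> real ^ 'p::finite) \<Rightarrow> real"
  assumes twice: "tuple_twice_differentiable n F" and dep: "depends_upto n F"
    and grad: "\<And>K i. \<lbrakk>compactin (product_topology (\<lambda>_. euclidean) {..n}) K; i \<le> n\<rbrakk>
        \<Longrightarrow> bdd_above ((\<lambda>\<theta>. norm (pgrad i F \<theta>)) ` K)"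
    and hess: "\<And>K i. \<lbrakk>compactin (product_topology (\<lambda>_. euclidean) {..n}) K; i \<le> n\<rbrakk>
        \<Longrightarrow> bdd_above ((\<lambda>\<theta>. eig_norm (phess i F \<theta>)) ` K)"
    and mixed: "\<And>K i j. \<lbrakk>compactin (product_topology (\<lambda>_. euclidean) {..n}) K; i \<le> n; j \<le> n; i \<noteq> j\<rbrakk>
        \<Longrightarrow> bdd_above ((\<lambda>\<theta>. onorm (pmixed j i F \<theta>)) ` K)"
    and K4: "bounded K4" and R: "0 \<le> R"
  shows "\<exists>C\<ge>0. (\<forall>\<theta>\<in>K4. \<forall>i\<le>n. norm (pgrad i F (\<lambda>_. \<theta>)) \<le> C) \<and>
    (\<forall>\<theta>\<in>K4. \<forall>h r. 0 \<le> r \<longrightarrow> r \<le> R \<longrightarrow> (\<forall>i\<le>n. norm (h i) \<le> r) \<longrightarrow>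
       \<bar>exp (F (\<lambda>i. \<theta> + h i) - F (\<lambda>_. \<theta>)) - 1 - (\<Sum>i\<le>n. h i \<bullet> pgrad i F (\<lambda>_. \<theta>))\<bar> \<le> C * r\<^sup>2)"
proof -
  obtain B where B: "\<And>\<theta>. \<theta> \<in> K4 \<Longrightarrow> norm \<theta> \<le> B" using K4 by (auto simp: bounded_iff)
  define K where "K = PiE {..n} (\<lambda>_. cball (0 :: real ^ 'p) (B + R))"
  have cK: "compactin (product_topology (\<lambda>_. euclidean) {..n}) K"
    by (simp add: K_def compactin_PiE)
  define U where "U = (\<Union>i\<le>n. (\<lambda>\<theta>. norm (pgrad i F \<theta>)) ` K) \<union> (\<Union>i\<le>n. (\<lambda>\<theta>. eig_norm (phess i F \<theta>)) ` K)
    \<union> (\<Union>i\<le>n. \<Union>j\<in>{..n} - {i}. (\<lambda>\<theta>. onorm (pmixed j i F \<theta>)) ` K)"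
  have "bdd_above U"
    unfolding U_def using grad[OF cK] hess[OF cK] mixed[OF cK] by (auto simp: bdd_above_UN)
  then obtain b0 where b0: "\<forall>x\<in>U. x \<le> b0" unfolding bdd_above_def by (rule exE)
  define b where "b = max b0 0"
  have b: "0 \<le> b" by (simp add: b_def)
  have bU: "x \<le> b" if "x \<in> U" for x using bspec[OF b0 that] by (simp add: b_def)
  have KB: "norm (pgrad i F t) \<le> b" if "t \<in> K" "i \<le> n" for t i
    by (rule bU, unfold U_def, rule UnI1, rule UnI1, rule UN_I[of i]) (use that in \<open>auto intro: imageI\<close>)
  have KH: "eig_norm (phess i F t) \<le> b" if "t \<in> K" "i \<le> n" for t i
    by (rule bU, unfold U_def, rule UnI1, rule UnI2, rule UN_I[of i]) (use that in \<open>auto intro: imageI\<close>)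
  have KM: "onorm (pmixed j i F t) \<le> b" if "t \<in> K" "i \<le> n" "j \<le> n" "i \<noteq> j" for t i j
    by (rule bU, unfold U_def, rule UnI2, rule UN_I[of i], simp add: that, rule UN_I[of j])
      (use that in \<open>auto intro: imageI\<close>)
  have inK: "restrict t {..n} \<in> K" if "\<And>i. i \<le> n \<Longrightarrow> norm (t i) \<le> B + R" for t
    using that by (auto simp: K_def)
  have bg: "norm (pgrad i F t) \<le> b" if "\<And>i. i \<le> n \<Longrightarrow> norm (t i) \<le> B + R" "i \<le> n" for t i
  proof -
    have "norm (pgrad i F (restrict t {..n})) \<le> b"
      using inK[OF that(1)] that(2) by (rule KB)
    then show ?thesis
      using depends_uptoD[OF depends_upto_pgrad[OF dep that(2)], of t "restrict t {..n}"] by simp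
  qed
  have bh: "eig_norm (phess i F t) \<le> b" if "\<And>i. i \<le> n \<Longrightarrow> norm (t i) \<le> B + R" "i \<le> n" for t i
  proof -
    have "eig_norm (phess i F (restrict t {..n})) \<le> b"
      using inK[OF that(1)] that(2) by (rule KH)
    then show ?thesis
      using depends_uptoD[OF depends_upto_phess[OF dep that(2)], of t "restrict t {..n}"] by simp
  qed
  have bm: "onorm (pmixed j i F t) \<le> b"
    if "\<And>i. i \<le> n \<Longrightarrow> norm (t i) \<le> B + R" "i \<le> n" "j \<le> n" "i \<noteq> j" for t i j
  proof -
    have "onorm (pmixed j i F (restrict t {..n})) \<le> b"
      using inK[OF that(1)] that(2-) by (rule KM)
    then show ?thesis
      using depends_uptoD[OF depends_upto_pmixed[OF dep that(2,3)], of t "restrict t {..n}"] by simp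
  qed
  define m where "m = real (Suc n)"
  have m: "1 \<le> m" by (simp add: m_def)
  define M where "M = (m\<^sup>2 * b + (m * b)\<^sup>2) * exp (m * b * R)"
  have M: "0 \<le> M" using b by (simp add: M_def)
  show ?thesis
  proof (intro exI[of _ "b + M"] conjI ballI allI impI)
    show "0 \<le> b + M" using b M by simp
  next
    fix \<theta> i assume "\<theta> \<in> K4" "i \<le> n"
    then have "norm (pgrad i F (\<lambda>_. \<theta>)) \<le> b"
      using B[of \<theta>] R by (intro bg) auto
    then show "norm (pgrad i F (\<lambda>_. \<theta>)) \<le> b + M" using M by simp
  next
    fix \<theta> and h :: "nat \<Rightarrow> real ^ 'p" and r
    assume \<theta>: "\<theta> \<in> K4" and r: "0 \<le> r" "r \<le> R" and h': "\<forall>i\<le>n. norm (h i) \<le> r"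
    have h: "norm (h i) \<le> r" if "i \<le> n" for i using h' that by simp
    define t where "t = (\<lambda>s i. \<theta> + s *\<^sub>R h i)"
    have region: "norm (t s i) \<le> B + R" if "0 \<le> s" "s \<le> 1" "i \<le> n" for s i
    proof -
      have "norm (s *\<^sub>R h i) \<le> 1 * R"
        unfolding norm_scaleR using that h[OF that(3)] r by (intro mult_mono) auto
      then show ?thesis
        using B[OF \<theta>] norm_triangle_ineq[of \<theta> "s *\<^sub>R h i"] by (simp add: t_def)
    qed
    have bgt: "norm (pgrad i F (t s)) \<le> b" if "0 \<le> s" "s \<le> 1" "i \<le> n" for s i
      by (rule bg[OF region[OF that(1,2)] that(3)])
    have bht: "eig_norm (phess i F (t s)) \<le> b" if "0 \<le> s" "s \<le> 1" "i \<le> n" for s i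
      by (rule bh[OF region[OF that(1,2)] that(3)])
    have bmt: "onorm (pmixed j i F (t s)) \<le> b"
      if "0 \<le> s" "s \<le> 1" "i \<le> n" "j \<le> n" "i \<noteq> j" for s i j
      by (rule bm[OF region[OF that(1,2)] that(3-)])
    have "\<exists>D. tuple_has_derivative n F D (t s)" for s
      using twice unfolding tuple_twice_differentiable_def tuple_differentiable_def by blast
    then obtain D where D: "\<And>s. tuple_has_derivative n F (D s) (t s)" by metis
    have "\<exists>E. \<forall>i\<le>n. tuple_has_derivative n (pgrad i F) (E i) (t s)" for s
      using twice unfolding tuple_twice_differentiable_def tuple_differentiable_def by metis
    then obtain E where E: "\<And>s i. i \<le> n \<Longrightarrow> tuple_has_derivative n (pgrad i F) (E s i) (t s)" by metis
    let ?f = "\<lambda>s. F (t s)" and ?f1 = "\<lambda>s. \<Sum>i\<le>n. h i \<bullet> pgrad i F (t s)"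
      and ?f2 = "\<lambda>s. \<Sum>i\<le>n. \<Sum>j\<le>n. h i \<bullet> E s i j (h j)"
    have d1: "(?f has_real_derivative ?f1 s) (at s)" for s
    proof -
      have "(?f has_vector_derivative (\<Sum>i\<le>n. D s i (h i))) (at s)"
        unfolding t_def by (rule tuple_has_derivative_line) (use D[of s] in \<open>simp add: t_def\<close>)
      also have "(\<Sum>i\<le>n. D s i (h i)) = ?f1 s"
        by (intro sum.cong refl tuple_has_derivative_pgrad(2)[OF D]) auto
      finally show ?thesis by (simp add: has_real_derivative_iff_has_vector_derivative)
    qed
    have d2: "(?f1 has_real_derivative ?f2 s) (at s)" for s
    proof (intro DERIV_sum)
      fix i assume "i \<in> {..n}"
      then have i: "i \<le> n" by simp
      have "((\<lambda>s. pgrad i F (t s)) has_vector_derivative (\<Sum>j\<le>n. E s i j (h j))) (at s)"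
        unfolding t_def by (rule tuple_has_derivative_line) (use E[OF i, of s] in \<open>simp add: t_def\<close>)
      then have "((\<lambda>s. h i \<bullet> pgrad i F (t s)) has_vector_derivative h i \<bullet> (\<Sum>j\<le>n. E s i j (h j))) (at s)"
        by (rule bounded_linear.has_vector_derivative[OF bounded_linear_inner_right])
      then show "((\<lambda>s. h i \<bullet> pgrad i F (t s)) has_real_derivative (\<Sum>j\<le>n. h i \<bullet> E s i j (h j))) (at s)"
        by (simp add: inner_sum_right has_real_derivative_iff_has_vector_derivative)
    qed
    have f1: "\<bar>?f1 s\<bar> \<le> m * b * r" if "0 \<le> s" "s \<le> 1" for s
    proof -
      have "\<bar>h i \<bullet> pgrad i F (t s)\<bar> \<le> r * b" if i: "i \<le> n" for i
        using h[OF i] bgt[OF \<open>0 \<le> s\<close> \<open>s \<le> 1\<close> i] r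
        by (intro order_trans[OF Cauchy_Schwarz_ineq2] mult_mono) auto
      then have "(\<Sum>i\<le>n. \<bar>h i \<bullet> pgrad i F (t s)\<bar>) \<le> of_nat (card {..n}) * (r * b)"
        by (intro sum_bounded_above) simp
      then have "(\<Sum>i\<le>n. \<bar>h i \<bullet> pgrad i F (t s)\<bar>) \<le> m * b * r"
        by (simp add: m_def algebra_simps)
      then show ?thesis by (rule order_trans[OF sum_abs])
    qed
    have f2: "\<bar>?f2 s\<bar> \<le> m\<^sup>2 * b * r\<^sup>2" if s: "0 \<le> s" "s \<le> 1" for s
    proof -
      have "\<bar>h i \<bullet> E s i j (h j)\<bar> \<le> b * r\<^sup>2" if ij: "i \<le> n" "j \<le> n" for i j
        by (rule second_order_form_bound[OF twice E])
          (use ij bht bmt s h r b in auto)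
      then have "(\<Sum>i\<le>n. \<Sum>j\<le>n. \<bar>h i \<bullet> E s i j (h j)\<bar>)
          \<le> of_nat (card {..n}) * (of_nat (card {..n}) * (b * r\<^sup>2))"
        by (intro sum_bounded_above) simp
      moreover have "\<bar>?f2 s\<bar> \<le> (\<Sum>i\<le>n. \<Sum>j\<le>n. \<bar>h i \<bullet> E s i j (h j)\<bar>)"
        by (rule order_trans[OF sum_abs]) (intro sum_mono sum_abs)
      ultimately show ?thesis by (simp add: m_def power2_eq_square mult.assoc)
    qed
    \<comment> \<open>Expanding the exponential of \<open>F\<close> along the segment directly, rather than \<open>F\<close> first, needs
      only one Taylor estimate.\<close>
    let ?e = "\<lambda>s. exp (?f s - ?f 0)"
    have inc: "?f s - ?f 0 \<le> m * b * R" if "0 \<le> s" "s \<le> 1" for s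
    proof (cases "s = 0")
      case False
      have "\<exists>z. 0 < z \<and> z < s \<and> ?f s - ?f 0 = (s - 0) * ?f1 z"
        using False that by (intro MVT2) (auto intro: d1)
      then obtain z where z: "0 < z" "z < s" "?f s - ?f 0 = s * ?f1 z" by auto
      have "\<bar>s * ?f1 z\<bar> \<le> 1 * (m * b * R)"
        unfolding abs_mult
      proof (intro mult_mono)
        show "\<bar>?f1 z\<bar> \<le> m * b * R"
          by (rule order_trans[OF f1 mult_left_mono]) (use z that r b m in auto)
      qed (use that in auto)
      with z show ?thesis by simp
    qed (use b m R in auto)
    have "\<bar>?e 1 - ?e 0 - ?f1 0 * ?e 0\<bar> \<le> M * r\<^sup>2"
    proof (rule abs_taylor2_unit_interval[where f = ?e and f' = "\<lambda>s. ?f1 s * ?e s"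
          and f'' = "\<lambda>s. (?f2 s + (?f1 s)\<^sup>2) * ?e s"])
      fix s :: real assume s: "0 \<le> s" "s \<le> 1"
      show e: "(?e has_real_derivative ?f1 s * ?e s) (at s)"
        by (rule DERIV_cong[OF DERIV_fun_exp[OF DERIV_diff[OF d1 DERIV_const]]]) simp
      show "((\<lambda>s. ?f1 s * ?e s) has_real_derivative (?f2 s + (?f1 s)\<^sup>2) * ?e s) (at s)"
        using DERIV_mult[OF d2 e] by (simp add: algebra_simps power2_eq_square)
      have "\<bar>(?f1 s)\<^sup>2\<bar> \<le> (m * b * r)\<^sup>2"
        using power_mono[OF f1[OF s] abs_ge_zero, of 2] by simp
      then have "\<bar>?f2 s + (?f1 s)\<^sup>2\<bar> \<le> m\<^sup>2 * b * r\<^sup>2 + (m * b * r)\<^sup>2"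
        using f2[OF s] by linarith
      moreover have "?e s \<le> exp (m * b * R)" using inc[OF s] by simp
      ultimately have "\<bar>?f2 s + (?f1 s)\<^sup>2\<bar> * ?e s \<le> (m\<^sup>2 * b * r\<^sup>2 + (m * b * r)\<^sup>2) * exp (m * b * R)"
        using b by (intro mult_mono) auto
      also have "m\<^sup>2 * b * r\<^sup>2 + (m * b * r)\<^sup>2 = (m\<^sup>2 * b + (m * b)\<^sup>2) * r\<^sup>2"
        by (simp add: power_mult_distrib distrib_right)
      also have "\<dots> * exp (m * b * R) = M * r\<^sup>2" by (simp only: M_def mult_ac)
      finally show "\<bar>(?f2 s + (?f1 s)\<^sup>2) * ?e s\<bar> \<le> M * r\<^sup>2" by (simp add: abs_mult)
    qed
    then have "\<bar>exp (F (\<lambda>i. \<theta> + h i) - F (\<lambda>_. \<theta>)) - 1 - (\<Sum>i\<le>n. h i \<bullet> pgrad i F (\<lambda>_. \<theta>))\<bar> \<le> M * r\<^sup>2"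
      by (simp add: t_def)
    also have "\<dots> \<le> (b + M) * r\<^sup>2" using b by (intro mult_right_mono) auto
    finally show "\<bar>exp (F (\<lambda>i. \<theta> + h i) - F (\<lambda>_. \<theta>)) - 1 - (\<Sum>i\<le>n. h i \<bullet> pgrad i F (\<lambda>_. \<theta>))\<bar>
        \<le> (b + M) * r\<^sup>2" .
  qed
qed

lemma gradient_diagonal:
  fixes F :: "(nat \<Rightarrow> 'a::euclidean_space) \<Rightarrow> real"
  assumes "tuple_differentiable n F (\<lambda>_. \<theta>)" and dep: "depends_upto n F"
  shows "gradient (\<lambda>v. F (\<lambda>_. v)) \<theta> = (\<Sum>i\<le>n. pgrad i F (\<lambda>_. \<theta>))"
proof (rule gradient_eqI)
  obtain D where D: "tuple_has_derivative n F D (\<lambda>_. \<theta>)"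
    using assms by (auto simp: tuple_differentiable_def)
  have eq: "(\<Sum>i\<le>n. D i h) = h \<bullet> (\<Sum>i\<le>n. pgrad i F (\<lambda>_. \<theta>))" for h
    by (simp add: inner_sum_right tuple_has_derivative_pgrad(2)[OF D])
  define c where "c = sqrt (real (Suc n))"
  have c: "0 < c" by (simp add: c_def)
  have norm: "tuple_norm n (\<lambda>_. h) = c * norm h" for h :: 'a
    by (simp add: tuple_norm_def L2_set_def c_def real_sqrt_mult)
  show "GDERIV (\<lambda>v. F (\<lambda>_. v)) \<theta> :> (\<Sum>i\<le>n. pgrad i F (\<lambda>_. \<theta>))"
    unfolding gderiv_def has_derivative_at_alt
  proof (intro conjI allI impI)
    show "bounded_linear (\<lambda>h. h \<bullet> (\<Sum>i\<le>n. pgrad i F (\<lambda>_. \<theta>)))" by (rule bounded_linear_inner_left)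
  next
    fix e :: real assume "0 < e"
    then have "0 < e / c" using c by simp
    then obtain d where d: "0 < d" and b: "\<And>h'. tuple_norm n h' < d \<Longrightarrow>
        norm (F (\<lambda>i. \<theta> + h' i) - F (\<lambda>_. \<theta>) - (\<Sum>i\<le>n. D i (h' i))) \<le> e / c * tuple_norm n h'"
      using D unfolding tuple_has_derivative_def by meson
    show "\<exists>d>0. \<forall>y. norm (y - \<theta>) < d \<longrightarrow> norm (F (\<lambda>_. y) - F (\<lambda>_. \<theta>)
        - (y - \<theta>) \<bullet> (\<Sum>i\<le>n. pgrad i F (\<lambda>_. \<theta>))) \<le> e * norm (y - \<theta>)"
    proof (intro exI conjI allI impI)
      show "0 < d / c" using d c by simp
      fix y assume "norm (y - \<theta>) < d / c"
      then have "tuple_norm n (\<lambda>_. y - \<theta>) < d" using c by (simp add: norm field_simps)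
      from b[OF this] show "norm (F (\<lambda>_. y) - F (\<lambda>_. \<theta>)
        - (y - \<theta>) \<bullet> (\<Sum>i\<le>n. pgrad i F (\<lambda>_. \<theta>))) \<le> e * norm (y - \<theta>)"
        using c by (simp add: eq norm)
    qed
  qed
qed

section \<open>Perturbation of matrix inverses\<close>

lemma matrix_inv_mult:
  assumes "invertible (A :: 'a::semiring_1 ^ 'n::finite ^ 'n)"
  shows "A ** matrix_inv A = mat 1" "matrix_inv A ** A = mat 1"
  using someI_ex[OF assms[unfolded invertible_def]] by (simp_all add: matrix_inv_def)

lemma matrix_inv_apply:
  assumes "invertible (A :: real ^ 'n::finite ^ 'n)"
  shows "A *v (matrix_inv A *v x) = x" "matrix_inv A *v (A *v x) = x"
  by (simp_all add: matrix_vector_mul_assoc matrix_inv_mult[OF assms])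

lemma invertible_if_ker_trivial:
  fixes A :: "real ^ 'n::finite ^ 'n"
  assumes "\<And>x. A *v x = 0 \<Longrightarrow> x = 0"
  shows "invertible A"
  using assms matrix_left_invertible_ker[of A] by (simp add: invertible_left_inverse)

text \<open>
  The estimate is stated for \<open>y\<close> and \<open>B *v y\<close> instead of \<open>matrix_inv B *v x\<close> and \<open>x\<close>, which avoids
  computing with the inverse of \<open>B\<close>.
\<close>

lemma inverse_perturbation:
  fixes A :: "real ^ 'n::finite ^ 'n"
  assumes A: "invertible A"
  shows "\<exists>d>0. \<exists>c\<ge>0. \<forall>B e. (\<forall>i j. \<bar>B $ i $ j - A $ i $ j\<bar> \<le> e) \<longrightarrow> e \<le> d \<longrightarrow>
       invertible B \<and> (\<forall>y. norm (y - matrix_inv A *v (B *v y)) \<le> c * e * norm (B *v y))"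
proof -
  define k where "k = onorm ((*v) (matrix_inv A))"
  have k: "0 \<le> k" unfolding k_def by (intro onorm_pos_le) auto
  have kn: "norm (matrix_inv A *v x) \<le> k * norm x" for x
    unfolding k_def by (intro onorm) auto
  define N where "N = real CARD('n) * real CARD('n)"
  have N: "0 \<le> N" by (simp add: N_def)
  show ?thesis
  proof (rule exI[of _ "1 / (2 * (k * N + 1))"], intro exI[of _ "2 * k * k * N"] conjI allI impI)
    show "0 < 1 / (2 * (k * N + 1))" "0 \<le> 2 * k * k * N"
      using k N by (auto intro!: divide_pos_pos add_nonneg_pos)
    fix B :: "real ^ 'n ^ 'n" and e :: real
    assume "\<forall>i j. \<bar>B $ i $ j - A $ i $ j\<bar> \<le> e" and d: "e \<le> 1 / (2 * (k * N + 1))"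
    then have e: "\<bar>B $ i $ j - A $ i $ j\<bar> \<le> e" for i j by simp
    have e0: "0 \<le> e" using e order_trans abs_ge_zero by metis
    have "onorm ((*v) (A - B)) \<le> N * e"
      unfolding N_def by (rule onorm_le_matrix_component) (use e in \<open>simp add: abs_minus_commute\<close>)
    then have AB: "norm ((A - B) *v y) \<le> N * e * norm y" for y
      using onorm[of "(*v) (A - B)" y] mult_right_mono[OF _ norm_ge_zero[of y]] by fastforce
    have diff: "norm (y - matrix_inv A *v (B *v y)) \<le> k * N * e * norm y" for y
    proof -
      have "y - matrix_inv A *v (B *v y) = matrix_inv A *v ((A - B) *v y)"
        by (simp add: matrix_vector_mult_diff_rdistrib matrix_vector_mult_diff_distrib
            matrix_inv_apply[OF A])
      also have "norm \<dots> \<le> k * (N * e * norm y)"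
        using kn AB k by (meson mult_left_mono order_trans)
      finally show ?thesis by (simp add: mult.assoc)
    qed
    have "k * N * e \<le> k * N * (1 / (2 * (k * N + 1)))" using d k N by (intro mult_left_mono) auto
    also have "\<dots> = k * N / (k * N + 1) / 2" by simp
    also have "\<dots> \<le> 1 / 2"
      using mult_nonneg_nonneg[OF k N] by (intro divide_right_mono) (auto simp: divide_le_eq_1)
    finally have half: "k * N * e \<le> 1 / 2" .
    have inv_bound: "norm y \<le> 2 * k * norm (B *v y)" for y
    proof -
      have "norm y \<le> norm (y - matrix_inv A *v (B *v y)) + norm (matrix_inv A *v (B *v y))"
        using norm_triangle_ineq[of "y - matrix_inv A *v (B *v y)" "matrix_inv A *v (B *v y)"] by simp
      also have "\<dots> \<le> 1 / 2 * norm y + k * norm (B *v y)"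
        using diff[of y] mult_right_mono[OF half norm_ge_zero[of y]] kn[of "B *v y"] by linarith
      finally show ?thesis by simp
    qed
    show "invertible B"
    proof (rule invertible_if_ker_trivial)
      fix y assume "B *v y = 0"
      with inv_bound[of y] show "y = 0" by simp
    qed
    show "norm (y - matrix_inv A *v (B *v y)) \<le> 2 * k * k * N * e * norm (B *v y)" for y
    proof -
      have "k * N * e * norm y \<le> k * N * e * (2 * k * norm (B *v y))"
        using k N e0 inv_bound by (intro mult_left_mono) auto
      with diff[of y] show ?thesis by (simp add: algebra_simps)
    qed
  qed
qed

section \<open>Moments of the displacements\<close>

lemma norm_le_if_inner_le:
  fixes x :: "'a::real_inner"
  assumes "\<And>u. \<bar>u \<bullet> x\<bar> \<le> norm u * c" and "0 \<le> c"
  shows "norm x \<le> c"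
proof (cases "x = 0")
  case False
  have "norm x * norm x \<le> norm x * c" using assms(1)[of x] by (simp flip: power2_norm_eq_inner power2_eq_square)
  with False show ?thesis by simp
qed (use assms in simp)

lemma abs_inner_le: "norm z \<le> r \<Longrightarrow> \<bar>u \<bullet> z\<bar> \<le> norm u * r"
  by (rule order_trans[OF Cauchy_Schwarz_ineq2 mult_left_mono]) auto

text \<open>
  The perturbation kernel: \<open>D\<close> is the law of one draw, \<open>Sig\<close> its covariance matrix, \<open>radius\<close> an
  almost sure bound for it, and \<open>Q n\<close> the joint law of the draws at times \<open>0, \<dots>, n\<close>.
\<close>

locale perturbation_kernel =
  fixes \<kappa> :: "real ^ 'p::finite \<Rightarrow> real"
  assumes kernel: "perturbation_density \<kappa>"
begin

definition D :: "(real ^ 'p) measure" where "D = density lborel \<kappa>"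

definition Sig :: "real ^ 'p ^ 'p" where "Sig = cov_matrix D (\<lambda>z. z)"

lemma sets_D [simp, measurable_cong]: "sets D = sets borel"
  by (simp add: D_def)

lemma space_D [simp]: "space D = UNIV"
  by (simp add: D_def)

lemma kernel_measurable [measurable]: "\<kappa> \<in> borel_measurable borel"
  using kernel by (simp add: perturbation_density_def)

sublocale D: prob_space D
  using kernel by (simp add: perturbation_density_def D_def)

lemma prob_D: "measure D UNIV = 1"
  using D.prob_space by simp

lemma mean_D: "(\<integral>z. z \<partial>D) = 0"
  using kernel by (simp add: perturbation_density_def D_def)

lemma D_bounded: "\<exists>R\<ge>1. AE z in D. norm z \<le> R"
proof -
  have "bounded (closure {z. \<kappa> z \<noteq> 0})"
    using kernel by (auto simp: perturbation_density_def compact_imp_bounded)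
  then have "bounded {z. \<kappa> z \<noteq> 0}" by (rule bounded_subset[OF _ closure_subset])
  then obtain R where R: "norm z \<le> R" if "\<kappa> z \<noteq> 0" for z unfolding bounded_iff by auto
  have "norm z \<le> max 1 R" if "0 < \<kappa> z" for z
    using R[of z] that by simp
  then have "AE z in D. norm z \<le> max 1 R"
    unfolding D_def by (subst AE_density) auto
  then show ?thesis by (intro exI[of _ "max 1 R"]) auto
qed

definition radius :: real where
  "radius = (SOME R. 1 \<le> R \<and> (AE z in D. norm z \<le> R))"

lemma radius: "1 \<le> radius" "AE z in D. norm z \<le> radius"
  using someI_ex[OF D_bounded] by (auto simp: radius_def)

lemma integrable_D_linear [simp]: "integrable D (\<lambda>z. u \<bullet> z)"
proof (rule D.integrable_const_bound[where B = "norm u * radius"])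
  show "AE z in D. norm (u \<bullet> z) \<le> norm u * radius"
    using radius(2)
    by eventually_elim (simp add: abs_inner_le)
qed simp

lemma integrable_D_bilinear [simp]: "integrable D (\<lambda>z. (u \<bullet> z) * (v \<bullet> z))"
proof (rule D.integrable_const_bound[where B = "(norm u * radius) * (norm v * radius)"])
  show "AE z in D. norm ((u \<bullet> z) * (v \<bullet> z)) \<le> (norm u * radius) * (norm v * radius)"
    using radius(2)
  proof eventually_elim
    case (elim z)
    have "\<bar>w \<bullet> z\<bar> \<le> norm w * radius" for w
      using elim by (simp add: abs_inner_le)
    then show ?case unfolding real_norm_def abs_mult
      using radius(1) by (intro mult_mono) auto
  qed
qed simp

lemma integral_D_linear: "(\<integral>z. u \<bullet> z \<partial>D) = 0"
proof -
  have "integrable D (\<lambda>z. z)"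
    by (rule D.integrable_const_bound[where B = radius]) (use radius in auto)
  then have "(\<integral>z. u \<bullet> z \<partial>D) = u \<bullet> (\<integral>z. z \<partial>D)" by simp
  then show ?thesis by (simp add: mean_D)
qed

lemma Sig_nth: "Sig $ i $ j = (\<integral>z. z $ i * z $ j \<partial>D)"
  by (simp add: Sig_def cov_matrix_def mean_D)

lemma integral_D_bilinear: "(\<integral>z. (u \<bullet> z) * (v \<bullet> z) \<partial>D) = u \<bullet> (Sig *v v)"
proof -
  have i: "integrable D (\<lambda>z. z $ i * z $ j)" for i j
    using integrable_D_bilinear[of "axis i 1" "axis j 1"] by (simp add: inner_axis')
  have "(\<integral>z. (u \<bullet> z) * (v \<bullet> z) \<partial>D)
      = (\<integral>z. (\<Sum>i\<in>UNIV. \<Sum>j\<in>UNIV. (u $ i * v $ j) * (z $ i * z $ j)) \<partial>D)"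
    by (simp add: inner_vec_def sum_product algebra_simps)
  also have "\<dots> = (\<Sum>i\<in>UNIV. \<Sum>j\<in>UNIV. (u $ i * v $ j) * Sig $ i $ j)"
    by (simp add: i Sig_nth)
  also have "\<dots> = u \<bullet> (Sig *v v)"
    by (simp add: inner_vec_def matrix_vector_mult_def sum_distrib_left algebra_simps)
  finally show ?thesis .
qed

text \<open>
  A null direction of the covariance matrix would confine the law to a hyperplane, which is
  impossible for a law with a density.
\<close>

lemma invertible_Sig: "invertible Sig"
proof (rule invertible_if_ker_trivial)
  fix u assume u: "Sig *v u = 0"
  show "u = 0"
  proof (rule ccontr)
    assume "u \<noteq> 0"
    have "(\<integral>z. (u \<bullet> z) * (u \<bullet> z) \<partial>D) = 0" by (simp add: integral_D_bilinear u)
    then have "AE z in D. (u \<bullet> z) * (u \<bullet> z) = 0"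
      by (subst (asm) integral_nonneg_eq_0_iff_AE) auto
    moreover have "AE z in D. u \<bullet> z \<noteq> 0"
    proof -
      have "negligible {z. u \<bullet> z = 0}" using \<open>u \<noteq> 0\<close> by (intro negligible_hyperplane) auto
      moreover have "{z. u \<bullet> z = 0} \<in> sets lborel" by simp
      ultimately have "{z. u \<bullet> z = 0} \<in> null_sets lborel"
        by (simp add: negligible_iff_null_sets null_sets_completion_iff)
      then have "AE z in lborel. u \<bullet> z \<noteq> 0"
        by (intro AE_I'[where N = "{z. u \<bullet> z = 0}"]) auto
      then show ?thesis
        unfolding D_def by (subst AE_density) (auto elim: eventually_mono)
    qed
    ultimately have "AE z in D. False" by eventually_elim simp
    then show False by simp
  qed
qed

definition Q :: "nat \<Rightarrow> (nat \<Rightarrow> real ^ 'p) measure" where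
  "Q n = PiM {..n} (\<lambda>_. D)"

lemma prob_space_Q: "prob_space (Q n)"
  unfolding Q_def by (intro prob_space_PiM D.prob_space_axioms)

lemma sets_Q [measurable_cong]: "sets (Q n) = sets (PiM {..n} (\<lambda>_. borel))"
  unfolding Q_def by (intro sets_PiM_cong) auto

lemma measurable_Q_component [measurable]: "a \<le> n \<Longrightarrow> (\<lambda>z. z a) \<in> borel_measurable (Q n)"
  unfolding measurable_cong_sets[OF sets_Q refl] by measurable

lemma AE_Q_component: "a \<le> n \<Longrightarrow> AE z in Q n. norm (z a) \<le> radius"
  unfolding Q_def by (intro AE_PiM_component D.prob_space_axioms radius) auto

lemma AE_Q: "AE z in Q n. \<forall>a\<le>n. norm (z a) \<le> radius"
proof -
  have "AE z in Q n. \<forall>a\<in>{..n}. norm (z a) \<le> radius"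
    by (rule AE_finite_allI) (auto intro: AE_Q_component)
  then show ?thesis unfolding Ball_def atMost_iff .
qed

lemma integral_Q_prod:
  assumes "\<And>i. i \<le> n \<Longrightarrow> integrable D (f i)"
  shows "(\<integral>z. (\<Prod>i\<le>n. f i (z i)) \<partial>Q n) = (\<Prod>i\<le>n. \<integral>z. f i z \<partial>D :: real)"
proof -
  interpret product_sigma_finite "\<lambda>_. D" by unfold_locales
  show ?thesis unfolding Q_def by (rule product_integral_prod) (use assms in auto)
qed

lemma integral_Q_bilinear:
  assumes "a \<le> n" "b \<le> n"
  shows "(\<integral>z. (u \<bullet> z a) * (v \<bullet> z b) \<partial>Q n) = (if a = b then u \<bullet> (Sig *v v) else 0)"
proof -
  \<comment> \<open>This product form covers \<open>a = b\<close> and \<open>a \<noteq> b\<close> with one application of Fubini's theorem.\<close>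
  let ?f = "\<lambda>i z. (if i = a then u \<bullet> z else 1) * (if i = b then v \<bullet> z else 1)"
  have "(\<Prod>i\<le>n. ?f i (z i)) = (u \<bullet> z a) * (v \<bullet> z b)" for z
    using assms by (simp add: prod.distrib)
  then have "(\<integral>z. (u \<bullet> z a) * (v \<bullet> z b) \<partial>Q n) = (\<integral>z. (\<Prod>i\<le>n. ?f i (z i)) \<partial>Q n)" by simp
  also have "\<dots> = (\<Prod>i\<le>n. \<integral>z. ?f i z \<partial>D)"
  proof (rule integral_Q_prod)
    show "integrable D (?f i)" for i by (cases "i = a"; cases "i = b") simp_all
  qed
  also have "\<dots> = (if a = b then u \<bullet> (Sig *v v) else 0)"
  proof (cases "a = b")
    case True
    then have "(\<integral>z. ?f i z \<partial>D) = (if i = a then u \<bullet> (Sig *v v) else 1)" for i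
      by (simp add: integral_D_bilinear prob_D)
    with True assms show ?thesis by simp
  next
    case False
    then have "(\<integral>z. ?f a z \<partial>D) = 0" by (simp add: integral_D_linear)
    then have "\<exists>i\<in>{..n}. (\<integral>z. ?f i z \<partial>D) = 0" by (rule bexI) (use assms in simp)
    then have "(\<Prod>i\<le>n. \<integral>z. ?f i z \<partial>D) = 0" by (intro prod_zero) auto
    with False show ?thesis by simp
  qed
  finally show ?thesis .
qed

lemma integral_Q_linear:
  assumes "a \<le> n"
  shows "(\<integral>z. u \<bullet> z a \<partial>Q n) = 0"
proof -
  let ?f = "\<lambda>i z. if i = a then u \<bullet> z else 1"
  have "(\<Prod>i\<le>n. ?f i (z i)) = u \<bullet> z a" for z :: "nat \<Rightarrow> real ^ 'p" using assms by simp
  then have "(\<integral>z. u \<bullet> z a \<partial>Q n) = (\<integral>z. (\<Prod>i\<le>n. ?f i (z i)) \<partial>Q n)" by simp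
  also have "\<dots> = (\<Prod>i\<le>n. \<integral>z. ?f i z \<partial>D)"
  proof (rule integral_Q_prod)
    show "integrable D (?f i)" for i by (cases "i = a") simp_all
  qed
  also have "\<dots> = 0" by (rule prod_zero) (use assms in \<open>auto simp: integral_D_linear intro!: bexI[of _ a]\<close>)
  finally show ?thesis .
qed

text \<open>
  The displacement of the parameter at time \<open>k\<close> when the draws are \<open>z\<close>, and its coefficients as a
  linear combination of the draws.
\<close>

definition disp :: "real \<Rightarrow> real \<Rightarrow> nat \<Rightarrow> (nat \<Rightarrow> real ^ 'p) \<Rightarrow> real ^ 'p" where
  "disp \<sigma> \<tau> k z = \<tau> *\<^sub>R z 0 + \<sigma> *\<^sub>R (\<Sum>j\<in>{1..k}. z j)"

definition disp_coeff :: "real \<Rightarrow> real \<Rightarrow> nat \<Rightarrow> nat \<Rightarrow> real" where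
  "disp_coeff \<sigma> \<tau> k j = (if j = 0 then \<tau> else if j \<le> k then \<sigma> else 0)"

lemma disp_sum:
  assumes "k \<le> n"
  shows "disp \<sigma> \<tau> k z = (\<Sum>j\<le>n. disp_coeff \<sigma> \<tau> k j *\<^sub>R z j)"
proof -
  have "(\<Sum>j\<in>{1..k}. z j) = (\<Sum>j\<in>{1..n}. if j \<le> k then z j else 0)"
    using assms by (intro sum.mono_neutral_cong_left) auto
  then have "disp \<sigma> \<tau> k z = disp_coeff \<sigma> \<tau> k 0 *\<^sub>R z 0 + (\<Sum>j\<in>{1..n}. disp_coeff \<sigma> \<tau> k j *\<^sub>R z j)"
    by (auto simp: disp_def disp_coeff_def scaleR_sum_right intro!: sum.cong)
  also have "\<dots> = (\<Sum>j\<in>insert 0 {1..n}. disp_coeff \<sigma> \<tau> k j *\<^sub>R z j)" by simp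
  also have "insert 0 {1..n} = {..n}" by auto
  finally show ?thesis .
qed

lemma disp_coeff_square_sum:
  assumes "i \<le> n"
  shows "(\<Sum>j\<le>n. disp_coeff \<sigma> \<tau> n j * disp_coeff \<sigma> \<tau> i j) = \<tau>\<^sup>2 + real i * \<sigma>\<^sup>2"
proof -
  have "{..n} = insert 0 {1..n}" by auto
  then have "(\<Sum>j\<le>n. disp_coeff \<sigma> \<tau> n j * disp_coeff \<sigma> \<tau> i j)
      = \<tau>\<^sup>2 + (\<Sum>j\<in>{1..n}. disp_coeff \<sigma> \<tau> n j * disp_coeff \<sigma> \<tau> i j)"
    by (simp add: disp_coeff_def power2_eq_square)
  also have "(\<Sum>j\<in>{1..n}. disp_coeff \<sigma> \<tau> n j * disp_coeff \<sigma> \<tau> i j) = (\<Sum>j\<in>{1..i}. \<sigma>\<^sup>2)"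
    using assms by (intro sum.mono_neutral_cong_right) (auto simp: disp_coeff_def power2_eq_square)
  finally show ?thesis by simp
qed

lemma measurable_disp [measurable]: "k \<le> n \<Longrightarrow> disp \<sigma> \<tau> k \<in> borel_measurable (Q n)"
  unfolding disp_def[abs_def] by (intro borel_measurable_add borel_measurable_scaleR
      borel_measurable_sum borel_measurable_const measurable_Q_component) auto

lemma disp_bound:
  assumes z: "\<forall>a\<le>n. norm (z a) \<le> radius" and k: "k \<le> n" and s: "0 \<le> \<sigma>" "\<sigma> \<le> \<tau>"
  shows "norm (disp \<sigma> \<tau> k z) \<le> real (Suc n) * radius * \<tau>"
proof -
  have "norm (disp_coeff \<sigma> \<tau> k j *\<^sub>R z j) \<le> \<tau> * radius" if "j \<in> {..n}" for j
    unfolding norm_scaleR using z s that by (intro mult_mono) (auto simp: disp_coeff_def)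
  then have "norm (\<Sum>j\<le>n. disp_coeff \<sigma> \<tau> k j *\<^sub>R z j) \<le> of_nat (card {..n}) * (\<tau> * radius)"
    by (rule sum_norm_bound)
  then show ?thesis by (simp add: disp_sum[OF k] algebra_simps)
qed

lemma AE_disp_bound:
  assumes "0 \<le> \<sigma>" "\<sigma> \<le> \<tau>"
  shows "AE z in Q n. \<forall>k\<le>n. norm (disp \<sigma> \<tau> k z) \<le> real (Suc n) * radius * \<tau>"
  using AE_Q[of n] by eventually_elim (use assms disp_bound in blast)

lemma integrable_Q_bounded:
  fixes f :: "(nat \<Rightarrow> real ^ 'p) \<Rightarrow> 'b::{banach, second_countable_topology}"
  assumes "AE z in Q n. norm (f z) \<le> B" "f \<in> borel_measurable (Q n)"
  shows "integrable (Q n) f"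
proof -
  interpret prob_space "Q n" by (rule prob_space_Q)
  show ?thesis using assms by (rule integrable_const_bound)
qed

lemma integral_Q_abs_le:
  fixes f :: "(nat \<Rightarrow> real ^ 'p) \<Rightarrow> real"
  assumes B: "AE z in Q n. \<bar>f z\<bar> \<le> B" and B0: "0 \<le> B"
  shows "\<bar>\<integral>z. f z \<partial>Q n\<bar> \<le> B"
proof (cases "integrable (Q n) f")
  case True
  interpret prob_space "Q n" by (rule prob_space_Q)
  have "\<bar>\<integral>z. f z \<partial>Q n\<bar> \<le> (\<integral>z. \<bar>f z\<bar> \<partial>Q n)" by (rule integral_abs_bound)
  also have "\<dots> \<le> (\<integral>z. B \<partial>Q n)" using True B by (intro integral_mono_AE) auto
  finally show ?thesis by (simp add: prob_space)
qed (use B0 in \<open>simp add: not_integrable_integral_eq\<close>)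

lemma integrable_Q_linear: "a \<le> n \<Longrightarrow> integrable (Q n) (\<lambda>z. u \<bullet> z a)"
proof (rule integrable_Q_bounded[where B = "norm u * radius"])
  assume "a \<le> n"
  show "AE z in Q n. norm (u \<bullet> z a) \<le> norm u * radius"
    using AE_Q_component[OF \<open>a \<le> n\<close>]
    by eventually_elim (simp add: abs_inner_le)
qed simp

lemma integrable_Q_bilinear:
  assumes "a \<le> n" "b \<le> n"
  shows "integrable (Q n) (\<lambda>z. (u \<bullet> z a) * (v \<bullet> z b))"
proof (rule integrable_Q_bounded[where B = "(norm u * radius) * (norm v * radius)"])
  show "AE z in Q n. norm ((u \<bullet> z a) * (v \<bullet> z b)) \<le> (norm u * radius) * (norm v * radius)"
    using AE_Q
  proof eventually_elim
    case (elim z)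
    then have "\<bar>w \<bullet> z a\<bar> \<le> norm w * radius" "\<bar>w \<bullet> z b\<bar> \<le> norm w * radius" for w
      using assms by (simp_all add: abs_inner_le)
    then show ?case unfolding real_norm_def abs_mult
      using radius(1) by (intro mult_mono) auto
  qed
qed (use assms in simp)

lemma integral_disp_linear: "k \<le> n \<Longrightarrow> (\<integral>z. u \<bullet> disp \<sigma> \<tau> k z \<partial>Q n) = 0"
  by (simp add: disp_sum inner_sum_right integral_Q_linear integrable_Q_linear)

text \<open>
  Independence and zero means leave only the products of a draw with itself. In particular there is
  no term of order \<open>\<tau> * \<sigma>\<close>, which would spoil the rate \<open>\<sigma>\<^sup>2 / \<tau>\<^sup>2\<close>.
\<close>

lemma integral_disp_bilinear:
  assumes "i \<le> n"
  shows "(\<integral>z. (u \<bullet> disp \<sigma> \<tau> n z) * (v \<bullet> disp \<sigma> \<tau> i z) \<partial>Q n)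
    = (\<tau>\<^sup>2 + real i * \<sigma>\<^sup>2) * (u \<bullet> (Sig *v v))"
proof -
  let ?c = "disp_coeff \<sigma> \<tau>"
  have "(u \<bullet> disp \<sigma> \<tau> n z) * (v \<bullet> disp \<sigma> \<tau> i z)
      = (\<Sum>a\<le>n. \<Sum>b\<le>n. (?c n a * ?c i b) * ((u \<bullet> z a) * (v \<bullet> z b)))" for z
    by (simp add: disp_sum[OF order_refl[of n]] disp_sum[OF assms] inner_sum_right sum_product algebra_simps)
  then have "(\<integral>z. (u \<bullet> disp \<sigma> \<tau> n z) * (v \<bullet> disp \<sigma> \<tau> i z) \<partial>Q n)
      = (\<integral>z. (\<Sum>a\<le>n. \<Sum>b\<le>n. (?c n a * ?c i b) * ((u \<bullet> z a) * (v \<bullet> z b))) \<partial>Q n)" by simp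
  also have "\<dots> = (\<Sum>a\<le>n. \<integral>z. (\<Sum>b\<le>n. (?c n a * ?c i b) * ((u \<bullet> z a) * (v \<bullet> z b))) \<partial>Q n)"
    by (intro Bochner_Integration.integral_sum Bochner_Integration.integrable_sum
        integrable_mult_right integrable_Q_bilinear) auto
  also have "\<dots> = (\<Sum>a\<le>n. \<Sum>b\<le>n. \<integral>z. (?c n a * ?c i b) * ((u \<bullet> z a) * (v \<bullet> z b)) \<partial>Q n)"
    by (intro sum.cong refl Bochner_Integration.integral_sum integrable_mult_right integrable_Q_bilinear) auto
  also have "\<dots> = (\<Sum>a\<le>n. \<Sum>b\<le>n. (?c n a * ?c i b) * (\<integral>z. (u \<bullet> z a) * (v \<bullet> z b) \<partial>Q n))"
    by simp
  also have "\<dots> = (\<Sum>a\<le>n. \<Sum>b\<le>n. if a = b then ?c n a * ?c i a * (u \<bullet> (Sig *v v)) else 0)"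
    by (intro sum.cong refl) (simp add: integral_Q_bilinear)
  also have "\<dots> = (\<Sum>a\<le>n. ?c n a * ?c i a) * (u \<bullet> (Sig *v v))"
    by (simp add: sum_distrib_right)
  finally show ?thesis by (simp add: disp_coeff_square_sum[OF assms])
qed

section \<open>Moments under weights close to one\<close>

text \<open>
  For \<open>0 \<le> \<sigma> \<le> \<tau>\<close> the displacements up to time \<open>n\<close> are almost surely bounded by \<open>rho n * \<tau>\<close>, and
  \<open>snorm\<close> is the operator norm of the covariance matrix.
\<close>

definition rho :: "nat \<Rightarrow> real" where "rho n = real (Suc n) * radius"

definition snorm :: real where "snorm = onorm ((*v) Sig)"

lemma rho_pos: "0 \<le> rho n" using radius(1) by (simp add: rho_def)

lemma snorm_nonneg: "0 \<le> snorm"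
  unfolding snorm_def by (rule onorm_pos_le) simp

lemma Sig_sum: "Sig *v (\<Sum>i\<in>I. g i) = (\<Sum>i\<in>I. Sig *v g i)"
  by (rule linear_sum) simp

lemma snorm_bound: "\<bar>u \<bullet> (Sig *v v)\<bar> \<le> norm u * (snorm * norm v)"
  unfolding snorm_def by (intro abs_inner_le onorm) simp

text \<open>
  The constants below bound, for weights \<open>W\<close> that are \<open>1\<close> plus a linear form of the displacements
  up to second order, the deviation of \<open>W\<close> from \<open>1\<close> and the error in the weighted mean displacement.
\<close>

definition dev_const :: "nat \<Rightarrow> real \<Rightarrow> real" where
  "dev_const n C = C * (rho n)\<^sup>2 + real (Suc n) * rho n * C"

definition mean_const :: "nat \<Rightarrow> real \<Rightarrow> real" where
  "mean_const n C = C * rho n ^ 3 + real (Suc n) * real (Suc n) * snorm * C"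

lemma dev_const_nonneg: "0 \<le> C \<Longrightarrow> 0 \<le> dev_const n C"
  using rho_pos[of n] by (simp add: dev_const_def)

lemma mean_const_nonneg: "0 \<le> C \<Longrightarrow> 0 \<le> mean_const n C"
  using rho_pos[of n] snorm_nonneg by (simp add: mean_const_def)

lemma AE_disp: "0 \<le> \<sigma> \<Longrightarrow> \<sigma> \<le> \<tau> \<Longrightarrow> AE z in Q n. \<forall>k\<le>n. norm (disp \<sigma> \<tau> k z) \<le> rho n * \<tau>"
  unfolding rho_def by (rule AE_disp_bound)

lemma weight_deviation:
  assumes s: "0 \<le> \<sigma>" "\<sigma> \<le> \<tau>" "\<tau> \<le> 1" and C: "0 \<le> C"
    and W: "AE z in Q n. \<bar>W z - 1 - (\<Sum>i\<le>n. disp \<sigma> \<tau> i z \<bullet> g i)\<bar> \<le> C * (rho n * \<tau>)\<^sup>2"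
    and g: "\<And>i. i \<le> n \<Longrightarrow> norm (g i) \<le> C"
  shows "AE z in Q n. \<bar>W z - 1\<bar> \<le> dev_const n C * \<tau>"
  using W AE_disp[OF s(1,2)]
proof eventually_elim
  case (elim z)
  have "\<bar>disp \<sigma> \<tau> i z \<bullet> g i\<bar> \<le> rho n * \<tau> * C" if "i \<in> {..n}" for i
  proof -
    have "\<bar>disp \<sigma> \<tau> i z \<bullet> g i\<bar> \<le> norm (disp \<sigma> \<tau> i z) * norm (g i)" by (rule Cauchy_Schwarz_ineq2)
    also have "\<dots> \<le> rho n * \<tau> * C"
      using elim g that rho_pos[of n] s by (intro mult_mono) auto
    finally show ?thesis .
  qed
  then have "\<bar>\<Sum>i\<le>n. disp \<sigma> \<tau> i z \<bullet> g i\<bar> \<le> of_nat (card {..n}) * (rho n * \<tau> * C)"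
    by (intro order_trans[OF sum_abs] sum_bounded_above)
  then have 1: "\<bar>\<Sum>i\<le>n. disp \<sigma> \<tau> i z \<bullet> g i\<bar> \<le> real (Suc n) * rho n * C * \<tau>" by (simp add: mult_ac)
  have "\<tau>\<^sup>2 \<le> \<tau>" using s by (simp add: power2_eq_square mult_left_le_one_le)
  then have 2: "C * (rho n * \<tau>)\<^sup>2 \<le> C * (rho n)\<^sup>2 * \<tau>"
    unfolding power_mult_distrib mult.assoc using C by (intro mult_left_mono) auto
  show ?case using elim(1) 1 2 unfolding dev_const_def distrib_right by linarith
qed

lemma abs_inner_disp:
  assumes "0 \<le> \<sigma>" "\<sigma> \<le> \<tau>"
  shows "AE z in Q n. \<forall>k\<le>n. \<forall>u. \<bar>u \<bullet> disp \<sigma> \<tau> k z\<bar> \<le> norm u * (rho n * \<tau>)"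
  using AE_disp[OF assms] by eventually_elim (auto intro: abs_inner_le)

text \<open>
  The weight splits into \<open>1\<close>, whose contribution vanishes, the linear form, which contributes the
  main term and \<open>O(\<sigma>\<^sup>2)\<close>, and a remainder of order \<open>\<tau>\<^sup>2\<close> that meets a displacement of order \<open>\<tau>\<close>.
\<close>

lemma weighted_displacement:
  fixes W :: "(nat \<Rightarrow> real ^ 'p) \<Rightarrow> real"
  assumes s: "0 \<le> \<sigma>" "\<sigma> \<le> \<tau>" and C: "0 \<le> C"
    and Wm [measurable]: "W \<in> borel_measurable (Q n)"
    and W: "AE z in Q n. \<bar>W z - 1 - (\<Sum>i\<le>n. disp \<sigma> \<tau> i z \<bullet> g i)\<bar> \<le> C * (rho n * \<tau>)\<^sup>2"
    and g: "\<And>i. i \<le> n \<Longrightarrow> norm (g i) \<le> C"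
  shows "\<bar>(\<integral>z. W z * (u \<bullet> disp \<sigma> \<tau> n z) \<partial>Q n) - \<tau>\<^sup>2 * (u \<bullet> (Sig *v (\<Sum>i\<le>n. g i)))\<bar>
    \<le> norm u * mean_const n C * (\<tau> ^ 3 + \<sigma>\<^sup>2)"
proof -
  let ?X = "\<lambda>z. u \<bullet> disp \<sigma> \<tau> n z"
  define rem where "rem z = W z - 1 - (\<Sum>i\<le>n. disp \<sigma> \<tau> i z \<bullet> g i)" for z
  have [measurable]: "disp \<sigma> \<tau> i \<in> borel_measurable (Q n)" if "i \<le> n" for i
    using that by (rule measurable_disp)
  have [measurable]: "disp \<sigma> \<tau> n \<in> borel_measurable (Q n)" by simp
  have remm [measurable]: "rem \<in> borel_measurable (Q n)"
    unfolding rem_def by (intro borel_measurable_diff borel_measurable_sum borel_measurable_inner) auto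
  have iX: "integrable (Q n) ?X"
    by (rule integrable_Q_bounded[where B = "norm u * (rho n * \<tau>)"])
      (use abs_inner_disp[OF s, of n] in \<open>auto elim: eventually_mono\<close>)
  have iXX: "integrable (Q n) (\<lambda>z. ?X z * (g i \<bullet> disp \<sigma> \<tau> i z))" if i: "i \<le> n" for i
  proof (rule integrable_Q_bounded[where B = "norm u * (rho n * \<tau>) * (norm (g i) * (rho n * \<tau>))"])
    show "AE z in Q n. norm (?X z * (g i \<bullet> disp \<sigma> \<tau> i z)) \<le> norm u * (rho n * \<tau>) * (norm (g i) * (rho n * \<tau>))"
      using abs_inner_disp[OF s, of n]
    proof eventually_elim
      case (elim z)
      show ?case unfolding real_norm_def abs_mult
        using elim i rho_pos[of n] s by (intro mult_mono) auto
    qed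
  qed (use i in measurable)
  have remX: "AE z in Q n. \<bar>rem z * ?X z\<bar> \<le> C * (rho n * \<tau>)\<^sup>2 * (norm u * (rho n * \<tau>))"
    using W abs_inner_disp[OF s, of n]
  proof eventually_elim
    case (elim z)
    show ?case unfolding abs_mult rem_def
      using elim C by (intro mult_mono) auto
  qed
  have irem: "integrable (Q n) (\<lambda>z. rem z * ?X z)"
    by (rule integrable_Q_bounded[OF remX[folded real_norm_def]]) measurable
  have "W z * ?X z = ?X z + (\<Sum>i\<le>n. ?X z * (g i \<bullet> disp \<sigma> \<tau> i z)) + rem z * ?X z" for z
    by (simp add: rem_def algebra_simps inner_commute flip: sum_distrib_left)
  then have "(\<integral>z. W z * ?X z \<partial>Q n)
      = (\<integral>z. ?X z + (\<Sum>i\<le>n. ?X z * (g i \<bullet> disp \<sigma> \<tau> i z)) + rem z * ?X z \<partial>Q n)" by simp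
  also have "\<dots> = (\<integral>z. ?X z + (\<Sum>i\<le>n. ?X z * (g i \<bullet> disp \<sigma> \<tau> i z)) \<partial>Q n) + (\<integral>z. rem z * ?X z \<partial>Q n)"
    using iX iXX irem
    by (intro Bochner_Integration.integral_add Bochner_Integration.integrable_add
        Bochner_Integration.integrable_sum) auto
  also have "(\<integral>z. ?X z + (\<Sum>i\<le>n. ?X z * (g i \<bullet> disp \<sigma> \<tau> i z)) \<partial>Q n)
      = (\<integral>z. ?X z \<partial>Q n) + (\<integral>z. (\<Sum>i\<le>n. ?X z * (g i \<bullet> disp \<sigma> \<tau> i z)) \<partial>Q n)"
    using iX iXX by (intro Bochner_Integration.integral_add Bochner_Integration.integrable_sum) auto
  also have "(\<integral>z. (\<Sum>i\<le>n. ?X z * (g i \<bullet> disp \<sigma> \<tau> i z)) \<partial>Q n)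
      = (\<Sum>i\<le>n. \<integral>z. ?X z * (g i \<bullet> disp \<sigma> \<tau> i z) \<partial>Q n)"
    using iXX by (intro Bochner_Integration.integral_sum) auto
  also have "(\<integral>z. ?X z \<partial>Q n) + (\<Sum>i\<le>n. \<integral>z. ?X z * (g i \<bullet> disp \<sigma> \<tau> i z) \<partial>Q n) + (\<integral>z. rem z * ?X z \<partial>Q n)
      = (\<Sum>i\<le>n. (\<tau>\<^sup>2 + real i * \<sigma>\<^sup>2) * (u \<bullet> (Sig *v g i))) + (\<integral>z. rem z * ?X z \<partial>Q n)"
    by (simp add: integral_disp_linear integral_disp_bilinear)
  finally have eq: "(\<integral>z. W z * ?X z \<partial>Q n) - \<tau>\<^sup>2 * (u \<bullet> (Sig *v (\<Sum>i\<le>n. g i)))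
      = \<sigma>\<^sup>2 * (\<Sum>i\<le>n. real i * (u \<bullet> (Sig *v g i))) + (\<integral>z. rem z * ?X z \<partial>Q n)"
    by (simp add: algebra_simps sum.distrib sum_distrib_left inner_sum_right Sig_sum)
  have "\<bar>real i * (u \<bullet> (Sig *v g i))\<bar> \<le> real (Suc n) * (norm u * (snorm * C))" if "i \<in> {..n}" for i
  proof -
    have "\<bar>u \<bullet> (Sig *v g i)\<bar> \<le> norm u * (snorm * norm (g i))" by (rule snorm_bound)
    also have "\<dots> \<le> norm u * (snorm * C)" using g that snorm_nonneg by (intro mult_left_mono) auto
    finally show ?thesis unfolding abs_mult using that by (intro mult_mono) auto
  qed
  then have "\<bar>\<Sum>i\<le>n. real i * (u \<bullet> (Sig *v g i))\<bar>
      \<le> of_nat (card {..n}) * (real (Suc n) * (norm u * (snorm * C)))"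
    by (intro order_trans[OF sum_abs] sum_bounded_above)
  then have "\<sigma>\<^sup>2 * \<bar>\<Sum>i\<le>n. real i * (u \<bullet> (Sig *v g i))\<bar>
      \<le> \<sigma>\<^sup>2 * (of_nat (card {..n}) * (real (Suc n) * (norm u * (snorm * C))))"
    by (intro mult_left_mono) auto
  then have 1: "\<bar>\<sigma>\<^sup>2 * (\<Sum>i\<le>n. real i * (u \<bullet> (Sig *v g i)))\<bar>
      \<le> norm u * (real (Suc n) * real (Suc n) * snorm * C) * \<sigma>\<^sup>2"
    by (simp only: abs_mult abs_power2 card_atMost mult_ac)
  have "\<bar>\<integral>z. rem z * ?X z \<partial>Q n\<bar> \<le> C * (rho n * \<tau>)\<^sup>2 * (norm u * (rho n * \<tau>))"
    using remX by (rule integral_Q_abs_le) (use C rho_pos[of n] s in auto)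
  then have 2: "\<bar>\<integral>z. rem z * ?X z \<partial>Q n\<bar> \<le> norm u * (C * rho n ^ 3) * \<tau> ^ 3"
    by (simp add: power2_eq_square power3_eq_cube mult_ac)
  have m: "real (Suc n) * real (Suc n) * snorm * C \<le> mean_const n C" "C * rho n ^ 3 \<le> mean_const n C"
    using C rho_pos[of n] snorm_nonneg by (simp_all add: mean_const_def)
  have "norm u * (real (Suc n) * real (Suc n) * snorm * C) * \<sigma>\<^sup>2 \<le> norm u * mean_const n C * \<sigma>\<^sup>2"
    by (intro mult_right_mono mult_left_mono m(1)) auto
  moreover have "norm u * (C * rho n ^ 3) * \<tau> ^ 3 \<le> norm u * mean_const n C * \<tau> ^ 3"
    using s by (intro mult_right_mono mult_left_mono m(2)) auto
  ultimately show ?thesis using 1 2 unfolding eq distrib_left by linarith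
qed

lemma integral_weight:
  fixes W :: "(nat \<Rightarrow> real ^ 'p) \<Rightarrow> real"
  assumes "W \<in> borel_measurable (Q n)" "AE z in Q n. \<bar>W z - 1\<bar> \<le> d" "0 \<le> d"
  shows "integrable (Q n) W" "\<bar>(\<integral>z. W z \<partial>Q n) - 1\<bar> \<le> d"
proof -
  interpret prob_space "Q n" by (rule prob_space_Q)
  show i: "integrable (Q n) W"
    by (rule integrable_Q_bounded[where B = "1 + d"])
      (use assms in \<open>auto elim!: eventually_mono\<close>)
  have "(\<integral>z. W z - 1 \<partial>Q n) = (\<integral>z. W z \<partial>Q n) - 1" using i by (simp add: prob_space)
  with integral_Q_abs_le[OF assms(2,3)] show "\<bar>(\<integral>z. W z \<partial>Q n) - 1\<bar> \<le> d" by simp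
qed

lemma abs_quotient_le:
  fixes a e x d :: real
  assumes e: "\<bar>e - 1\<bar> \<le> d" and d: "d \<le> 1 / 2"
  shows "\<bar>a / e - x\<bar> \<le> 2 * (\<bar>a - x\<bar> + d * \<bar>x\<bar>)"
proof -
  have e2: "1 / 2 \<le> e" using e d by linarith
  have "a / e - x = ((a - x) + (1 - e) * x) / e" using e2 by (simp add: field_simps)
  also have "\<bar>\<dots>\<bar> = \<bar>(a - x) + (1 - e) * x\<bar> / e" using e2 by simp
  also have "\<dots> \<le> \<bar>(a - x) + (1 - e) * x\<bar> / (1 / 2)" using e2 by (intro divide_left_mono) auto
  also have "\<bar>(a - x) + (1 - e) * x\<bar> \<le> \<bar>a - x\<bar> + \<bar>1 - e\<bar> * \<bar>x\<bar>"
    using abs_triangle_ineq[of "a - x" "(1 - e) * x"] by (simp add: abs_mult)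
  also have "\<bar>1 - e\<bar> * \<bar>x\<bar> \<le> d * \<bar>x\<bar>" using e by (intro mult_right_mono) auto
  finally show ?thesis by simp
qed

text \<open>
  The error constant for the normalised weighted mean displacement.
\<close>

definition filter_const :: "nat \<Rightarrow> real \<Rightarrow> real" where
  "filter_const n C = 2 * (mean_const n C + dev_const n C * (snorm * (real (Suc n) * C)))"

lemma weighted_mean:
  fixes W :: "(nat \<Rightarrow> real ^ 'p) \<Rightarrow> real"
  assumes s: "0 \<le> \<sigma>" "\<sigma> \<le> \<tau>" "\<tau> \<le> 1" and C: "0 \<le> C"
    and Wm: "W \<in> borel_measurable (Q n)"
    and W: "AE z in Q n. \<bar>W z - 1 - (\<Sum>i\<le>n. disp \<sigma> \<tau> i z \<bullet> g i)\<bar> \<le> C * (rho n * \<tau>)\<^sup>2"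
    and g: "\<And>i. i \<le> n \<Longrightarrow> norm (g i) \<le> C"
    and small: "dev_const n C * \<tau> \<le> 1 / 2"
  shows "\<bar>(\<integral>z. W z * (u \<bullet> disp \<sigma> \<tau> n z) \<partial>Q n) / (\<integral>z. W z \<partial>Q n) - \<tau>\<^sup>2 * (u \<bullet> (Sig *v (\<Sum>i\<le>n. g i)))\<bar>
    \<le> norm u * (filter_const n C * (\<tau> ^ 3 + \<sigma>\<^sup>2))"
proof -
  let ?G = "\<Sum>i\<le>n. g i"
  note dev = weight_deviation[OF s C W g]
  have d0: "0 \<le> dev_const n C * \<tau>" using dev_const_nonneg[OF C] s by simp
  have "norm ?G \<le> of_nat (card {..n}) * C" by (rule sum_norm_bound) (use g in auto)
  then have "\<bar>u \<bullet> (Sig *v ?G)\<bar> \<le> norm u * (snorm * (real (Suc n) * C))"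
    using snorm_nonneg by (intro order_trans[OF snorm_bound] mult_left_mono) auto
  then have x: "\<bar>\<tau>\<^sup>2 * (u \<bullet> (Sig *v ?G))\<bar> \<le> \<tau>\<^sup>2 * (norm u * (snorm * (real (Suc n) * C)))"
    unfolding abs_mult abs_power2 by (intro mult_left_mono) auto
  have "\<bar>(\<integral>z. W z * (u \<bullet> disp \<sigma> \<tau> n z) \<partial>Q n) / (\<integral>z. W z \<partial>Q n) - \<tau>\<^sup>2 * (u \<bullet> (Sig *v ?G))\<bar>
      \<le> 2 * (\<bar>(\<integral>z. W z * (u \<bullet> disp \<sigma> \<tau> n z) \<partial>Q n) - \<tau>\<^sup>2 * (u \<bullet> (Sig *v ?G))\<bar>
          + dev_const n C * \<tau> * \<bar>\<tau>\<^sup>2 * (u \<bullet> (Sig *v ?G))\<bar>)"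
    by (rule abs_quotient_le[OF integral_weight(2)[OF Wm dev d0] small])
  also have "\<dots> \<le> 2 * (norm u * mean_const n C * (\<tau> ^ 3 + \<sigma>\<^sup>2)
        + dev_const n C * \<tau> * (\<tau>\<^sup>2 * (norm u * (snorm * (real (Suc n) * C)))))"
    by (intro mult_left_mono add_mono weighted_displacement[OF s(1,2) C Wm W g] x d0) auto
  also have "\<dots> = norm u * (2 * mean_const n C * (\<tau> ^ 3 + \<sigma>\<^sup>2)
        + 2 * (dev_const n C * (snorm * (real (Suc n) * C))) * \<tau> ^ 3)"
    by (simp add: algebra_simps power2_eq_square power3_eq_cube)
  also have "\<dots> \<le> norm u * (2 * mean_const n C * (\<tau> ^ 3 + \<sigma>\<^sup>2)
        + 2 * (dev_const n C * (snorm * (real (Suc n) * C))) * (\<tau> ^ 3 + \<sigma>\<^sup>2))"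
    using dev_const_nonneg[OF C] C snorm_nonneg
    by (intro mult_left_mono add_left_mono) auto
  finally show ?thesis by (simp add: filter_const_def algebra_simps)
qed

text \<open>
  The error constant for the weighted covariance of the displacement at time \<open>n\<close>, for weights that
  are within \<open>c * \<tau>\<close> of \<open>1\<close>.
\<close>

definition cov_const :: "nat \<Rightarrow> real \<Rightarrow> real" where
  "cov_const n c = 2 * (real n * snorm + c * (rho n)\<^sup>2 + c * snorm) + 4 * c\<^sup>2 * (rho n)\<^sup>2"

lemma cov_const_nonneg: "0 \<le> c \<Longrightarrow> 0 \<le> cov_const n c"
  using rho_pos[of n] snorm_nonneg by (simp add: cov_const_def)

text \<open>
  For second moments it is enough that the weights are within \<open>O(\<tau>)\<close> of \<open>1\<close>: the mean displacement
  is then \<open>O(\<tau>\<^sup>2)\<close>, so centring changes the second moments by \<open>O(\<tau>\<^sup>4)\<close> only.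
\<close>

lemma weighted_covariance:
  fixes W :: "(nat \<Rightarrow> real ^ 'p) \<Rightarrow> real"
  assumes s: "0 \<le> \<sigma>" "\<sigma> \<le> \<tau>" "\<tau> \<le> 1" and c: "0 \<le> c"
    and Wm [measurable]: "W \<in> borel_measurable (Q n)"
    and W: "AE z in Q n. \<bar>W z - 1\<bar> \<le> c * \<tau>"
    and small: "c * \<tau> \<le> 1 / 2"
  defines "E \<equiv> \<lambda>f. (\<integral>z. W z * f z \<partial>Q n) / (\<integral>z. W z \<partial>Q n)"
  shows "\<bar>E (\<lambda>z. disp \<sigma> \<tau> n z $ p * disp \<sigma> \<tau> n z $ q)
      - E (\<lambda>z. disp \<sigma> \<tau> n z $ p) * E (\<lambda>z. disp \<sigma> \<tau> n z $ q) - \<tau>\<^sup>2 * Sig $ p $ q\<bar>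
    \<le> cov_const n c * (\<tau> ^ 3 + \<sigma>\<^sup>2)"
proof -
  let ?X = "\<lambda>p z. disp \<sigma> \<tau> n z $ p"
  let ?r = "rho n * \<tau>"
  have r: "0 \<le> ?r" using rho_pos[of n] s by simp
  have [measurable]: "disp \<sigma> \<tau> n \<in> borel_measurable (Q n)" by simp
  have Xm [measurable]: "?X p \<in> borel_measurable (Q n)" for p
  proof -
    have "(\<lambda>z. axis p 1 \<bullet> disp \<sigma> \<tau> n z) \<in> borel_measurable (Q n)" by measurable
    then show ?thesis by (simp add: inner_axis')
  qed
  have X: "AE z in Q n. \<forall>p. \<bar>?X p z\<bar> \<le> ?r"
    using AE_disp[OF s(1,2), of n] by eventually_elim (meson component_le_norm_cart order_refl order_trans)
  have d0: "0 \<le> c * \<tau>" using c s by simp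
  note e = integral_weight(2)[OF Wm W d0]
  have split: "(\<integral>z. W z * f z \<partial>Q n) = (\<integral>z. f z \<partial>Q n) + (\<integral>z. (W z - 1) * f z \<partial>Q n)"
    "\<bar>\<integral>z. (W z - 1) * f z \<partial>Q n\<bar> \<le> c * \<tau> * b"
    if fm [measurable]: "f \<in> borel_measurable (Q n)" and f: "AE z in Q n. \<bar>f z\<bar> \<le> b" and b: "0 \<le> b" for f b
  proof -
    have Wf: "AE z in Q n. \<bar>(W z - 1) * f z\<bar> \<le> c * \<tau> * b"
      using W f
    proof eventually_elim
      case (elim z)
      show ?case unfolding abs_mult using elim d0 by (intro mult_mono) auto
    qed
    then show "\<bar>\<integral>z. (W z - 1) * f z \<partial>Q n\<bar> \<le> c * \<tau> * b"
      by (rule integral_Q_abs_le) (use d0 b in auto)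
    have 1: "integrable (Q n) (\<lambda>z. (W z - 1) * f z)"
      by (rule integrable_Q_bounded[OF Wf[folded real_norm_def]]) measurable
    have 2: "integrable (Q n) f"
      by (rule integrable_Q_bounded[OF f[folded real_norm_def]]) measurable
    have "(\<integral>z. W z * f z \<partial>Q n) = (\<integral>z. f z + (W z - 1) * f z \<partial>Q n)"
      by (simp add: algebra_simps)
    then show "(\<integral>z. W z * f z \<partial>Q n) = (\<integral>z. f z \<partial>Q n) + (\<integral>z. (W z - 1) * f z \<partial>Q n)"
      using 1 2 by simp
  qed
  have mean: "\<bar>E (?X p)\<bar> \<le> 2 * c * rho n * \<tau>\<^sup>2" for p
  proof -
    have Xp: "AE z in Q n. \<bar>?X p z\<bar> \<le> ?r" using X by eventually_elim simp
    have "(\<integral>z. ?X p z \<partial>Q n) = 0"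
      using integral_disp_linear[of n n "axis p 1" \<sigma> \<tau>] by (simp add: inner_axis')
    with split[OF Xm Xp r] have "\<bar>\<integral>z. W z * ?X p z \<partial>Q n\<bar> \<le> c * \<tau> * ?r" by simp
    with abs_quotient_le[OF e small, of "\<integral>z. W z * ?X p z \<partial>Q n" 0]
    show ?thesis by (simp add: E_def power2_eq_square algebra_simps)
  qed
  have Spq: "\<bar>Sig $ p $ q\<bar> \<le> snorm"
    unfolding snorm_def by (rule matrix_component_le_onorm)
  have XX: "AE z in Q n. \<bar>?X p z * ?X q z\<bar> \<le> ?r * ?r"
    using X
  proof eventually_elim
    case (elim z)
    show ?case unfolding abs_mult using elim r by (intro mult_mono) auto
  qed
  have "(\<integral>z. ?X p z * ?X q z \<partial>Q n) = (\<tau>\<^sup>2 + real n * \<sigma>\<^sup>2) * Sig $ p $ q"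
    using integral_disp_bilinear[of n n "axis p 1" \<sigma> \<tau> "axis q 1"]
    by (simp add: inner_axis' matrix_vector_mult_basis column_def)
  moreover note split[OF borel_measurable_times[OF Xm Xm] XX mult_nonneg_nonneg[OF r r]]
  ultimately have "(\<integral>z. W z * (?X p z * ?X q z) \<partial>Q n) - \<tau>\<^sup>2 * Sig $ p $ q
      = real n * \<sigma>\<^sup>2 * Sig $ p $ q + (\<integral>z. (W z - 1) * (?X p z * ?X q z) \<partial>Q n)"
    and "\<bar>\<integral>z. (W z - 1) * (?X p z * ?X q z) \<partial>Q n\<bar> \<le> c * \<tau> * (?r * ?r)"
    by (simp_all only: distrib_right)
  moreover have "\<bar>real n * \<sigma>\<^sup>2 * Sig $ p $ q\<bar> = real n * \<sigma>\<^sup>2 * \<bar>Sig $ p $ q\<bar>" by (simp add: abs_mult)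
  ultimately have "\<bar>(\<integral>z. W z * (?X p z * ?X q z) \<partial>Q n) - \<tau>\<^sup>2 * Sig $ p $ q\<bar>
      \<le> real n * \<sigma>\<^sup>2 * \<bar>Sig $ p $ q\<bar> + c * \<tau> * (?r * ?r)"
    by linarith
  also have "real n * \<sigma>\<^sup>2 * \<bar>Sig $ p $ q\<bar> \<le> real n * \<sigma>\<^sup>2 * snorm"
    using Spq by (intro mult_left_mono) auto
  finally have a: "\<bar>(\<integral>z. W z * (?X p z * ?X q z) \<partial>Q n) - \<tau>\<^sup>2 * Sig $ p $ q\<bar>
      \<le> real n * snorm * \<sigma>\<^sup>2 + c * (rho n)\<^sup>2 * \<tau> ^ 3"
    by (simp add: power2_eq_square power3_eq_cube mult_ac)
  have x: "c * \<tau> * \<bar>\<tau>\<^sup>2 * Sig $ p $ q\<bar> \<le> c * snorm * \<tau> ^ 3"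
  proof -
    have "c * \<tau> * \<bar>\<tau>\<^sup>2 * Sig $ p $ q\<bar> = c * \<tau> ^ 3 * \<bar>Sig $ p $ q\<bar>"
      using s by (simp add: abs_mult power2_eq_square power3_eq_cube)
    also have "\<dots> \<le> c * \<tau> ^ 3 * snorm" using Spq c s by (intro mult_left_mono) auto
    finally show ?thesis by (simp add: mult_ac)
  qed
  have second: "\<bar>E (\<lambda>z. ?X p z * ?X q z) - \<tau>\<^sup>2 * Sig $ p $ q\<bar>
      \<le> 2 * (real n * snorm * \<sigma>\<^sup>2 + c * (rho n)\<^sup>2 * \<tau> ^ 3 + c * snorm * \<tau> ^ 3)"
    unfolding E_def by (rule order_trans[OF abs_quotient_le[OF e small] mult_left_mono[OF add_mono[OF a x]]]) simp
  have "\<bar>E (?X p) * E (?X q)\<bar> \<le> (2 * c * rho n * \<tau>\<^sup>2) * (2 * c * rho n * \<tau>\<^sup>2)"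
    unfolding abs_mult using mean c rho_pos[of n] by (intro mult_mono) auto
  also have "\<dots> = 4 * c\<^sup>2 * (rho n)\<^sup>2 * (\<tau> ^ 3 * \<tau>)" by (simp add: power2_eq_square power3_eq_cube)
  also have "\<dots> \<le> 4 * c\<^sup>2 * (rho n)\<^sup>2 * (\<tau> ^ 3 * 1)" using s by (intro mult_left_mono) auto
  finally have third: "\<bar>E (?X p) * E (?X q)\<bar> \<le> 4 * c\<^sup>2 * (rho n)\<^sup>2 * \<tau> ^ 3" by simp
  define A where "A = real n * snorm"
  define A' where "A' = c * (rho n)\<^sup>2 + c * snorm"
  define A'' where "A'' = 4 * c\<^sup>2 * (rho n)\<^sup>2"
  have nn: "0 \<le> A" "0 \<le> A'" "0 \<le> A''" using c snorm_nonneg by (auto simp: A_def A'_def A''_def)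
  have "\<bar>E (\<lambda>z. ?X p z * ?X q z) - E (?X p) * E (?X q) - \<tau>\<^sup>2 * Sig $ p $ q\<bar>
      \<le> 2 * (A * \<sigma>\<^sup>2 + A' * \<tau> ^ 3) + A'' * \<tau> ^ 3"
    using second third by (simp add: A_def A'_def A''_def distrib_right)
  also have "\<dots> \<le> 2 * (A * (\<tau> ^ 3 + \<sigma>\<^sup>2) + A' * (\<tau> ^ 3 + \<sigma>\<^sup>2)) + A'' * (\<tau> ^ 3 + \<sigma>\<^sup>2)"
    using s nn by (intro add_mono mult_left_mono) auto
  also have "\<dots> = cov_const n c * (\<tau> ^ 3 + \<sigma>\<^sup>2)"
    by (simp add: A_def A'_def A''_def cov_const_def algebra_simps)
  finally show ?thesis .
qed

end

section \<open>Likelihoods and conditional observation densities\<close>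

lemma joint_density_cong:
  assumes "\<And>k. k \<le> n \<Longrightarrow> x k = x' k" "\<And>k. k \<in> {1..n} \<Longrightarrow> y k = y' k"
    "\<And>k. k \<le> n \<Longrightarrow> t k = t' k"
  shows "joint_density P n x y t = joint_density P n x' y' t'"
proof -
  have "(\<Prod>k\<in>{1..n}. trans P k (x k) (x (k - 1)) (t k) * obs P k (y k) (x k) (t k))
      = (\<Prod>k\<in>{1..n}. trans P k (x' k) (x' (k - 1)) (t' k) * obs P k (y' k) (x' k) (t' k))"
  proof (rule prod.cong)
    fix k assume "k \<in> {1..n}"
    then have "k \<le> n" "k - 1 \<le> n" "k \<in> {1..n}" by auto
    then show "trans P k (x k) (x (k - 1)) (t k) * obs P k (y k) (x k) (t k)
        = trans P k (x' k) (x' (k - 1)) (t' k) * obs P k (y' k) (x' k) (t' k)"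
      using assms by metis
  qed simp
  then show ?thesis by (simp add: joint_density_def assms)
qed

lemma joint_density_Suc:
  "joint_density P (Suc m) x y t = joint_density P m x y t *
     (trans P (Suc m) (x (Suc m)) (x m) (t (Suc m)) * obs P (Suc m) (y (Suc m)) (x (Suc m)) (t (Suc m)))"
  by (simp add: joint_density_def mult.assoc)

lemma depends_upto_likelihood:
  fixes P :: "('p, 'x, 'y) pomp"
  shows "depends_upto n (likelihood P ys n)"
  unfolding depends_upto_def likelihood_def
proof (intro allI impI nn_integral_cong)
  fix t t' :: "nat \<Rightarrow> 'p" and x :: "nat \<Rightarrow> 'x" assume "\<forall>i\<le>n. t i = t' i"
  then have "joint_density P n x ys t = joint_density P n x ys t'" by (intro joint_density_cong) auto
  then show "ennreal (joint_density P n x ys t) = ennreal (joint_density P n x ys t')" by simp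
qed

lemma depends_upto_loglik_tv: "depends_upto n (loglik_tv P ys n)"
  using depends_upto_likelihood[of n P ys] unfolding depends_upto_def loglik_tv_def by metis

text \<open>A partially observed Markov model together with the data.\<close>

locale pomp_data =
  fixes N :: nat and MX :: "'x measure" and MY :: "'y measure"
    and P :: "('p::topological_space, 'x, 'y) pomp" and ys :: "nat \<Rightarrow> 'y"
  assumes model: "pomp_model N MX MY P"
    and data: "\<And>k. k \<in> {1..N} \<Longrightarrow> ys k \<in> space MY"
begin

lemma sets_state: "k \<le> N \<Longrightarrow> sets (state_meas P k) = sets MX"
  and sets_obs: "k \<in> {1..N} \<Longrightarrow> sets (obs_meas P k) = sets MY"
  and init_nonneg: "x \<in> space MX \<Longrightarrow> 0 \<le> init P x \<theta>"
  and trans_nonneg: "k \<in> {1..N} \<Longrightarrow> x \<in> space MX \<Longrightarrow> x' \<in> space MX \<Longrightarrow> 0 \<le> trans P k x' x \<theta>"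
  and obs_nonneg: "k \<in> {1..N} \<Longrightarrow> x \<in> space MX \<Longrightarrow> y \<in> space MY \<Longrightarrow> 0 \<le> obs P k y x \<theta>"
  and integral_init: "(\<integral>\<^sup>+x. ennreal (init P x \<theta>) \<partial>state_meas P 0) = 1"
  and integral_trans: "k \<in> {1..N} \<Longrightarrow> x \<in> space MX \<Longrightarrow>
      (\<integral>\<^sup>+x'. ennreal (trans P k x' x \<theta>) \<partial>state_meas P k) = 1"
  and integral_obs: "k \<in> {1..N} \<Longrightarrow> x \<in> space MX \<Longrightarrow>
      (\<integral>\<^sup>+y. ennreal (obs P k y x \<theta>) \<partial>obs_meas P k) = 1"
  using model by (simp_all add: pomp_model_def)

lemma space_state: "k \<le> N \<Longrightarrow> space (state_meas P k) = space MX"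
  by (rule sets_eq_imp_space_eq) (rule sets_state)

text \<open>
  The reference measures are known to be \<open>\<sigma>\<close>-finite only at the times of the model, so the products
  are taken over families that agree with them there and consist of empty measures elsewhere.
\<close>

definition S :: "nat \<Rightarrow> 'x measure" where
  "S k = (if k \<le> N then state_meas P k else count_space {})"

definition Ob :: "nat \<Rightarrow> 'y measure" where
  "Ob k = (if k \<in> {1..N} then obs_meas P k else count_space {})"

lemma sigma_finite_S: "sigma_finite_measure (S k)"
  using model by (cases "k \<le> N") (simp_all add: S_def pomp_model_def sigma_finite_measure_count_space_finite)

lemma sigma_finite_Ob: "sigma_finite_measure (Ob k)"
  using model by (cases "k \<in> {1..N}") (simp_all add: Ob_def pomp_model_def sigma_finite_measure_count_space_finite)

sublocale S: product_sigma_finite S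
  unfolding product_sigma_finite_def using sigma_finite_S by blast

sublocale Ob: product_sigma_finite Ob
  unfolding product_sigma_finite_def using sigma_finite_Ob by blast

lemma PiM_state: "n \<le> N \<Longrightarrow> PiM {..n} (state_meas P) = PiM {..n} S"
  by (intro PiM_cong) (auto simp: S_def)

lemma PiM_obs: "I \<subseteq> {1..N} \<Longrightarrow> PiM I (obs_meas P) = PiM I Ob"
  by (intro PiM_cong) (auto simp: Ob_def)

lemma sets_S: "k \<le> N \<Longrightarrow> sets (S k) = sets MX" by (simp add: S_def sets_state)

lemma sets_Ob: "k \<in> {1..N} \<Longrightarrow> sets (Ob k) = sets MY" by (simp add: Ob_def sets_obs)

lemma space_S: "k \<le> N \<Longrightarrow> space (S k) = space MX" by (simp add: S_def space_state)

lemma measurable_init: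
  assumes [measurable]: "X \<in> measurable M MX" "T \<in> borel_measurable M"
  shows "(\<lambda>w. init P (X w) (T w)) \<in> borel_measurable M"
proof -
  have "(\<lambda>(x, \<theta>). init P x \<theta>) \<in> borel_measurable (MX \<Otimes>\<^sub>M borel)"
    using model by (simp add: pomp_model_def)
  from measurable_compose[OF measurable_Pair[OF assms] this] show ?thesis by simp
qed

lemma measurable_trans:
  assumes k: "k \<in> {1..N}" and m: "X' \<in> measurable M MX" "X \<in> measurable M MX" "T \<in> borel_measurable M"
  shows "(\<lambda>w. trans P k (X' w) (X w) (T w)) \<in> borel_measurable M"
proof -
  have "(\<lambda>(x', x, \<theta>). trans P k x' x \<theta>) \<in> borel_measurable (MX \<Otimes>\<^sub>M MX \<Otimes>\<^sub>M borel)"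
    using model k by (simp add: pomp_model_def)
  from measurable_compose[OF measurable_Pair[OF m(1) measurable_Pair[OF m(2,3)]] this]
  show ?thesis by simp
qed

lemma measurable_obs:
  assumes k: "k \<in> {1..N}" and m: "Y \<in> measurable M MY" "X \<in> measurable M MX" "T \<in> borel_measurable M"
  shows "(\<lambda>w. obs P k (Y w) (X w) (T w)) \<in> borel_measurable M"
proof -
  have "(\<lambda>(y, x, \<theta>). obs P k y x \<theta>) \<in> borel_measurable (MY \<Otimes>\<^sub>M MX \<Otimes>\<^sub>M borel)"
    using model k by (simp add: pomp_model_def)
  from measurable_compose[OF measurable_Pair[OF m(1) measurable_Pair[OF m(2,3)]] this]
  show ?thesis by simp
qed

lemma measurable_joint_density:
  assumes n: "n \<le> N"
    and X: "\<And>k. k \<le> n \<Longrightarrow> (\<lambda>w. X w k) \<in> measurable M MX"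
    and Y: "\<And>k. k \<in> {1..n} \<Longrightarrow> (\<lambda>w. Y w k) \<in> measurable M MY"
    and T: "\<And>k. k \<le> n \<Longrightarrow> (\<lambda>w. T w k) \<in> borel_measurable M"
  shows "(\<lambda>w. joint_density P n (X w) (Y w) (T w)) \<in> borel_measurable M"
  unfolding joint_density_def
  by (intro borel_measurable_times borel_measurable_prod measurable_init measurable_trans
      measurable_obs X Y T) (use n in auto)

lemma joint_density_nonneg:
  assumes n: "n \<le> N" and x: "\<And>k. k \<le> n \<Longrightarrow> x k \<in> space MX"
    and y: "\<And>k. k \<in> {1..n} \<Longrightarrow> y k \<in> space MY"
  shows "0 \<le> joint_density P n x y t"
  unfolding joint_density_def
  by (intro mult_nonneg_nonneg prod_nonneg ballI init_nonneg trans_nonneg obs_nonneg x y)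
    (use n in auto)

lemma measurable_state_component:
  "k \<le> n \<Longrightarrow> n \<le> N \<Longrightarrow> (\<lambda>x. x k) \<in> measurable (PiM {..n} S) MX"
  using measurable_component_singleton[of k "{..n}" S]
  by (simp add: measurable_cong_sets[OF refl sets_S])

lemma measurable_likelihood:
  assumes n: "n \<le> N" "n \<le> m"
  shows "likelihood P ys n \<in> borel_measurable (PiM {..m} (\<lambda>_. borel))"
proof -
  interpret sigma_finite_measure "PiM {..n} S" by (rule S.sigma_finite) simp
  let ?M = "PiM {..m} (\<lambda>_. borel :: 'p measure) \<Otimes>\<^sub>M PiM {..n} S"
  have "(\<lambda>w. joint_density P n (snd w) ys (fst w)) \<in> borel_measurable ?M"
  proof (rule measurable_joint_density[OF n(1)])
    show "(\<lambda>w. snd w k) \<in> measurable ?M MX" if "k \<le> n" for k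
      using measurable_compose[OF measurable_snd measurable_state_component[OF that n(1)]] .
    show "(\<lambda>w. ys k) \<in> measurable ?M MY" if "k \<in> {1..n}" for k
      using data that n by (intro measurable_const) auto
    show "(\<lambda>w. fst w k) \<in> borel_measurable ?M" if "k \<le> n" for k
      by (rule measurable_compose[OF measurable_fst measurable_component_singleton]) (use that n in auto)
  qed
  then have "(\<lambda>(t, x). ennreal (joint_density P n x ys t)) \<in> borel_measurable ?M"
    by (simp add: case_prod_beta')
  then show ?thesis
    unfolding likelihood_def[abs_def] PiM_state[OF n(1)] by (rule borel_measurable_nn_integral)
qed

lemma likelihood_0: "likelihood P ys 0 t = 1"
proof -
  have m: "(\<lambda>x. ennreal (init P x (t 0))) \<in> borel_measurable (S 0)"
    using measurable_init[of "\<lambda>x. x" "S 0" "\<lambda>_. t 0"]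
    by (simp add: measurable_cong_sets[OF sets_S refl])
  have "likelihood P ys 0 t = (\<integral>\<^sup>+x. ennreal (init P (x 0) (t 0)) \<partial>PiM {0} S)"
    by (simp add: likelihood_def joint_density_def PiM_state flip: atMost_0)
  also have "\<dots> = (\<integral>\<^sup>+x. ennreal (init P x (t 0)) \<partial>S 0)"
    using m by (rule S.product_nn_integral_singleton)
  finally show ?thesis by (simp add: S_def integral_init)
qed

lemma obs_density_all:
  "obs_density P ys n n t = likelihood P ys n t"
proof -
  have "joint_density P n x (\<lambda>k. if k \<le> n then ys k else y k) t = joint_density P n x ys t" for x y
    by (rule joint_density_cong) auto
  then show ?thesis
    by (simp add: obs_density_def likelihood_def PiM_empty)
qed

text \<open>
  The last observation and then the last state integrate to \<open>1\<close>, so conditioning on the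
  observations before time \<open>Suc m\<close> involves the parameters only through the likelihood at time \<open>m\<close>.
\<close>

lemma obs_density_all_but_last:
  assumes m: "Suc m \<le> N"
  shows "obs_density P ys m (Suc m) t = likelihood P ys m t"
proof -
  let ?n = "Suc m"
  have n: "?n \<in> {1..N}" "?n \<le> N" "m \<le> N" using m by auto
  let ?tr = "\<lambda>x. trans P ?n (x ?n) (x m) (t ?n)" and ?J = "\<lambda>x. joint_density P m x ys t"
    and ?ob = "\<lambda>x y. obs P ?n y (x ?n) (t ?n)"
  interpret PX: sigma_finite_measure "PiM {..?n} S" by (rule S.sigma_finite) simp
  interpret PY: sigma_finite_measure "PiM {?n} Ob" by (rule Ob.sigma_finite) simp
  interpret pair_sigma_finite "PiM {..?n} S" "PiM {?n} Ob" ..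
  have inX: "x k \<in> space MX" if "x \<in> space (PiM {..l} S)" "k \<le> l" "l \<le> N" for x k l
    using that space_S[of k] by (auto simp: space_PiM PiE_iff)
  have J0: "0 \<le> ?J x" if "x \<in> space (PiM {..l} S)" "m \<le> l" "l \<le> N" for x l
    by (rule joint_density_nonneg) (use that inX data n in auto)
  have J: "joint_density P ?n x (\<lambda>k. if k \<le> m then ys k else y k) t = ?J x * (?tr x * ?ob x (y ?n))" for x y
  proof -
    have "joint_density P m x (\<lambda>k. if k \<le> m then ys k else y k) t = ?J x"
      by (rule joint_density_cong) auto
    then show ?thesis by (simp add: joint_density_Suc)
  qed
  have meas: "(\<lambda>x. ?J x) \<in> borel_measurable (PiM {..l} S)" if "m \<le> l" "l \<le> N" for l
    by (rule measurable_joint_density)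
      (use that n data measurable_state_component in \<open>auto intro!: measurable_const\<close>)
  have meast: "(\<lambda>x. ?tr x) \<in> borel_measurable (PiM {..?n} S)"
    by (rule measurable_trans) (use n measurable_state_component in auto)
  have "obs_density P ys m ?n t
      = (\<integral>\<^sup>+y. \<integral>\<^sup>+x. ennreal (?J x * (?tr x * ?ob x (y ?n))) \<partial>PiM {..?n} S \<partial>PiM {?n} Ob)"
  proof -
    have "{m<..?n} = {?n}" by auto
    then show ?thesis
      using n by (simp add: obs_density_def J PiM_state PiM_obs)
  qed
  also have "\<dots> = (\<integral>\<^sup>+x. \<integral>\<^sup>+y. ennreal (?J x * (?tr x * ?ob x (y ?n))) \<partial>PiM {?n} Ob \<partial>PiM {..?n} S)"
  proof (rule Fubini')
    let ?M = "PiM {..?n} S \<Otimes>\<^sub>M PiM {?n} Ob"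
    have x: "(\<lambda>w. fst w k) \<in> measurable ?M MX" if "k \<le> ?n" for k
      using measurable_compose[OF measurable_fst measurable_state_component[OF that n(2)]] .
    have y: "(\<lambda>w. snd w ?n) \<in> measurable ?M MY"
      using measurable_compose[OF measurable_snd measurable_component_singleton[of ?n "{?n}" Ob]]
      by (simp add: measurable_cong_sets[OF refl sets_Ob[OF n(1)]])
    have "(\<lambda>w. ?J (fst w) * (?tr (fst w) * ?ob (fst w) (snd w ?n))) \<in> borel_measurable ?M"
      by (intro borel_measurable_times measurable_compose[OF measurable_fst meas]
          measurable_compose[OF measurable_fst meast] measurable_obs x y n) (use n in auto)
    then show "(\<lambda>(x, y). ennreal (?J x * (?tr x * ?ob x (y ?n)))) \<in> borel_measurable ?M"
      by (simp add: case_prod_beta')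
  qed
  also have "\<dots> = (\<integral>\<^sup>+x. ennreal (?J x) * ennreal (?tr x) \<partial>PiM {..?n} S)"
  proof (rule nn_integral_cong)
    fix x assume x: "x \<in> space (PiM {..?n} S)"
    have x1: "x ?n \<in> space MX" "x m \<in> space MX" using inX[OF x] n by auto
    have mo: "(\<lambda>y. ennreal (?ob x y)) \<in> borel_measurable (Ob ?n)"
      using measurable_obs[OF n(1), of "\<lambda>y. y" "Ob ?n" "\<lambda>_. x ?n" "\<lambda>_. t ?n"] x1
      by (simp add: measurable_cong_sets[OF sets_Ob[OF n(1)] refl])
    have pos: "0 \<le> ?J x" "0 \<le> ?tr x"
      using J0[OF x] trans_nonneg[OF n(1)] x1 n by auto
    have "(\<integral>\<^sup>+y. ennreal (?J x * (?tr x * ?ob x (y ?n))) \<partial>PiM {?n} Ob)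
        = (\<integral>\<^sup>+y. ennreal (?J x * (?tr x * ?ob x y)) \<partial>Ob ?n)"
      by (rule Ob.product_nn_integral_singleton[where f = "\<lambda>y. ennreal (?J x * (?tr x * ?ob x y))"])
        (use measurable_obs[OF n(1), of "\<lambda>y. y" "Ob ?n" "\<lambda>_. x ?n" "\<lambda>_. t ?n"] x1 in
          \<open>simp add: measurable_cong_sets[OF sets_Ob[OF n(1)] refl]\<close>)
    also have "\<dots> = (\<integral>\<^sup>+y. (ennreal (?J x) * ennreal (?tr x)) * ennreal (?ob x y) \<partial>Ob ?n)"
      using pos by (simp add: ennreal_mult' mult.assoc)
    also have "\<dots> = (ennreal (?J x) * ennreal (?tr x)) * (\<integral>\<^sup>+y. ennreal (?ob x y) \<partial>Ob ?n)"
      using mo by (rule nn_integral_cmult)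
    also have "(\<integral>\<^sup>+y. ennreal (?ob x y) \<partial>Ob ?n) = 1"
      using integral_obs[OF n(1) x1(1)] n by (simp add: Ob_def)
    finally show "(\<integral>\<^sup>+y. ennreal (?J x * (?tr x * ?ob x (y ?n))) \<partial>PiM {?n} Ob)
        = ennreal (?J x) * ennreal (?tr x)" by simp
  qed
  also have "{..?n} = insert ?n {..m}" by auto
  also have "(\<integral>\<^sup>+x. ennreal (?J x) * ennreal (?tr x) \<partial>PiM (insert ?n {..m}) S)
      = (\<integral>\<^sup>+x. \<integral>\<^sup>+x'. ennreal (?J (x(?n := x'))) * ennreal (?tr (x(?n := x'))) \<partial>S ?n \<partial>PiM {..m} S)"
    by (rule S.product_nn_integral_insert)
      (use meas[of ?n] meast n in \<open>auto simp: atMost_Suc intro!: borel_measurable_times_ennreal\<close>)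
  also have "\<dots> = (\<integral>\<^sup>+x. ennreal (?J x) \<partial>PiM {..m} S)"
  proof (rule nn_integral_cong)
    fix x assume x: "x \<in> space (PiM {..m} S)"
    have xm: "x m \<in> space MX" using inX[OF x] n by auto
    have eq: "?J (x(?n := x')) = ?J x" for x' by (rule joint_density_cong) auto
    have "(\<lambda>x'. ennreal (trans P ?n x' (x m) (t ?n))) \<in> borel_measurable (S ?n)"
      using measurable_trans[OF n(1), of "\<lambda>x'. x'" "S ?n" "\<lambda>_. x m" "\<lambda>_. t ?n"] xm
      by (simp add: measurable_cong_sets[OF sets_S[OF n(2)] refl])
    then have "(\<integral>\<^sup>+x'. ennreal (?J x) * ennreal (trans P ?n x' (x m) (t ?n)) \<partial>S ?n)
        = ennreal (?J x) * (\<integral>\<^sup>+x'. ennreal (trans P ?n x' (x m) (t ?n)) \<partial>S ?n)"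
      by (rule nn_integral_cmult)
    also have "(\<integral>\<^sup>+x'. ennreal (trans P ?n x' (x m) (t ?n)) \<partial>S ?n) = 1"
      using integral_trans[OF n(1) xm] n by (simp add: S_def)
    finally show "(\<integral>\<^sup>+x'. ennreal (?J (x(?n := x'))) * ennreal (?tr (x(?n := x'))) \<partial>S ?n) = ennreal (?J x)"
      by (simp add: eq)
  qed
  finally show ?thesis using n by (simp add: likelihood_def PiM_state)
qed

end

section \<open>The conditional laws of the perturbed parameters\<close>

text \<open>
  The perturbed model. Since \<open>lk 0 = 1\<close>, conditioning on no observations is the case \<open>m = 0\<close> of
  conditioning on the first \<open>m\<close> observations.
\<close>

locale perturbed_pomp = perturbation_kernel \<kappa> + pomp_data N MX MY P ys
  for \<kappa> :: "real ^ 'p::finite \<Rightarrow> real" and N :: nat and MX :: "'x measure" and MY :: "'y measure"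
    and P :: "(real ^ 'p, 'x, 'y) pomp" and ys :: "nat \<Rightarrow> 'y" +
  assumes lik: "\<And>n \<theta>. n \<in> {1..N} \<Longrightarrow> 0 < likelihood P ys n \<theta> \<and> likelihood P ys n \<theta> < \<infinity>"
begin

text \<open>The likelihood of the first \<open>m\<close> observations as a real number.\<close>

definition lk :: "nat \<Rightarrow> (nat \<Rightarrow> real ^ 'p) \<Rightarrow> real" where
  "lk m t = enn2real (likelihood P ys m t)"

lemma lk_pos: "m \<le> N \<Longrightarrow> 0 < lk m t"
  using lik[of m t] by (cases "m = 0") (auto simp: lk_def likelihood_0 enn2real_positive_iff)

lemma likelihood_lk: "m \<le> N \<Longrightarrow> likelihood P ys m t = ennreal (lk m t)"
  using lik[of m t] by (cases "m = 0") (auto simp: lk_def likelihood_0)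

lemma lk_exp: "m \<le> N \<Longrightarrow> lk m t = exp (loglik_tv P ys m t)"
  using lk_pos[of m t] by (simp add: loglik_tv_def lk_def)

text \<open>
  The parameters at times \<open>0, \<dots>, n\<close> perturbed around the constant value \<open>\<theta>\<close>, as a function of the
  draws; \<open>undefined\<close> beyond \<open>n\<close>.
\<close>

definition pert :: "nat \<Rightarrow> real ^ 'p \<Rightarrow> real \<Rightarrow> real \<Rightarrow> (nat \<Rightarrow> real ^ 'p) \<Rightarrow> nat \<Rightarrow> real ^ 'p" where
  "pert n \<theta> \<sigma> \<tau> z = (\<lambda>k\<in>{..n}. \<theta> + disp \<sigma> \<tau> k z)"

lemma perturbed_law_eq_distr:
  "perturbed_law \<kappa> n (\<lambda>_. \<theta>) \<sigma> \<tau> = distr (Q n) (PiM {..n} (\<lambda>_. borel)) (pert n \<theta> \<sigma> \<tau>)"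
  by (simp add: perturbed_law_def Q_def D_def pert_def[abs_def] disp_def add.assoc)

lemma measurable_pert [measurable]: "pert n \<theta> \<sigma> \<tau> \<in> measurable (Q n) (PiM {..n} (\<lambda>_. borel))"
  unfolding pert_def[abs_def] by (rule measurable_restrict) simp

text \<open>The likelihood at the perturbed parameters relative to the likelihood at \<open>\<theta>\<close>.\<close>

definition wt :: "nat \<Rightarrow> nat \<Rightarrow> real ^ 'p \<Rightarrow> real \<Rightarrow> real \<Rightarrow> (nat \<Rightarrow> real ^ 'p) \<Rightarrow> real" where
  "wt m n \<theta> \<sigma> \<tau> z = lk m (pert n \<theta> \<sigma> \<tau> z) / lk m (\<lambda>_. \<theta>)"

lemma measurable_lk: "m \<le> N \<Longrightarrow> m \<le> n \<Longrightarrow> lk m \<in> borel_measurable (PiM {..n} (\<lambda>_. borel))"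
  unfolding lk_def[abs_def] by (intro measurable_compose[OF measurable_likelihood]) auto

lemma measurable_wt: "m \<le> N \<Longrightarrow> m \<le> n \<Longrightarrow> wt m n \<theta> \<sigma> \<tau> \<in> borel_measurable (Q n)"
  unfolding wt_def[abs_def]
  by (intro borel_measurable_divide measurable_compose[OF measurable_pert measurable_lk]) auto

lemma wt_nonneg: "m \<le> N \<Longrightarrow> 0 \<le> wt m n \<theta> \<sigma> \<tau> z"
  using lk_pos[of m] by (simp add: wt_def less_imp_le)

text \<open>
  Integrals under a conditional law are normalised weighted integrals over the draws. Here \<open>n\<close> is
  the last time of the parameters and \<open>m\<close> the number of observations in the likelihood; the law of
  the parameters at times up to \<open>n\<close> given the first \<open>n\<close> or the first \<open>n - 1\<close> observations
  corresponds to \<open>m = n\<close> and \<open>m = n - 1\<close>.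
\<close>

lemma cond_law_integral:
  fixes g :: "(nat \<Rightarrow> real ^ 'p) \<Rightarrow> 'b::{banach, second_countable_topology}"
  assumes m: "m \<le> n" "m \<le> N"
    and obs: "\<And>t. obs_density P ys k n t = likelihood P ys m t"
    and i: "integrable (Q n) (wt m n \<theta> \<sigma> \<tau>)"
    and e: "0 < (\<integral>z. wt m n \<theta> \<sigma> \<tau> z \<partial>Q n)"
    and g: "g \<in> borel_measurable (PiM {..n} (\<lambda>_. borel))"
  shows "(\<integral>t. g t \<partial>cond_law \<kappa> P ys k n (\<lambda>_. \<theta>) \<sigma> \<tau>)
    = (\<integral>z. (wt m n \<theta> \<sigma> \<tau> z / (\<integral>z. wt m n \<theta> \<sigma> \<tau> z \<partial>Q n)) *\<^sub>R g (pert n \<theta> \<sigma> \<tau> z) \<partial>Q n)"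
proof -
  let ?e = "\<integral>z. wt m n \<theta> \<sigma> \<tau> z \<partial>Q n" and ?l = "lk m (\<lambda>_. \<theta>)"
  let ?L = "distr (Q n) (PiM {..n} (\<lambda>_. borel)) (pert n \<theta> \<sigma> \<tau>)"
  have l: "0 < ?l" using m by (intro lk_pos)
  note lkm = measurable_lk[OF m(2,1)]
  have "(\<integral>\<^sup>+t. ennreal (lk m t) \<partial>?L) = (\<integral>\<^sup>+z. ennreal (lk m (pert n \<theta> \<sigma> \<tau> z)) \<partial>Q n)"
    using lkm by (intro nn_integral_distr measurable_pert) simp
  also have "\<dots> = (\<integral>\<^sup>+z. ennreal (?l * wt m n \<theta> \<sigma> \<tau> z) \<partial>Q n)"
    using l by (simp add: wt_def)
  also have "\<dots> = ennreal (\<integral>z. ?l * wt m n \<theta> \<sigma> \<tau> z \<partial>Q n)"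
    using i l wt_nonneg[OF m(2)] by (intro nn_integral_eq_integral) auto
  finally have nn: "(\<integral>\<^sup>+t. ennreal (lk m t) \<partial>?L) = ennreal (?l * ?e)" by simp
  have "cond_law \<kappa> P ys k n (\<lambda>_. \<theta>) \<sigma> \<tau> = density ?L (\<lambda>t. ennreal (lk m t / (?l * ?e)))"
    using lk_pos[OF m(2)] l e
    by (simp add: cond_law_def perturbed_law_eq_distr obs likelihood_lk[OF m(2)] nn divide_ennreal less_imp_le)
  then have "(\<integral>t. g t \<partial>cond_law \<kappa> P ys k n (\<lambda>_. \<theta>) \<sigma> \<tau>) = (\<integral>t. (lk m t / (?l * ?e)) *\<^sub>R g t \<partial>?L)"
    using lkm g lk_pos[OF m(2)] l e
    by (simp add: integral_density less_imp_le)
  also have "\<dots> = (\<integral>z. (lk m (pert n \<theta> \<sigma> \<tau> z) / (?l * ?e)) *\<^sub>R g (pert n \<theta> \<sigma> \<tau> z) \<partial>Q n)"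
    using lkm g by (intro integral_distr measurable_pert) simp
  finally show ?thesis by (simp add: wt_def)
qed

lemma cond_law_mean:
  assumes m: "m \<le> n" "m \<le> N"
    and obs: "\<And>t. obs_density P ys k n t = likelihood P ys m t"
    and W: "AE z in Q n. \<bar>wt m n \<theta> \<sigma> \<tau> z - 1\<bar> \<le> d" "0 \<le> d" "d \<le> 1 / 2"
    and s: "0 \<le> \<sigma>" "\<sigma> \<le> \<tau>"
  shows "u \<bullet> ((\<integral>t. t n \<partial>cond_law \<kappa> P ys k n (\<lambda>_. \<theta>) \<sigma> \<tau>) - \<theta>)
    = (\<integral>z. wt m n \<theta> \<sigma> \<tau> z * (u \<bullet> disp \<sigma> \<tau> n z) \<partial>Q n) / (\<integral>z. wt m n \<theta> \<sigma> \<tau> z \<partial>Q n)"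
proof -
  let ?w = "wt m n \<theta> \<sigma> \<tau>" and ?X = "disp \<sigma> \<tau> n"
  define e where "e = (\<integral>z. ?w z \<partial>Q n)"
  note wm [measurable] = measurable_wt[OF m(2,1), of \<theta> \<sigma> \<tau>]
  have [measurable]: "?X \<in> borel_measurable (Q n)" by simp
  note i = integral_weight(1)[OF wm W(1,2)]
  have e: "0 < e" using integral_weight(2)[OF wm W(1,2)] W(3) by (simp add: e_def)
  have iX: "integrable (Q n) (\<lambda>z. ?w z *\<^sub>R ?X z)"
  proof (rule integrable_Q_bounded[where B = "(1 + d) * (rho n * \<tau>)"])
    show "AE z in Q n. norm (?w z *\<^sub>R ?X z) \<le> (1 + d) * (rho n * \<tau>)"
      using W(1) AE_disp[OF s, of n]
    proof eventually_elim
      case (elim z)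
      show ?case unfolding norm_scaleR
        using elim rho_pos[of n] s by (intro mult_mono) auto
    qed
  qed measurable
  have "(\<integral>t. t n \<partial>cond_law \<kappa> P ys k n (\<lambda>_. \<theta>) \<sigma> \<tau>) = (\<integral>z. (?w z / e) *\<^sub>R pert n \<theta> \<sigma> \<tau> z n \<partial>Q n)"
    unfolding e_def by (rule cond_law_integral[OF m obs i e[unfolded e_def]]) simp
  also have "\<dots> = (\<integral>z. (1 / e) *\<^sub>R (?w z *\<^sub>R \<theta> + ?w z *\<^sub>R ?X z) \<partial>Q n)"
    by (simp add: pert_def scaleR_add_right)
  also have "\<dots> = (1 / e) *\<^sub>R (e *\<^sub>R \<theta> + (\<integral>z. ?w z *\<^sub>R ?X z \<partial>Q n))"
    using i iX by (simp add: e_def)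
  also have "\<dots> = \<theta> + (1 / e) *\<^sub>R (\<integral>z. ?w z *\<^sub>R ?X z \<partial>Q n)"
    using e by (simp add: scaleR_add_right)
  finally have "u \<bullet> ((\<integral>t. t n \<partial>cond_law \<kappa> P ys k n (\<lambda>_. \<theta>) \<sigma> \<tau>) - \<theta>)
      = (u \<bullet> (\<integral>z. ?w z *\<^sub>R ?X z \<partial>Q n)) / e" by simp
  also have "u \<bullet> (\<integral>z. ?w z *\<^sub>R ?X z \<partial>Q n) = (\<integral>z. u \<bullet> (?w z *\<^sub>R ?X z) \<partial>Q n)"
    using iX by (simp del: inner_scaleR_right)
  finally show ?thesis by (simp add: e_def)
qed

lemma cond_law_covariance:
  assumes m: "m \<le> n" "m \<le> N"
    and obs: "\<And>t. obs_density P ys k n t = likelihood P ys m t"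
    and W: "AE z in Q n. \<bar>wt m n \<theta> \<sigma> \<tau> z - 1\<bar> \<le> d" "0 \<le> d" "d \<le> 1 / 2"
    and s: "0 \<le> \<sigma>" "\<sigma> \<le> \<tau>"
  defines "E \<equiv> \<lambda>f. (\<integral>z. wt m n \<theta> \<sigma> \<tau> z * f z \<partial>Q n) / (\<integral>z. wt m n \<theta> \<sigma> \<tau> z \<partial>Q n)"
  shows "cov_matrix (cond_law \<kappa> P ys k n (\<lambda>_. \<theta>) \<sigma> \<tau>) (\<lambda>t. t n) $ p $ q
    = E (\<lambda>z. disp \<sigma> \<tau> n z $ p * disp \<sigma> \<tau> n z $ q)
      - E (\<lambda>z. disp \<sigma> \<tau> n z $ p) * E (\<lambda>z. disp \<sigma> \<tau> n z $ q)"
proof -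
  let ?w = "wt m n \<theta> \<sigma> \<tau>" and ?X = "\<lambda>p z. disp \<sigma> \<tau> n z $ p" and ?r = "rho n * \<tau>"
  let ?C = "cond_law \<kappa> P ys k n (\<lambda>_. \<theta>) \<sigma> \<tau>"
  define \<mu> where "\<mu> = (\<integral>t. t n \<partial>?C)"
  define e where "e = (\<integral>z. ?w z \<partial>Q n)"
  note wm [measurable] = measurable_wt[OF m(2,1), of \<theta> \<sigma> \<tau>]
  have r: "0 \<le> ?r" using rho_pos[of n] s by simp
  note i = integral_weight(1)[OF wm W(1,2)]
  have e: "0 < e" using integral_weight(2)[OF wm W(1,2)] W(3) by (simp add: e_def)
  have nth: "(\<lambda>x. x $ p) \<in> borel_measurable (borel :: (real ^ 'p) measure)" for p
    by (intro borel_measurable_continuous_onI continuous_on_component continuous_on_id)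
  have Xm [measurable]: "?X p \<in> borel_measurable (Q n)" for p
    by (rule measurable_compose[OF _ nth]) simp
  have X: "AE z in Q n. \<forall>p. \<bar>?X p z\<bar> \<le> ?r"
    using AE_disp[OF s, of n] by eventually_elim (meson component_le_norm_cart order_refl order_trans)
  have i1: "integrable (Q n) (\<lambda>z. ?w z * ?X p z)" for p
  proof (rule integrable_Q_bounded[where B = "(1 + d) * ?r"])
    show "AE z in Q n. norm (?w z * ?X p z) \<le> (1 + d) * ?r"
      using W(1) X
    proof eventually_elim
      case (elim z)
      show ?case unfolding real_norm_def abs_mult
        using elim r by (intro mult_mono) auto
    qed
  qed measurable
  have i2: "integrable (Q n) (\<lambda>z. ?w z * (?X p z * ?X q z))"
  proof (rule integrable_Q_bounded[where B = "(1 + d) * (?r * ?r)"])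
    show "AE z in Q n. norm (?w z * (?X p z * ?X q z)) \<le> (1 + d) * (?r * ?r)"
      using W(1) X
    proof eventually_elim
      case (elim z)
      show ?case unfolding real_norm_def abs_mult
        using elim r by (intro mult_mono) auto
    qed
  qed measurable
  have \<mu>: "\<mu> $ p = \<theta> $ p + E (?X p)" for p
    using cond_law_mean[OF m obs W s, of "axis p 1"] by (simp add: inner_axis' \<mu>_def E_def)
  have comp: "(\<lambda>t. t n) \<in> measurable (PiM {..n} (\<lambda>_. borel)) (borel :: (real ^ 'p) measure)" by simp
  have gm: "(\<lambda>t. (t n $ p - \<mu> $ p) * (t n $ q - \<mu> $ q)) \<in> borel_measurable (PiM {..n} (\<lambda>_. borel))"
    by (intro borel_measurable_times borel_measurable_diff borel_measurable_const
        measurable_compose[OF comp nth])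
  have "cov_matrix ?C (\<lambda>t. t n) $ p $ q = (\<integral>t. (t n $ p - \<mu> $ p) * (t n $ q - \<mu> $ q) \<partial>?C)"
    by (simp add: cov_matrix_def \<mu>_def)
  also have "\<dots> = (\<integral>z. (?w z / e) *\<^sub>R ((pert n \<theta> \<sigma> \<tau> z n $ p - \<mu> $ p) * (pert n \<theta> \<sigma> \<tau> z n $ q - \<mu> $ q)) \<partial>Q n)"
    unfolding e_def by (rule cond_law_integral[OF m obs i e[unfolded e_def] gm])
  also have "\<dots> = (\<integral>z. (1 / e) * (?w z * (?X p z * ?X q z) - E (?X q) * (?w z * ?X p z)
      - E (?X p) * (?w z * ?X q z) + E (?X p) * E (?X q) * ?w z) \<partial>Q n)"
    by (simp add: pert_def \<mu> algebra_simps)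
  also have "\<dots> = (1 / e) * ((\<integral>z. ?w z * (?X p z * ?X q z) \<partial>Q n) - E (?X q) * (\<integral>z. ?w z * ?X p z \<partial>Q n)
      - E (?X p) * (\<integral>z. ?w z * ?X q z \<partial>Q n) + E (?X p) * E (?X q) * e)"
    using i i1 i2 by (simp add: e_def)
  also have "\<dots> = E (\<lambda>z. ?X p z * ?X q z) - E (?X q) * E (?X p) - E (?X p) * E (?X q) + E (?X p) * E (?X q)"
    using e by (simp add: E_def e_def[symmetric] field_simps)
  finally show ?thesis by simp
qed

text \<open>The gradient of the log likelihood at time \<open>m\<close> with respect to the parameter at time \<open>i\<close>,
  extended by \<open>0\<close> to \<open>i > m\<close> and to the log likelihood without observations, which is \<open>0\<close>.\<close>

definition part :: "nat \<Rightarrow> nat \<Rightarrow> real ^ 'p \<Rightarrow> real ^ 'p" where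
  "part m i \<theta> = (if 1 \<le> m \<and> i \<le> m then pgrad i (loglik_tv P ys m) (\<lambda>_. \<theta>) else 0)"

lemma rho_mono: "n \<le> n' \<Longrightarrow> rho n \<le> rho n'"
  unfolding rho_def using radius(1) by (intro mult_right_mono) auto

lemma wt_expansion:
  assumes diff: "\<And>n. n \<in> {1..N} \<Longrightarrow> tuple_twice_differentiable n (loglik_tv P ys n)"
    and grad: "\<And>n K i. \<lbrakk>n \<in> {1..N}; compactin (product_topology (\<lambda>_. euclidean) {..n}) K; i \<le> n\<rbrakk>
        \<Longrightarrow> bdd_above ((\<lambda>\<theta>. norm (pgrad i (loglik_tv P ys n) \<theta>)) ` K)"
    and hess: "\<And>n K i. \<lbrakk>n \<in> {1..N}; compactin (product_topology (\<lambda>_. euclidean) {..n}) K; i \<le> n\<rbrakk>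
        \<Longrightarrow> bdd_above ((\<lambda>\<theta>. eig_norm (phess i (loglik_tv P ys n) \<theta>)) ` K)"
    and mixed: "\<And>n K i j. \<lbrakk>n \<in> {1..N}; compactin (product_topology (\<lambda>_. euclidean) {..n}) K;
          i \<le> n; j \<le> n; i \<noteq> j\<rbrakk>
        \<Longrightarrow> bdd_above ((\<lambda>\<theta>. onorm (pmixed j i (loglik_tv P ys n) \<theta>)) ` K)"
    and K4: "bounded K4"
  shows "\<exists>C\<ge>0. (\<forall>\<theta>\<in>K4. \<forall>m\<le>N. \<forall>i. norm (part m i \<theta>) \<le> C) \<and>
    (\<forall>\<theta>\<in>K4. \<forall>m n \<sigma> \<tau>. m \<le> n \<longrightarrow> n \<le> N \<longrightarrow> 0 \<le> \<sigma> \<longrightarrow> \<sigma> \<le> \<tau> \<longrightarrow> \<tau> \<le> 1 \<longrightarrow>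
      (AE z in Q n. \<bar>wt m n \<theta> \<sigma> \<tau> z - 1 - (\<Sum>i\<le>n. disp \<sigma> \<tau> i z \<bullet> part m i \<theta>)\<bar> \<le> C * (rho n * \<tau>)\<^sup>2))"
proof -
  let ?l = "\<lambda>m. loglik_tv P ys m"
  define B where "B m C \<longleftrightarrow> 0 \<le> C \<and> (\<forall>\<theta>\<in>K4. \<forall>i\<le>m. norm (pgrad i (?l m) (\<lambda>_. \<theta>)) \<le> C) \<and>
      (\<forall>\<theta>\<in>K4. \<forall>h r. 0 \<le> r \<longrightarrow> r \<le> rho N \<longrightarrow> (\<forall>i\<le>m. norm (h i) \<le> r) \<longrightarrow>
       \<bar>exp (?l m (\<lambda>i. \<theta> + h i) - ?l m (\<lambda>_. \<theta>)) - 1 - (\<Sum>i\<le>m. h i \<bullet> pgrad i (?l m) (\<lambda>_. \<theta>))\<bar> \<le> C * r\<^sup>2)"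
    for m C
  have "\<exists>C. B m C" if m: "m \<in> {1..N}" for m
    unfolding B_def
    by (rule exp_expansion_uniform[OF diff[OF m] depends_upto_loglik_tv grad[OF m] hess[OF m] mixed[OF m] K4 rho_pos])
  then have "\<forall>m\<in>{1..N}. \<exists>C. B m C" by (rule ballI)
  then obtain Cf where B: "\<forall>m\<in>{1..N}. B m (Cf m)" by (rule bchoice[THEN exE])
  have Cf1: "0 \<le> Cf m" if "m \<in> {1..N}" for m
    using bspec[OF B that] unfolding B_def by (rule conjunct1)
  have Cf2: "norm (pgrad i (?l m) (\<lambda>_. \<theta>)) \<le> Cf m" if "m \<in> {1..N}" "\<theta> \<in> K4" "i \<le> m" for m \<theta> i
    using bspec[OF B that(1)] that(2,3) unfolding B_def by simp
  have Cf3: "\<bar>exp (?l m (\<lambda>i. \<theta> + h i) - ?l m (\<lambda>_. \<theta>)) - 1 - (\<Sum>i\<le>m. h i \<bullet> pgrad i (?l m) (\<lambda>_. \<theta>))\<bar>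
      \<le> Cf m * r\<^sup>2"
    if "m \<in> {1..N}" "\<theta> \<in> K4" "0 \<le> r" "r \<le> rho N" "\<forall>i\<le>m. norm (h i) \<le> r" for m \<theta> h r
    using bspec[OF B that(1)] that(2-) unfolding B_def by simp
  define C where "C = (\<Sum>m\<in>{1..N}. Cf m)"
  have C: "0 \<le> C" unfolding C_def by (rule sum_nonneg) (rule Cf1)
  have le: "Cf m \<le> C" if "m \<in> {1..N}" for m
    unfolding C_def by (rule member_le_sum) (use that Cf1 in auto)
  show ?thesis
  proof (intro exI[of _ C] conjI ballI allI impI C)
    fix \<theta> m i assume "\<theta> \<in> K4" "m \<le> N"
    then show "norm (part m i \<theta>) \<le> C"
      using Cf2[of m \<theta> i] le[of m] C by (auto simp: part_def)
  next
    fix \<theta> and m n :: nat and \<sigma> \<tau> :: real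
    assume \<theta>: "\<theta> \<in> K4" and m: "m \<le> n" "n \<le> N" and s: "0 \<le> \<sigma>" "\<sigma> \<le> \<tau>" "\<tau> \<le> 1"
    have "rho n * \<tau> \<le> rho n * 1" using rho_pos[of n] s by (intro mult_left_mono) auto
    then have r: "0 \<le> rho n * \<tau>" "rho n * \<tau> \<le> rho N"
      using rho_mono[OF m(2)] rho_pos[of n] s by auto
    show "AE z in Q n. \<bar>wt m n \<theta> \<sigma> \<tau> z - 1 - (\<Sum>i\<le>n. disp \<sigma> \<tau> i z \<bullet> part m i \<theta>)\<bar> \<le> C * (rho n * \<tau>)\<^sup>2"
    proof (cases "m = 0")
      case True
      then show ?thesis using C by (simp add: wt_def lk_def likelihood_0 part_def)
    next
      case False
      then have mN: "m \<in> {1..N}" using m by auto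
      show ?thesis
        using AE_disp[OF s(1,2), of n]
      proof eventually_elim
        case (elim z)
        have "?l m (pert n \<theta> \<sigma> \<tau> z) = ?l m (\<lambda>i. \<theta> + disp \<sigma> \<tau> i z)"
          by (rule depends_uptoD[OF depends_upto_loglik_tv]) (use m in \<open>simp add: pert_def\<close>)
        then have "wt m n \<theta> \<sigma> \<tau> z = exp (?l m (\<lambda>i. \<theta> + disp \<sigma> \<tau> i z) - ?l m (\<lambda>_. \<theta>))"
          using mN by (simp add: wt_def lk_exp exp_diff)
        moreover have "(\<Sum>i\<le>n. disp \<sigma> \<tau> i z \<bullet> part m i \<theta>)
            = (\<Sum>i\<le>m. disp \<sigma> \<tau> i z \<bullet> pgrad i (?l m) (\<lambda>_. \<theta>))"
          using m False by (intro sum.mono_neutral_cong_right) (auto simp: part_def)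
        moreover have "\<bar>exp (?l m (\<lambda>i. \<theta> + disp \<sigma> \<tau> i z) - ?l m (\<lambda>_. \<theta>)) - 1
            - (\<Sum>i\<le>m. disp \<sigma> \<tau> i z \<bullet> pgrad i (?l m) (\<lambda>_. \<theta>))\<bar> \<le> Cf m * (rho n * \<tau>)\<^sup>2"
          by (rule Cf3[OF mN \<theta> r]) (use elim m in auto)
        moreover have "Cf m * (rho n * \<tau>)\<^sup>2 \<le> C * (rho n * \<tau>)\<^sup>2"
          using le[OF mN] by (intro mult_right_mono) auto
        ultimately show ?case by linarith
      qed
    qed
  qed
qed

lemma filter_mean_estimate:
  assumes n: "n \<in> {1..N}" and s: "0 \<le> \<sigma>" "\<sigma> \<le> \<tau>" "0 < \<tau>" "\<tau> \<le> 1" and C: "0 \<le> C"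
    and W: "AE z in Q n. \<bar>wt n n \<theta> \<sigma> \<tau> z - 1 - (\<Sum>i\<le>n. disp \<sigma> \<tau> i z \<bullet> part n i \<theta>)\<bar> \<le> C * (rho n * \<tau>)\<^sup>2"
    and g: "\<And>i. norm (part n i \<theta>) \<le> C"
    and small: "dev_const n C * \<tau> \<le> 1 / 2"
  shows "norm ((1 / \<tau>\<^sup>2) *\<^sub>R (filter_mean \<kappa> P ys n \<theta> \<sigma> \<tau> - \<theta>) - Sig *v (\<Sum>i\<le>n. part n i \<theta>))
    \<le> filter_const n C * (\<tau> + \<sigma>\<^sup>2 / \<tau>\<^sup>2)"
proof (rule norm_le_if_inner_le)
  have c0: "0 \<le> filter_const n C"
    using mean_const_nonneg[OF C] dev_const_nonneg[OF C] snorm_nonneg C by (simp add: filter_const_def)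
  then show "0 \<le> filter_const n C * (\<tau> + \<sigma>\<^sup>2 / \<tau>\<^sup>2)" using s by simp
  fix u :: "real ^ 'p"
  let ?G = "\<Sum>i\<le>n. part n i \<theta>" and ?f = "filter_mean \<kappa> P ys n \<theta> \<sigma> \<tau>"
  have nN: "n \<le> N" "n \<noteq> 0" using n by auto
  have d0: "0 \<le> dev_const n C * \<tau>" using dev_const_nonneg[OF C] s by simp
  note dev = weight_deviation[OF s(1,2,4) C W g]
  have "u \<bullet> (?f - \<theta>) = (\<integral>z. wt n n \<theta> \<sigma> \<tau> z * (u \<bullet> disp \<sigma> \<tau> n z) \<partial>Q n) / (\<integral>z. wt n n \<theta> \<sigma> \<tau> z \<partial>Q n)"
    using cond_law_mean[OF order_refl nN(1) obs_density_all dev d0 small s(1,2)] nN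
    by (simp add: filter_mean_def)
  then have *: "\<bar>u \<bullet> (?f - \<theta>) - \<tau>\<^sup>2 * (u \<bullet> (Sig *v ?G))\<bar> \<le> norm u * (filter_const n C * (\<tau> ^ 3 + \<sigma>\<^sup>2))"
    using weighted_mean[OF s(1,2,4) C measurable_wt[OF nN(1) order_refl] W g small, of u] by simp
  have "u \<bullet> ((1 / \<tau>\<^sup>2) *\<^sub>R (?f - \<theta>) - Sig *v ?G) = (u \<bullet> (?f - \<theta>) - \<tau>\<^sup>2 * (u \<bullet> (Sig *v ?G))) / \<tau>\<^sup>2"
    using s by (simp add: inner_diff_right diff_divide_distrib)
  also have "\<bar>\<dots>\<bar> \<le> norm u * (filter_const n C * (\<tau> ^ 3 + \<sigma>\<^sup>2)) / \<tau>\<^sup>2"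
    using * by (simp add: divide_right_mono)
  also have "\<dots> = norm u * (filter_const n C * (\<tau> + \<sigma>\<^sup>2 / \<tau>\<^sup>2))"
    using s by (simp add: field_simps power2_eq_square power3_eq_cube)
  finally show "\<bar>u \<bullet> ((1 / \<tau>\<^sup>2) *\<^sub>R (?f - \<theta>) - Sig *v ?G)\<bar> \<le> norm u * (filter_const n C * (\<tau> + \<sigma>\<^sup>2 / \<tau>\<^sup>2))" .
qed

lemma pred_var_estimate:
  assumes m: "Suc m \<le> N" and s: "0 \<le> \<sigma>" "\<sigma> \<le> \<tau>" "0 < \<tau>" "\<tau> \<le> 1" and C: "0 \<le> C"
    and W: "AE z in Q (Suc m). \<bar>wt m (Suc m) \<theta> \<sigma> \<tau> z - 1 - (\<Sum>i\<le>Suc m. disp \<sigma> \<tau> i z \<bullet> part m i \<theta>)\<bar>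
      \<le> C * (rho (Suc m) * \<tau>)\<^sup>2"
    and g: "\<And>i. norm (part m i \<theta>) \<le> C"
    and small: "dev_const (Suc m) C * \<tau> \<le> 1 / 2"
  shows "\<bar>((1 / \<tau>\<^sup>2) *\<^sub>R pred_var \<kappa> P ys (Suc m) \<theta> \<sigma> \<tau>) $ p $ q - Sig $ p $ q\<bar>
    \<le> cov_const (Suc m) (dev_const (Suc m) C) * (\<tau> + \<sigma>\<^sup>2 / \<tau>\<^sup>2)"
proof -
  let ?V = "pred_var \<kappa> P ys (Suc m) \<theta> \<sigma> \<tau>"
  have mN: "m \<le> Suc m" "m \<le> N" using m by auto
  have c0: "0 \<le> dev_const (Suc m) C" using C by (rule dev_const_nonneg)
  then have d0: "0 \<le> dev_const (Suc m) C * \<tau>" using s by simp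
  note dev = weight_deviation[OF s(1,2,4) C W g]
  note cv = cond_law_covariance[OF mN obs_density_all_but_last[OF m] dev d0 small s(1,2), of p q]
  have "\<bar>?V $ p $ q - \<tau>\<^sup>2 * Sig $ p $ q\<bar> \<le> cov_const (Suc m) (dev_const (Suc m) C) * (\<tau> ^ 3 + \<sigma>\<^sup>2)"
    using weighted_covariance[OF s(1,2,4) c0 measurable_wt[OF mN(2,1)] dev small, of p q] cv
    by (simp add: pred_var_def)
  then have "\<bar>(?V $ p $ q - \<tau>\<^sup>2 * Sig $ p $ q) / \<tau>\<^sup>2\<bar>
      \<le> cov_const (Suc m) (dev_const (Suc m) C) * (\<tau> ^ 3 + \<sigma>\<^sup>2) / \<tau>\<^sup>2"
    by (simp add: divide_right_mono)
  also have "\<dots> = cov_const (Suc m) (dev_const (Suc m) C) * (\<tau> + \<sigma>\<^sup>2 / \<tau>\<^sup>2)"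
    using s by (simp add: field_simps power2_eq_square power3_eq_cube)
  also have "(?V $ p $ q - \<tau>\<^sup>2 * Sig $ p $ q) / \<tau>\<^sup>2 = ((1 / \<tau>\<^sup>2) *\<^sub>R ?V) $ p $ q - Sig $ p $ q"
    using s by (simp add: diff_divide_distrib)
  finally show ?thesis .
qed

end

section \<open>Approximation of the gradient of the log likelihood\<close>

lemma sum_telescope_atLeast1:
  fixes f :: "nat \<Rightarrow> 'a::ab_group_add"
  shows "(\<Sum>n\<in>{1..N}. f n - f (n - 1)) = f N - f 0"
  by (induction N) auto

theorem theorem3:
  fixes N :: nat
    and MX :: "'x measure" and MY :: "'y measure"
    and P :: "(real ^ 'p::finite, 'x, 'y) pomp"
    and ys :: "nat \<Rightarrow> 'y"
    and \<kappa> :: "real ^ 'p \<Rightarrow> real"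
    and \<Sigma> :: "real ^ 'p ^ 'p"
    and \<sigma> :: "real \<Rightarrow> real"
    and K4 :: "(real ^ 'p) set"
  assumes N: "1 \<le> N"
    and model: "pomp_model N MX MY P"
    and data: "\<And>k. k \<in> {1..N} \<Longrightarrow> ys k \<in> space MY"
    and kernel: "perturbation_density \<kappa>"
    and cov: "\<Sigma> = cov_matrix (density lborel \<kappa>) (\<lambda>z. z)"
    and lik: "\<And>n \<theta>. n \<in> {1..N} \<Longrightarrow> 0 < likelihood P ys n \<theta> \<and> likelihood P ys n \<theta> < \<infinity>"
    and diff: "\<And>n. n \<in> {1..N} \<Longrightarrow> tuple_twice_differentiable n (loglik_tv P ys n)"
    and grad: "\<And>n K i. \<lbrakk>n \<in> {1..N}; compactin (product_topology (\<lambda>_. euclidean) {..n}) K; i \<le> n\<rbrakk>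
        \<Longrightarrow> bdd_above ((\<lambda>\<theta>. norm (pgrad i (loglik_tv P ys n) \<theta>)) ` K)"
    and hess: "\<And>n K i. \<lbrakk>n \<in> {1..N}; compactin (product_topology (\<lambda>_. euclidean) {..n}) K; i \<le> n\<rbrakk>
        \<Longrightarrow> bdd_above ((\<lambda>\<theta>. eig_norm (phess i (loglik_tv P ys n) \<theta>)) ` K)"
    and mixed: "\<And>n K i j. \<lbrakk>n \<in> {1..N}; compactin (product_topology (\<lambda>_. euclidean) {..n}) K;
          i \<le> n; j \<le> n; i \<noteq> j\<rbrakk>
        \<Longrightarrow> bdd_above ((\<lambda>\<theta>. onorm (pmixed j i (loglik_tv P ys n) \<theta>)) ` K)"
    and sigma_pos: "\<And>\<tau>. 0 < \<tau> \<Longrightarrow> 0 < \<sigma> \<tau>"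
    and sigma_lim: "((\<lambda>\<tau>. \<sigma> \<tau> / \<tau>) \<longlongrightarrow> 0) (at_right 0)"
    and K4: "compact K4"
  shows "invertible \<Sigma> \<and>
    (\<exists>C9 :: real. \<forall>\<^sub>F \<tau> in at_right 0.
      (\<forall>\<theta>\<in>K4.
        norm ((1 / \<tau>\<^sup>2) *\<^sub>R (matrix_inv \<Sigma> *v (filter_mean \<kappa> P ys N \<theta> (\<sigma> \<tau>) \<tau> - \<theta>))
              - gradient (loglik P ys N) \<theta>)
        \<le> C9 * (\<tau> + (\<sigma> \<tau>)\<^sup>2 / \<tau>\<^sup>2)) \<and>
      (\<forall>\<theta>\<in>K4.
        (\<forall>n\<in>{1..N}. invertible (pred_var \<kappa> P ys n \<theta> (\<sigma> \<tau>) \<tau>)) \<and>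
        norm ((\<Sum>n\<in>{1..N}. matrix_inv (pred_var \<kappa> P ys n \<theta> (\<sigma> \<tau>) \<tau>)
                 *v (filter_mean \<kappa> P ys n \<theta> (\<sigma> \<tau>) \<tau> - filter_mean \<kappa> P ys (n - 1) \<theta> (\<sigma> \<tau>) \<tau>))
              - gradient (loglik P ys N) \<theta>)
        \<le> C9 * (\<tau> + (\<sigma> \<tau>)\<^sup>2 / \<tau>\<^sup>2)))"
proof -
  interpret perturbed_pomp \<kappa> N MX MY P ys
    using kernel model data lik by unfold_locales auto
  have \<Sigma>: "\<Sigma> = Sig" by (simp add: cov Sig_def D_def)
  have "\<exists>C\<ge>0. (\<forall>\<theta>\<in>K4. \<forall>m\<le>N. \<forall>i. norm (part m i \<theta>) \<le> C) \<and>
    (\<forall>\<theta>\<in>K4. \<forall>m n \<sigma> \<tau>. m \<le> n \<longrightarrow> n \<le> N \<longrightarrow> 0 \<le> \<sigma> \<longrightarrow> \<sigma> \<le> \<tau> \<longrightarrow> \<tau> \<le> 1 \<longrightarrow>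
      (AE z in Q n. \<bar>wt m n \<theta> \<sigma> \<tau> z - 1 - (\<Sum>i\<le>n. disp \<sigma> \<tau> i z \<bullet> part m i \<theta>)\<bar> \<le> C * (rho n * \<tau>)\<^sup>2))"
    by (rule wt_expansion[OF diff grad hess mixed compact_imp_bounded[OF K4]])
  then obtain C where C: "0 \<le> C"
    and part': "\<forall>\<theta>\<in>K4. \<forall>m\<le>N. \<forall>i. norm (part m i \<theta>) \<le> C"
    and W': "\<forall>\<theta>\<in>K4. \<forall>m n \<sigma> \<tau>. m \<le> n \<longrightarrow> n \<le> N \<longrightarrow> 0 \<le> \<sigma> \<longrightarrow> \<sigma> \<le> \<tau> \<longrightarrow> \<tau> \<le> 1 \<longrightarrow>
      (AE z in Q n. \<bar>wt m n \<theta> \<sigma> \<tau> z - 1 - (\<Sum>i\<le>n. disp \<sigma> \<tau> i z \<bullet> part m i \<theta>)\<bar> \<le> C * (rho n * \<tau>)\<^sup>2)"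
    by (elim exE conjE) (rule that)
  have part_le: "norm (part m i \<theta>) \<le> C" if "\<theta> \<in> K4" "m \<le> N" for m i \<theta>
    using part' that by simp
  have W: "AE z in Q n. \<bar>wt m n \<theta> \<sigma> \<tau> z - 1 - (\<Sum>i\<le>n. disp \<sigma> \<tau> i z \<bullet> part m i \<theta>)\<bar> \<le> C * (rho n * \<tau>)\<^sup>2"
    if "\<theta> \<in> K4" "m \<le> n" "n \<le> N" "0 \<le> \<sigma>" "\<sigma> \<le> \<tau>" "\<tau> \<le> 1" for \<theta> m n \<sigma> \<tau>
    using W' that by simp
  from inverse_perturbation[OF invertible_Sig]
  obtain d c where d: "0 < d" and c: "0 \<le> c"
    and inv: "\<forall>B e. (\<forall>i j. \<bar>B $ i $ j - Sig $ i $ j\<bar> \<le> e) \<longrightarrow> e \<le> d \<longrightarrow>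
       invertible B \<and> (\<forall>y. norm (y - matrix_inv Sig *v (B *v y)) \<le> c * e * norm (B *v y))"
    by (elim exE conjE) (rule that)
  define k where "k = onorm ((*v) (matrix_inv Sig))"
  have k: "0 \<le> k" unfolding k_def by (rule onorm_pos_le) simp
  have kn: "norm (matrix_inv Sig *v x) \<le> k * norm x" for x unfolding k_def by (rule onorm) simp
  have sn: "norm (Sig *v x) \<le> snorm * norm x" for x unfolding snorm_def by (rule onorm) simp
  define dv where "dv = (\<Sum>n\<le>N. dev_const n C)"
  define fc where "fc = (\<Sum>n\<le>N. filter_const n C)"
  define cc where "cc = (\<Sum>n\<le>N. cov_const n (dev_const n C))"
  have dn: "0 \<le> dev_const n C" for n using C by (rule dev_const_nonneg)
  have fn: "0 \<le> filter_const n C" for n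
    using mean_const_nonneg[OF C, of n] dn[of n] snorm_nonneg C by (simp add: filter_const_def)
  have cn: "0 \<le> cov_const n (dev_const n C)" for n using dn by (rule cov_const_nonneg)
  have dvl: "dev_const n C \<le> dv" and fcl: "filter_const n C \<le> fc"
    and ccl: "cov_const n (dev_const n C) \<le> cc" if "n \<le> N" for n
    unfolding dv_def fc_def cc_def using that by (auto intro!: member_le_sum dn fn cn)
  have fc0: "0 \<le> fc" and cc0: "0 \<le> cc" unfolding fc_def cc_def by (auto intro!: sum_nonneg fn cn)
  \<comment> \<open>\<open>e\<close> is the claimed rate, and \<open>G n \<theta>\<close> is the gradient at \<open>\<theta>\<close> of the log likelihood at time \<open>n\<close>.\<close>
  define e where "e \<tau> = \<tau> + (\<sigma> \<tau>)\<^sup>2 / \<tau>\<^sup>2" for \<tau>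
  define G where "G n \<theta> = (\<Sum>i\<le>n. part n i \<theta>)" for n \<theta>
  define g where "g = (real N + 1) * C"
  have G0: "G 0 \<theta> = 0" for \<theta> by (simp add: G_def part_def)
  have Gb: "norm (G n \<theta>) \<le> g" if "\<theta> \<in> K4" "n \<le> N" for n \<theta>
  proof -
    have "norm (G n \<theta>) \<le> of_nat (card {..n}) * C"
      unfolding G_def by (rule sum_norm_bound) (use part_le that in auto)
    also have "\<dots> \<le> g" unfolding g_def using that C by (intro mult_right_mono) auto
    finally show ?thesis .
  qed
  have grad_G: "gradient (loglik P ys N) \<theta> = G N \<theta>" for \<theta>
  proof -
    have "tuple_differentiable N (loglik_tv P ys N) (\<lambda>_. \<theta>)"
      using diff[of N] N by (auto simp: tuple_twice_differentiable_def)
    from gradient_diagonal[OF this depends_upto_loglik_tv] show ?thesis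
      using N by (simp add: loglik_def[abs_def] G_def part_def)
  qed
  have e_lim: "(e \<longlongrightarrow> 0) (at_right 0)"
  proof -
    have "((\<lambda>\<tau>. \<tau> + (\<sigma> \<tau> / \<tau>)\<^sup>2) \<longlongrightarrow> 0 + 0\<^sup>2) (at_right 0)"
      by (intro tendsto_intros sigma_lim)
    then show ?thesis by (simp add: e_def[abs_def] power_divide)
  qed
  have ev: "\<forall>\<^sub>F \<tau> in at_right 0. 0 < \<tau> \<and> \<tau> \<le> 1 \<and> \<sigma> \<tau> / \<tau> < 1 \<and> dv * \<tau> < 1 / 2 \<and> e \<tau> < 1 \<and> cc * e \<tau> < d"
  proof (intro eventually_conj)
    show "\<forall>\<^sub>F \<tau> in at_right 0. 0 < (\<tau>::real)" by (simp add: eventually_at_right_less)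
    show "\<forall>\<^sub>F \<tau> in at_right 0. (\<tau>::real) \<le> 1"
      by (rule eventually_mono[OF eventually_at_right_real[of 0 1]]) auto
    show "\<forall>\<^sub>F \<tau> in at_right 0. \<sigma> \<tau> / \<tau> < 1" by (rule order_tendstoD(2)[OF sigma_lim]) simp
    have "((\<lambda>\<tau>. dv * \<tau>) \<longlongrightarrow> dv * 0) (at_right 0)" by (intro tendsto_intros)
    then show "\<forall>\<^sub>F \<tau> in at_right 0. dv * \<tau> < 1 / 2" by (rule order_tendstoD(2)) simp
    show "\<forall>\<^sub>F \<tau> in at_right 0. e \<tau> < 1" by (rule order_tendstoD(2)[OF e_lim]) simp
    have "((\<lambda>\<tau>. cc * e \<tau>) \<longlongrightarrow> cc * 0) (at_right 0)" by (intro tendsto_intros e_lim)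
    then show "\<forall>\<^sub>F \<tau> in at_right 0. cc * e \<tau> < d" by (rule order_tendstoD(2)) (use d in simp)
  qed
  define b where "b = 2 * fc + snorm * (2 * g)"
  define C9 where "C9 = k * fc + real N * (c * cc * b + k * (2 * fc))"
  have g0: "0 \<le> g" using C by (simp add: g_def)
  have b0: "0 \<le> b" using fc0 snorm_nonneg g0 by (simp add: b_def)
  have main: "norm ((1 / \<tau>\<^sup>2) *\<^sub>R (matrix_inv \<Sigma> *v (filter_mean \<kappa> P ys N \<theta> (\<sigma> \<tau>) \<tau> - \<theta>))
              - gradient (loglik P ys N) \<theta>) \<le> C9 * e \<tau>" (is ?first)
    "n \<in> {1..N} \<Longrightarrow> invertible (pred_var \<kappa> P ys n \<theta> (\<sigma> \<tau>) \<tau>)" (is "_ \<Longrightarrow> ?invertible n")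
    "norm ((\<Sum>n\<in>{1..N}. matrix_inv (pred_var \<kappa> P ys n \<theta> (\<sigma> \<tau>) \<tau>)
                 *v (filter_mean \<kappa> P ys n \<theta> (\<sigma> \<tau>) \<tau> - filter_mean \<kappa> P ys (n - 1) \<theta> (\<sigma> \<tau>) \<tau>))
              - gradient (loglik P ys N) \<theta>) \<le> C9 * e \<tau>" (is ?second)
    if t: "0 < \<tau> \<and> \<tau> \<le> 1 \<and> \<sigma> \<tau> / \<tau> < 1 \<and> dv * \<tau> < 1 / 2 \<and> e \<tau> < 1 \<and> cc * e \<tau> < d" and \<theta>: "\<theta> \<in> K4"
    for \<tau> \<theta> n
  proof -
    have \<tau>: "0 < \<tau>" "\<tau> \<le> 1" and st: "0 \<le> \<sigma> \<tau>" "\<sigma> \<tau> \<le> \<tau>"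
      using t sigma_pos[of \<tau>] by (auto simp: divide_less_eq_1)
    have e0: "0 \<le> e \<tau>" and e1: "e \<tau> \<le> 1" and ed: "cc * e \<tau> \<le> d" using t by (auto simp: e_def)
    have small: "dev_const n C * \<tau> \<le> 1 / 2" if "n \<le> N" for n
      using mult_right_mono[OF dvl[OF that], of \<tau>] t by linarith
    let ?f = "\<lambda>n. filter_mean \<kappa> P ys n \<theta> (\<sigma> \<tau>) \<tau>" and ?V = "\<lambda>n. pred_var \<kappa> P ys n \<theta> (\<sigma> \<tau>) \<tau>"
    \<comment> \<open>The rescaled filtering mean approximates \<open>Sig *v G n \<theta>\<close>, including at \<open>n = 0\<close>, where both vanish.\<close>
    define a where "a n = (1 / \<tau>\<^sup>2) *\<^sub>R (?f n - \<theta>)" for n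
    have a: "norm (a n - Sig *v G n \<theta>) \<le> fc * e \<tau>" if n: "n \<le> N" for n
    proof (cases "n = 0")
      case True
      then show ?thesis using fc0 e0 by (simp add: a_def filter_mean_def G0)
    next
      case False
      have "norm (a n - Sig *v G n \<theta>) \<le> filter_const n C * e \<tau>"
        unfolding a_def G_def e_def
        by (rule filter_mean_estimate[OF _ st \<tau> C W[OF \<theta> order_refl n st \<tau>(2)] _ small[OF n]])
          (use n False part_le \<theta> in auto)
      also have "\<dots> \<le> fc * e \<tau>" using fcl[OF n] e0 by (rule mult_right_mono)
      finally show ?thesis .
    qed
    have "(1 / \<tau>\<^sup>2) *\<^sub>R (matrix_inv \<Sigma> *v (?f N - \<theta>)) - gradient (loglik P ys N) \<theta>
        = matrix_inv Sig *v (a N - Sig *v G N \<theta>)"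
      by (simp add: \<Sigma> a_def grad_G matrix_vector_mult_diff_distrib matrix_vector_mult_scaleR
          matrix_inv_apply[OF invertible_Sig])
    also have "norm \<dots> \<le> k * (fc * e \<tau>)"
      using kn mult_left_mono[OF a[OF order_refl] k] by (rule order_trans)
    also have "\<dots> = (k * fc) * e \<tau>" by simp
    also have "\<dots> \<le> C9 * e \<tau>"
      using e0 c cc0 b0 k fc0 by (intro mult_right_mono) (auto simp: C9_def)
    finally show ?first .

    \<comment> \<open>The rescaled prediction variance is close to \<open>Sig\<close>.\<close>
    have B: "invertible ((1 / \<tau>\<^sup>2) *\<^sub>R ?V n) \<and> (\<forall>y. norm (y - matrix_inv Sig *v (((1 / \<tau>\<^sup>2) *\<^sub>R ?V n) *v y))
        \<le> c * (cc * e \<tau>) * norm (((1 / \<tau>\<^sup>2) *\<^sub>R ?V n) *v y))" if n: "n \<in> {1..N}" for n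
    proof (rule inv[rule_format, OF _ ed])
      fix p q
      obtain m where m: "n = Suc m" "Suc m \<le> N" "m \<le> Suc m" "m \<le> N" using n by (cases n) auto
      have "\<bar>((1 / \<tau>\<^sup>2) *\<^sub>R ?V n) $ p $ q - Sig $ p $ q\<bar> \<le> cov_const n (dev_const n C) * e \<tau>"
        unfolding e_def m(1)
        by (rule pred_var_estimate[OF m(2) st \<tau> C W[OF \<theta> m(3,2) st \<tau>(2)] _ small[OF m(2)]])
          (rule part_le[OF \<theta> m(4)])
      also have "\<dots> \<le> cc * e \<tau>" using ccl[of n] n e0 by (intro mult_right_mono) auto
      finally show "\<bar>((1 / \<tau>\<^sup>2) *\<^sub>R ?V n) $ p $ q - Sig $ p $ q\<bar> \<le> cc * e \<tau>" .
    qed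
    have V: "invertible (?V n)" if n: "n \<in> {1..N}" for n
    proof -
      have "invertible (\<tau>\<^sup>2 *\<^sub>R ((1 / \<tau>\<^sup>2) *\<^sub>R ?V n))"
        by (rule scalar_invertible[OF _ conjunct1[OF B[OF n]]]) (use \<tau> in simp)
      then show ?thesis using \<tau> by simp
    qed
    then show "n \<in> {1..N} \<Longrightarrow> ?invertible n" .

    \<comment> \<open>Each summand is close to an increment of \<open>G\<close>, and the increments telescope.\<close>
    define y where "y n = matrix_inv (?V n) *v (?f n - ?f (n - 1))" for n
    have y: "norm (y n - (G n \<theta> - G (n - 1) \<theta>)) \<le> (c * cc * b + k * (2 * fc)) * e \<tau>" if n: "n \<in> {1..N}" for n
    proof -
      let ?B = "(1 / \<tau>\<^sup>2) *\<^sub>R ?V n" and ?H = "G n \<theta> - G (n - 1) \<theta>"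
      have nN: "n \<le> N" "n - 1 \<le> N" using n by auto
      have By: "?B *v y n = a n - a (n - 1)"
        unfolding y_def scaleR_matrix_vector_assoc[symmetric] matrix_inv_apply(1)[OF V[OF n]]
        by (simp add: a_def scaleR_diff_right)
      have eq: "a n - a (n - 1) - Sig *v ?H
          = (a n - Sig *v G n \<theta>) - (a (n - 1) - Sig *v G (n - 1) \<theta>)"
        by (simp add: matrix_vector_mult_diff_distrib)
      have "norm (a n - a (n - 1) - Sig *v ?H)
          \<le> norm (a n - Sig *v G n \<theta>) + norm (a (n - 1) - Sig *v G (n - 1) \<theta>)"
        unfolding eq by (rule norm_triangle_ineq4)
      then have aH: "norm (a n - a (n - 1) - Sig *v ?H) \<le> 2 * (fc * e \<tau>)"
        using a[OF nN(1)] a[OF nN(2)] by linarith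
      have "norm ?H \<le> 2 * g"
        using norm_triangle_ineq4[of "G n \<theta>" "G (n - 1) \<theta>"] Gb[OF \<theta> nN(1)] Gb[OF \<theta> nN(2)] by linarith
      then have "norm (Sig *v ?H) \<le> snorm * (2 * g)"
        using snorm_nonneg by (intro order_trans[OF sn] mult_left_mono)
      moreover have "fc * e \<tau> \<le> fc" using e1 fc0 by (simp add: mult_left_le)
      moreover have "norm (a n - a (n - 1)) \<le> norm (a n - a (n - 1) - Sig *v ?H) + norm (Sig *v ?H)"
        using norm_triangle_ineq[of "a n - a (n - 1) - Sig *v ?H" "Sig *v ?H"] by simp
      ultimately have ab: "norm (a n - a (n - 1)) \<le> b" using aH unfolding b_def by linarith
      have "norm (y n - matrix_inv Sig *v (?B *v y n)) \<le> c * (cc * e \<tau>) * norm (?B *v y n)"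
        using B[OF n] by blast
      also have "\<dots> \<le> c * (cc * e \<tau>) * b"
        unfolding By using ab c cc0 e0 by (intro mult_left_mono) auto
      finally have 1: "norm (y n - matrix_inv Sig *v (?B *v y n)) \<le> c * cc * b * e \<tau>" by (simp add: mult_ac)
      have "matrix_inv Sig *v (?B *v y n) - ?H = matrix_inv Sig *v (a n - a (n - 1) - Sig *v ?H)"
        unfolding By matrix_vector_mult_diff_distrib[of _ _ "Sig *v ?H"] matrix_inv_apply(2)[OF invertible_Sig] ..
      also have "norm \<dots> \<le> k * (2 * (fc * e \<tau>))"
        using kn mult_left_mono[OF aH k] by (rule order_trans)
      finally have 2: "norm (matrix_inv Sig *v (?B *v y n) - ?H) \<le> k * (2 * fc) * e \<tau>" by (simp add: mult_ac)
      show ?thesis unfolding distrib_right using 1 2 by (rule norm_diff_triangle_le)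
    qed
    have "(\<Sum>n\<in>{1..N}. y n) - G N \<theta> = (\<Sum>n\<in>{1..N}. y n - (G n \<theta> - G (n - 1) \<theta>))"
      unfolding sum_subtractf[of y] sum_telescope_atLeast1[of "\<lambda>n. G n \<theta>"] by (simp add: G0)
    also have "norm \<dots> \<le> of_nat (card {1..N}) * ((c * cc * b + k * (2 * fc)) * e \<tau>)"
      by (rule sum_norm_bound) (rule y)
    also have "\<dots> = real N * (c * cc * b + k * (2 * fc)) * e \<tau>" by simp
    also have "\<dots> \<le> C9 * e \<tau>"
      using e0 k fc0 by (intro mult_right_mono) (auto simp: C9_def)
    finally show ?second by (simp add: y_def grad_G)
  qed
  have "invertible \<Sigma>" using invertible_Sig by (simp add: \<Sigma>)
  then show ?thesis
    using main unfolding e_def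
    by (intro conjI exI[of _ C9] eventually_mono[OF ev[unfolded e_def]] ballI) blast+
qed

end
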